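(* For every $\delta>0$ there exists $\varepsilon>0$ such that the following holds for every sufficiently large $m$. Let $G$ be a graph with $m$ edges such that $G$ contains no clique of size $m^{1/2-\delta}$ (that is, no clique on at least $m^{1/2-\delta}$ vertices). Then $G$ has a cut of size at least $m/2+m^{1/2+\varepsilon}$.
   Context: Graphs are finite and simple. A cut in a graph $G$ is a partition $(U,V)$ of the vertex set together with all edges having exactly one endpoint in each of $U$ and $V$; its size is the number of these edges. "Sufficiently large $m$" means $m\ge m_0(\delta,\varepsilon)$. *)

theory Defs
  imports Complex_Main "HOL-Library.Ramsey"
begin

definition simple_graph :: "'a set \<Rightarrow> 'a set set \<Rightarrow> bool" where
  "simple_graph V E \<longleftrightarrow> finite V \<and> E \<subseteq> [V]\<^bsup>2\<^esup>"

text \<open>The two parts of a cut are ordered and may be empty. An empty part gives a cut of size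
  \<open>0\<close>, so admitting such partitions does not affect the existence of a cut of
  positive size.\<close>

definition is_cut :: "'a set \<Rightarrow> 'a set \<Rightarrow> 'a set \<Rightarrow> bool" where
  "is_cut V U W \<longleftrightarrow> U \<union> W = V \<and> U \<inter> W = {}"

definition cut_edges :: "'a set set \<Rightarrow> 'a set \<Rightarrow> 'a set \<Rightarrow> 'a set set" where
  "cut_edges E U W = {e \<in> E. card (e \<inter> U) = 1 \<and> card (e \<inter> W) = 1}"

definition cut_size :: "'a set set \<Rightarrow> 'a set \<Rightarrow> 'a set \<Rightarrow> nat" where
  "cut_size E U W = card (cut_edges E U W)"

end

(*
  Suppose that no cut exceeds m/2 by much. Disjoint stars give large cuts, so the graph has at most
  m^(1/2 + o(1)) non-isolated vertices and is therefore almost dense. Sign rounding turns the cut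
  hypothesis into a bound for the semidefinite relaxation, and duality gives a small diagonal D such that
  M = A + D is positive semidefinite, A being the adjacency matrix.

  Since A has entries 0 and 1, all entrywise powers of M agree with M off the diagonal. If Z is
  a low-rank matrix below M, then by the Schur product theorem its k-th entrywise power is below M up to a
  diagonal error, and comparing traces on its range shows that almost all diagonal entries of Z are close
  to 1. If Z also captures most of A, the Cauchy-Schwarz inequality makes the neighbourhood of a typical
  vertex much denser than the whole graph. A vertex set T maximizing |T| (density of T)^C thus has
  density close to 1. Entrywise cubes of M minus its mean direction finally force the complement to
  be sparse, and a greedy choice yields the clique.
*)
theory Submission
  imports Defs "HOL-Analysis.Analysis"
begin

section \<open>Positive semidefinite forms\<close>

text \<open>Two tensions fix the constants. Duality bounds the added diagonal only on average, so
  vertices with large entries are deleted, and the remaining entries are bounded only by a small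
  power \<open>K\<close> of the size. A k-th entrywise power raises a rank r to r^k, which must stay
  below the number n of vertices, yet its gain must outgrow \<open>K\<close>; for r a power of x and
  k about log n / log x the gain x^(\<eta> k) is a fixed small power of n, and \<open>K\<close> is
  kept below that. The maximized functional reflects the exchange rate of one passage to a
  neighbourhood: the size drops by a factor of order q^2 while the density q rises to about sqrt q,
  so a large exponent C makes the exchange profitable until q is close to 1. There the cubes take
  over: an odd power keeps the entries near -1 at non-edges negative, and if the non-edges have
  density s^2, then after discarding s n vertices the entries on edges are O(s), so the non-edge
  density drops to O(s^3), far below s^2. Only the diagonal contribution of order K^3 stops
  this.\<close>

definition qf :: "'a set \<Rightarrow> ('a \<Rightarrow> 'a \<Rightarrow> real) \<Rightarrow> ('a \<Rightarrow> real) \<Rightarrow> real" where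
  "qf T M x = (\<Sum>i\<in>T. \<Sum>j\<in>T. M i j * x i * x j)"

definition psd :: "'a set \<Rightarrow> ('a \<Rightarrow> 'a \<Rightarrow> real) \<Rightarrow> bool" where
  "psd T M \<longleftrightarrow> (\<forall>i\<in>T. \<forall>j\<in>T. M i j = M j i) \<and> (\<forall>x. 0 \<le> qf T M x)"

text \<open>The length of the list bounds the rank of the matrix; this is the only notion of rank
  used. A list admits repeated vectors, so concatenation is addition.\<close>

definition gram :: "('a \<Rightarrow> real) list \<Rightarrow> 'a \<Rightarrow> 'a \<Rightarrow> real" where
  "gram ys i j = (\<Sum>y\<leftarrow>ys. y i * y j)"

lemma gram_Nil [simp]: "gram [] i j = 0"
  and gram_Cons [simp]: "gram (y # ys) i j = y i * y j + gram ys i j"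
  by (simp_all add: gram_def)

lemma gram_append: "gram (ys @ zs) i j = gram ys i j + gram zs i j"
  by (simp add: gram_def)

lemma gram_commute: "gram ys i j = gram ys j i"
  by (induction ys) auto

lemma gram_diag_nonneg: "0 \<le> gram ys i i"
  by (induction ys) auto

lemma gram_products:
  "gram (concat (map (\<lambda>y. map (\<lambda>z i. y i * z i) zs) ys)) i j = gram ys i j * gram zs i j"
proof (induction ys)
  case (Cons y ys)
  have "gram (map (\<lambda>z i. y i * z i) zs) i j = y i * y j * gram zs i j"
    by (induction zs) (auto simp: algebra_simps)
  with Cons show ?case
    by (simp add: gram_append algebra_simps)
qed simp

text \<open>Tensor powers: the pointwise products of \<open>k\<close> vectors of the list have the
  \<open>k\<close>-th entrywise power as Gram matrix, so a rank r becomes at most r^k.\<close>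

lemma gram_power_exists:
  "\<exists>zs. length zs = length ys ^ k \<and> (\<forall>i j. gram zs i j = gram ys i j ^ k)"
proof (induction k)
  case 0
  show ?case by (rule exI[of _ "[\<lambda>_. 1]"]) simp
next
  case (Suc k)
  then obtain zs where zs: "length zs = length ys ^ k" "\<forall>i j. gram zs i j = gram ys i j ^ k"
    by blast
  have "length (concat (map (\<lambda>y. map (\<lambda>z i. y i * z i) zs) ys)) = length ys ^ Suc k"
    by (simp add: length_concat comp_def zs(1) sum_list_triv)
  with gram_products[of zs ys] show ?case
    using zs(2) by (intro exI[of _ "concat (map (\<lambda>y. map (\<lambda>z i. y i * z i) zs) ys)"]) simp
qed

lemma qf_cong:
  assumes "\<And>i j. i \<in> T \<Longrightarrow> j \<in> T \<Longrightarrow> M i j = N i j" "\<And>i. i \<in> T \<Longrightarrow> x i = y i"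
  shows "qf T M x = qf T N y"
  unfolding qf_def by (intro sum.cong refl) (simp add: assms)

lemma psd_cong:
  assumes "\<And>i j. i \<in> T \<Longrightarrow> j \<in> T \<Longrightarrow> M i j = N i j"
  shows "psd T M \<longleftrightarrow> psd T N"
  using assms qf_cong[of T M N] unfolding psd_def by (metis (no_types, lifting))

lemma psd_sym: "psd T M \<Longrightarrow> i \<in> T \<Longrightarrow> j \<in> T \<Longrightarrow> M i j = M j i"
  by (simp add: psd_def)

lemma psd_qf: "psd T M \<Longrightarrow> 0 \<le> qf T M x"
  by (simp add: psd_def)

lemma qf_add_matrix: "qf T (\<lambda>i j. M i j + N i j) x = qf T M x + qf T N x"
  by (simp add: qf_def sum.distrib algebra_simps)

lemma qf_diff_matrix: "qf T (\<lambda>i j. M i j - N i j) x = qf T M x - qf T N x"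
  by (simp add: qf_def sum_subtractf algebra_simps)

lemma psd_add: "psd T M \<Longrightarrow> psd T N \<Longrightarrow> psd T (\<lambda>i j. M i j + N i j)"
  by (simp add: psd_def qf_add_matrix)

lemma qf_rank_one: "qf T (\<lambda>i j. c * y i * y j) x = c * (\<Sum>i\<in>T. y i * x i)\<^sup>2"
  by (simp add: qf_def power2_eq_square sum_product sum_distrib_left mult_ac)

lemma qf_gram: "qf T (gram ys) x = (\<Sum>y\<leftarrow>ys. (\<Sum>i\<in>T. y i * x i)\<^sup>2)"
proof (induction ys)
  case Nil
  show ?case by (simp add: qf_def)
next
  case (Cons y ys)
  have "qf T (gram (y # ys)) x = qf T (\<lambda>i j. 1 * y i * y j + gram ys i j) x"
    by (rule qf_cong) auto
  with Cons show ?case by (simp only: qf_add_matrix qf_rank_one) simp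
qed

lemma psd_gram: "psd T (gram ys)"
  unfolding psd_def
  by (auto simp: qf_gram intro!: gram_commute sum_list_nonneg)

lemma qf_diag:
  assumes "finite T"
  shows "qf T (\<lambda>i j. if i = j then d i else 0) x = (\<Sum>i\<in>T. d i * (x i)\<^sup>2)"
proof -
  have "(\<Sum>j\<in>T. (if i = j then d i else 0) * x i * x j) = d i * (x i)\<^sup>2" if "i \<in> T" for i
  proof -
    have "(\<Sum>j\<in>T. (if i = j then d i else 0) * x i * x j) = (\<Sum>j\<in>T. if i = j then d i * (x i)\<^sup>2 else 0)"
      by (rule sum.cong) (auto simp: power2_eq_square)
    then show ?thesis using assms that by simp
  qed
  then show ?thesis by (simp add: qf_def)
qed

lemma psd_diag:
  assumes "finite T" "\<And>i. i \<in> T \<Longrightarrow> 0 \<le> d i"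
  shows "psd T (\<lambda>i j. if i = j then d i else 0)"
  unfolding psd_def by (auto simp: qf_diag assms intro!: sum_nonneg)

lemma qf_scale: "qf T (\<lambda>i j. s i * M i j * s j) x = qf T M (\<lambda>i. s i * x i)"
  by (simp add: qf_def mult_ac)

lemma psd_scale: "psd T M \<Longrightarrow> psd T (\<lambda>i j. s i * M i j * s j)"
  by (auto simp: psd_def qf_scale)

lemma qf_subset:
  assumes "finite T" "S \<subseteq> T"
  shows "qf S M x = qf T M (\<lambda>i. if i \<in> S then x i else 0)"
proof -
  have "qf T M (\<lambda>i. if i \<in> S then x i else 0)
      = (\<Sum>i\<in>T. \<Sum>j\<in>T. M i j * (if i \<in> S then x i else 0) * (if j \<in> S then x j else 0))"
    by (simp add: qf_def)
  also have "\<dots> = (\<Sum>i\<in>S. \<Sum>j\<in>T. M i j * (if i \<in> S then x i else 0) * (if j \<in> S then x j else 0))"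
    using assms by (intro sum.mono_neutral_right) auto
  also have "\<dots> = (\<Sum>i\<in>S. \<Sum>j\<in>S. M i j * (if i \<in> S then x i else 0) * (if j \<in> S then x j else 0))"
    using assms by (intro sum.cong refl sum.mono_neutral_right) auto
  also have "\<dots> = qf S M x"
    unfolding qf_def by (intro sum.cong refl) auto
  finally show ?thesis by simp
qed

lemma psd_subset:
  assumes "psd T M" "finite T" "S \<subseteq> T"
  shows "psd S M"
  using assms unfolding psd_def by (auto simp: qf_subset[OF assms(2,3)] subset_iff)

definition bf :: "'a set \<Rightarrow> ('a \<Rightarrow> 'a \<Rightarrow> real) \<Rightarrow> ('a \<Rightarrow> real) \<Rightarrow> ('a \<Rightarrow> real) \<Rightarrow> real" where
  "bf T M x y = (\<Sum>i\<in>T. \<Sum>j\<in>T. M i j * x i * y j)"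

lemma bf_commute:
  assumes "\<And>i j. i \<in> T \<Longrightarrow> j \<in> T \<Longrightarrow> M i j = M j i"
  shows "bf T M x y = bf T M y x"
proof -
  have "bf T M x y = (\<Sum>j\<in>T. \<Sum>i\<in>T. M i j * x i * y j)"
    unfolding bf_def by (rule sum.swap)
  also have "\<dots> = bf T M y x"
    unfolding bf_def by (intro sum.cong refl) (simp add: assms)
  finally show ?thesis .
qed

lemma qf_add_scaled:
  assumes "\<And>i j. i \<in> T \<Longrightarrow> j \<in> T \<Longrightarrow> M i j = M j i"
  shows "qf T M (\<lambda>i. x i + c * y i) = qf T M x + 2 * c * bf T M x y + c\<^sup>2 * qf T M y"
proof -
  have "qf T M (\<lambda>i. x i + c * y i) = qf T M x + c * bf T M x y + c * bf T M y x + c\<^sup>2 * qf T M y"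
    unfolding qf_def bf_def
    by (simp add: algebra_simps power2_eq_square sum.distrib sum_distrib_left)
  then show ?thesis using bf_commute[OF assms, where y = x and x = y] by simp
qed

lemma psd_Cauchy_Schwarz:
  assumes "psd T M"
  shows "(bf T M x y)\<^sup>2 \<le> qf T M x * qf T M y"
proof -
  have *: "0 \<le> qf T M x + 2 * c * bf T M x y + c\<^sup>2 * qf T M y" for c
    using psd_qf[OF assms, of "\<lambda>i. x i + c * y i"] psd_sym[OF assms]
    by (simp add: qf_add_scaled)
  show ?thesis
  proof (cases "qf T M y = 0")
    case True
    show ?thesis
    proof (rule ccontr)
      assume "\<not> ?thesis"
      then have nz: "bf T M x y \<noteq> 0" using True by auto
      \<comment> \<open>The expression is affine in \<open>c\<close> here; this \<open>c\<close>
        would give it the value -1.\<close>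
      show False using *[of "- (qf T M x + 1) / (2 * bf T M x y)"] nz True by (simp add: field_simps)
    qed
  next
    case False
    then have pos: "qf T M y > 0" using psd_qf[OF assms, of y] by simp
    have "0 \<le> qf T M x - (bf T M x y)\<^sup>2 / qf T M y"
      using *[of "- bf T M x y / qf T M y"] pos by (simp add: field_simps power2_eq_square)
    then show ?thesis using pos by (simp add: field_simps)
  qed
qed

lemma bf_eq: "bf T M x y = (\<Sum>i\<in>T. x i * (\<Sum>j\<in>T. M i j * y j))"
  unfolding bf_def by (intro sum.cong refl) (simp add: sum_distrib_left mult_ac)

text \<open>A Schur complement in the direction \<open>x\<close>: Cauchy-Schwarz says exactly that
  the subtracted rank-one matrix lies below \<open>M\<close>. It serves with a unit vector for
  elimination, with a vector of large Rayleigh quotient for truncation, and with the all-ones vector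
  for removing the mean direction.\<close>

lemma psd_diff_rank_one:
  assumes "psd T M" "0 < qf T M x"
  shows "psd T (\<lambda>i j. M i j - (\<Sum>k\<in>T. M i k * x k) * (\<Sum>k\<in>T. M j k * x k) / qf T M x)"
  unfolding psd_def
proof (intro conjI ballI allI)
  fix i j assume "i \<in> T" "j \<in> T"
  then show "M i j - (\<Sum>k\<in>T. M i k * x k) * (\<Sum>k\<in>T. M j k * x k) / qf T M x =
     M j i - (\<Sum>k\<in>T. M j k * x k) * (\<Sum>k\<in>T. M i k * x k) / qf T M x"
    using psd_sym[OF assms(1)] by (simp add: mult.commute)
next
  fix y
  have "qf T (\<lambda>i j. M i j - (\<Sum>k\<in>T. M i k * x k) * (\<Sum>k\<in>T. M j k * x k) / qf T M x) y
     = qf T M y - qf T (\<lambda>i j. inverse (qf T M x) * (\<Sum>k\<in>T. M i k * x k) * (\<Sum>k\<in>T. M j k * x k)) y"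
    by (subst qf_diff_matrix[symmetric]) (simp add: field_simps)
  also have "\<dots> = qf T M y - (bf T M y x)\<^sup>2 / qf T M x"
    by (simp only: qf_rank_one) (simp add: bf_eq field_simps)
  also have "\<dots> \<ge> 0"
    using psd_Cauchy_Schwarz[OF assms(1), of y x] assms(2) by (simp add: field_simps)
  finally show "0 \<le> qf T (\<lambda>i j. M i j - (\<Sum>k\<in>T. M i k * x k) * (\<Sum>k\<in>T. M j k * x k) / qf T M x) y" .
qed

lemma bf_units:
  assumes "finite T" "i \<in> T" "j \<in> T"
  shows "bf T M (\<lambda>k. if k = i then 1 else 0) (\<lambda>k. if k = j then 1 else 0) = M i j"
proof -
  have "(\<Sum>l\<in>T. M k l * (if l = j then 1 else 0)) = M k j" for k
    using assms by (simp add: if_distrib[of "\<lambda>z. _ * z"] cong: if_cong)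
  then show ?thesis using assms
    by (simp add: bf_eq if_distrib[of "\<lambda>z. z * _"] cong: if_cong)
qed

lemma qf_eq_bf: "qf T M x = bf T M x x"
  by (simp add: qf_def bf_def)

lemma psd_diag_entry: "psd T M \<Longrightarrow> finite T \<Longrightarrow> i \<in> T \<Longrightarrow> 0 \<le> M i i"
  using psd_qf[of T M "\<lambda>k. if k = i then 1 else 0"] by (simp add: qf_eq_bf bf_units)

lemma psd_entry_bound:
  assumes "psd T M" "finite T" "i \<in> T" "j \<in> T"
  shows "(M i j)\<^sup>2 \<le> M i i * M j j"
  using psd_Cauchy_Schwarz[OF assms(1), of "\<lambda>k. if k = i then 1 else 0" "\<lambda>k. if k = j then 1 else 0"] assms
  by (simp add: qf_eq_bf bf_units)

text \<open>Cholesky factorization, eliminating one index \<open>u\<close> at a time. A zero pivot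
  forces the whole row of \<open>u\<close> to vanish by \<open>psd_entry_bound\<close>, so then
  there is nothing to subtract.\<close>

lemma psd_imp_gram:
  assumes "finite T" "psd T M"
  shows "\<exists>ys. \<forall>i\<in>T. \<forall>j\<in>T. M i j = gram ys i j"
  using assms
proof (induction T arbitrary: M rule: finite_induct)
  case empty
  then show ?case by simp
next
  case (insert u T)
  let ?V = "insert u T"
  define M' where "M' = (if M u u = 0 then M else (\<lambda>i j. M i j - M i u * M j u / M u u))"
  have fin: "finite ?V" using insert.hyps by simp
  have "psd ?V M'"
  proof (cases "M u u = 0")
    case True
    then show ?thesis using insert.prems by (simp add: M'_def)
  next
    case False
    define e where "e = (\<lambda>k. if k = u then (1::real) else 0)"
    have q: "qf ?V M e = M u u"
      unfolding qf_eq_bf e_def by (rule bf_units) (use fin in auto)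
    have row: "(\<Sum>k\<in>?V. M i k * e k) = M i u" for i
      using fin by (simp add: e_def if_distrib[of "\<lambda>z. _ * z"] cong: if_cong)
    have "0 < qf ?V M e" using False psd_diag_entry[OF insert.prems fin, of u] q by simp
    from psd_diff_rank_one[OF insert.prems this] show ?thesis
      using False unfolding row q M'_def by simp
  qed
  then have "psd T M'" by (rule psd_subset) (use fin in auto)
  then obtain ys where ys: "\<forall>i\<in>T. \<forall>j\<in>T. M' i j = gram ys i j" using insert.IH by blast
  \<comment> \<open>The vectors from the induction hypothesis are controlled only on
    \<open>T\<close>; setting them to 0 at \<open>u\<close> matches the vanishing row
    \<open>u\<close> of \<open>M'\<close>.\<close>
  define zs where "zs = (\<lambda>i. if M u u = 0 then 0 else M i u / sqrt (M u u)) # map (\<lambda>y. y(u := 0)) ys"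
  have upd: "gram (map (\<lambda>y. y(u := 0)) ys) i j = (if i = u \<or> j = u then 0 else gram ys i j)" for i j
    by (induction ys) auto
  have nn: "0 \<le> M u u" using psd_diag_entry[OF insert.prems fin] by simp
  have zero: "M i u = 0" "M u i = 0" if "M u u = 0" "i \<in> ?V" for i
    using psd_entry_bound[OF insert.prems fin that(2), of u] psd_sym[OF insert.prems that(2), of u] that
    by auto
  have "M i j = gram zs i j" if "i \<in> ?V" "j \<in> ?V" for i j
  proof (cases "M u u = 0")
    case True
    then show ?thesis using ys zero[OF True] that by (auto simp: zs_def upd M'_def)
  next
    case False
    have "M u j = M j u" "M i u = M u i" using psd_sym[OF insert.prems] that by auto
    then show ?thesis using ys that False nn
      by (auto simp: zs_def upd M'_def real_sqrt_mult[symmetric] field_simps)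
  qed
  then show ?case by blast
qed

text \<open>Schur product theorem: writing \<open>N\<close> as a sum of rank-one matrices turns the
  product into a sum of diagonal congruences \<open>y i * M i j * y j\<close>.\<close>

lemma psd_Hadamard:
  assumes "finite T" "psd T M" "psd T N"
  shows "psd T (\<lambda>i j. M i j * N i j)"
proof -
  obtain ys where ys: "\<forall>i\<in>T. \<forall>j\<in>T. N i j = gram ys i j" using psd_imp_gram assms by blast
  have "psd T (\<lambda>i j. M i j * gram ys i j)"
  proof (induction ys)
    case Nil
    show ?case by (simp add: psd_def qf_def)
  next
    case (Cons y ys)
    have "psd T (\<lambda>i j. y i * M i j * y j + M i j * gram ys i j)"
      by (intro psd_add psd_scale assms Cons)
    then show ?case by (simp add: algebra_simps)
  qed
  then show ?thesis by (subst psd_cong) (use ys in auto)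
qed

lemma psd_inner_nonneg:
  assumes "finite T" "psd T M" "psd T N"
  shows "0 \<le> (\<Sum>i\<in>T. \<Sum>j\<in>T. M i j * N i j)"
  using psd_qf[OF psd_Hadamard[OF assms], of "\<lambda>_. 1"] by (simp add: qf_def)

section \<open>Low-rank truncation and entrywise powers\<close>

text \<open>Stands in for discarding the eigenvalues below \<open>c\<close>, without eigenvectors:
  while some vector has Rayleigh quotient above \<open>c\<close>, the corresponding rank-one part is
  split off. Each split removes trace at least \<open>c\<close>, which bounds the number of
  splits.\<close>

lemma psd_truncate:
  assumes "finite T" "psd T Z" "0 < c"
  shows "\<exists>ys. psd T (\<lambda>i j. Z i j - gram ys i j) \<and>
    (\<forall>x. qf T (\<lambda>i j. Z i j - gram ys i j) x \<le> c * (\<Sum>i\<in>T. (x i)\<^sup>2)) \<and>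
    c * length ys \<le> (\<Sum>i\<in>T. gram ys i i)"
proof -
  \<comment> \<open>\<open>n\<close> bounds the number of splits still possible; for
    \<open>n = 0\<close> the matrix is zero.\<close>
  have *: "\<exists>ys. psd T (\<lambda>i j. Z i j - gram ys i j) \<and>
    (\<forall>x. qf T (\<lambda>i j. Z i j - gram ys i j) x \<le> c * (\<Sum>i\<in>T. (x i)\<^sup>2)) \<and>
    c * length ys \<le> (\<Sum>i\<in>T. gram ys i i)" if "psd T Z" "(\<Sum>i\<in>T. Z i i) \<le> real n * c" for n Z
    using that
  proof (induction n arbitrary: Z)
    case (0 Z)
    show ?case
    proof (cases "\<forall>x. qf T Z x \<le> c * (\<Sum>i\<in>T. (x i)\<^sup>2)")
      case True
      then show ?thesis using 0 by (intro exI[of _ "[]"]) simp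
    next
      case False
      then obtain x where x: "qf T Z x > c * (\<Sum>i\<in>T. (x i)\<^sup>2)" by (auto simp: not_le)
      have "Z i i = 0" if "i \<in> T" for i
        using 0 that psd_diag_entry[OF 0(1) assms(1)] sum_nonneg_eq_0_iff[of T "\<lambda>i. Z i i"] assms(1)
        by (metis (no_types, lifting) antisym mult_zero_left of_nat_0 sum_nonneg)
      then have "Z i j = 0" if "i \<in> T" "j \<in> T" for i j
        using psd_entry_bound[OF 0(1) assms(1) that] that by simp
      then have "qf T Z x = 0" by (simp add: qf_def)
      with x have "c * (\<Sum>i\<in>T. (x i)\<^sup>2) < 0" by simp
      moreover have "0 \<le> c * (\<Sum>i\<in>T. (x i)\<^sup>2)" using assms(3) by (simp add: sum_nonneg)
      ultimately show ?thesis by simp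
    qed
  next
    case (Suc n Z)
    show ?case
    proof (cases "\<forall>x. qf T Z x \<le> c * (\<Sum>i\<in>T. (x i)\<^sup>2)")
      case True
      then show ?thesis using Suc.prems by (intro exI[of _ "[]"]) simp
    next
      case False
      then obtain x where x: "qf T Z x > c * (\<Sum>i\<in>T. (x i)\<^sup>2)" by (auto simp: not_le)
      define v where "v = (\<lambda>i. \<Sum>k\<in>T. Z i k * x k)"
      define y where "y = (\<lambda>i. v i / sqrt (qf T Z x))"
      have q: "0 < qf T Z x"
        using x assms(3) sum_nonneg[of T "\<lambda>i. (x i)\<^sup>2"] by (smt (verit) mult_nonneg_nonneg zero_le_power2)
      have yy: "y i * y j = v i * v j / qf T Z x" for i j
        using q by (simp add: y_def real_sqrt_mult[symmetric])
      have psd': "psd T (\<lambda>i j. Z i j - y i * y j)"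
        unfolding yy v_def by (rule psd_diff_rank_one[OF Suc.prems(1) q])
      \<comment> \<open>The removed trace is |v|^2 / (x . v). As |v|^2 is at least (x . v)^2 /
        |x|^2, it is at least the Rayleigh quotient of \<open>x\<close>, hence at least
        \<open>c\<close>.\<close>
      have "qf T Z x = (\<Sum>i\<in>T. x i * v i)" unfolding qf_eq_bf bf_eq v_def ..
      then have "(qf T Z x)\<^sup>2 \<le> (\<Sum>i\<in>T. (x i)\<^sup>2) * (\<Sum>i\<in>T. (v i)\<^sup>2)"
        using Cauchy_Schwarz_ineq_sum[of x v T] by simp
      also have "c * \<dots> \<le> qf T Z x * (\<Sum>i\<in>T. (v i)\<^sup>2)"
        using x by (auto simp: mult.assoc[symmetric] intro!: mult_right_mono sum_nonneg)
      finally have "c * (qf T Z x)\<^sup>2 \<le> qf T Z x * (\<Sum>i\<in>T. (v i)\<^sup>2)" using assms(3) by simp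
      then have "c \<le> (\<Sum>i\<in>T. (v i)\<^sup>2) / qf T Z x"
        using q by (simp add: field_simps power2_eq_square)
      also have "\<dots> = (\<Sum>i\<in>T. y i * y i)"
        by (simp add: yy sum_divide_distrib power2_eq_square)
      finally have c: "c \<le> (\<Sum>i\<in>T. y i * y i)" .
      have "(\<Sum>i\<in>T. Z i i - y i * y i) \<le> real n * c"
        using c Suc.prems(2) by (simp add: sum_subtractf algebra_simps)
      from Suc.IH[OF psd' this] obtain ys where
        ys: "psd T (\<lambda>i j. Z i j - y i * y j - gram ys i j)"
          "\<forall>z. qf T (\<lambda>i j. Z i j - y i * y j - gram ys i j) z \<le> c * (\<Sum>i\<in>T. (z i)\<^sup>2)"
          "c * length ys \<le> (\<Sum>i\<in>T. gram ys i i)" by blast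
      have eq: "(\<lambda>i j. Z i j - y i * y j - gram ys i j) = (\<lambda>i j. Z i j - gram (y # ys) i j)"
        by (intro ext) simp
      have "c * length (y # ys) \<le> (\<Sum>i\<in>T. gram (y # ys) i i)"
        using ys(3) c by (simp add: sum.distrib algebra_simps)
      then show ?thesis using ys(1,2) unfolding eq by blast
    qed
  qed
  obtain n :: nat where "(\<Sum>i\<in>T. Z i i) / c \<le> real n" using real_arch_simple by blast
  then have "(\<Sum>i\<in>T. Z i i) \<le> real n * c" using assms(3) by (simp add: field_simps)
  from *[OF assms(2) this] show ?thesis .
qed

text \<open>The trace of (c I - R) R is nonnegative, being the entrywise inner product of two
  positive semidefinite matrices.\<close>

lemma psd_Frobenius_bound:
  assumes "finite T" "psd T R" "\<And>x. qf T R x \<le> c * (\<Sum>i\<in>T. (x i)\<^sup>2)"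
  shows "(\<Sum>i\<in>T. \<Sum>j\<in>T. (R i j)\<^sup>2) \<le> c * (\<Sum>i\<in>T. R i i)"
proof -
  have "psd T (\<lambda>i j. (if i = j then c else 0) - R i j)"
    unfolding psd_def
  proof (intro conjI ballI allI)
    fix x
    have "qf T (\<lambda>i j. (if i = j then c else 0) - R i j) x = (\<Sum>i\<in>T. c * (x i)\<^sup>2) - qf T R x"
      by (simp add: qf_diff_matrix qf_diag[OF assms(1), of "\<lambda>_. c"])
    then show "0 \<le> qf T (\<lambda>i j. (if i = j then c else 0) - R i j) x"
      using assms(3)[of x] by (simp add: sum_distrib_left)
  qed (use psd_sym[OF assms(2)] in auto)
  from psd_inner_nonneg[OF assms(1) this assms(2)]
  have "0 \<le> (\<Sum>i\<in>T. \<Sum>j\<in>T. (if i = j then c * R i i else 0) - (R i j)\<^sup>2)"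
    by (rule order_trans) (auto simp: algebra_simps power2_eq_square intro!: eq_refl sum.cong)
  then show ?thesis using assms(1)
    by (simp add: sum_subtractf sum_distrib_left)
qed

lemma sum_Cauchy_Schwarz2:
  fixes f g :: "'a \<Rightarrow> 'b \<Rightarrow> real"
  shows "(\<Sum>i\<in>S. \<Sum>j\<in>T. f i j * g i j)\<^sup>2
    \<le> (\<Sum>i\<in>S. \<Sum>j\<in>T. (f i j)\<^sup>2) * (\<Sum>i\<in>S. \<Sum>j\<in>T. (g i j)\<^sup>2)"
  using Cauchy_Schwarz_ineq_sum[of "\<lambda>(i, j). f i j" "\<lambda>(i, j). g i j" "S \<times> T"]
  by (simp add: sum.cartesian_product case_prod_unfold)

section \<open>Orthonormal systems and the trace of a low-rank matrix\<close>

definition ip :: "'a set \<Rightarrow> ('a \<Rightarrow> real) \<Rightarrow> ('a \<Rightarrow> real) \<Rightarrow> real" where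
  "ip T x y = (\<Sum>i\<in>T. x i * y i)"

definition orthonormal :: "'a set \<Rightarrow> ('a \<Rightarrow> real) set \<Rightarrow> bool" where
  "orthonormal T E \<longleftrightarrow> finite E \<and> (\<forall>e\<in>E. \<forall>f\<in>E. ip T e f = (if e = f then 1 else 0))"

lemma ip_commute: "ip T x y = ip T y x"
  by (simp add: ip_def mult.commute)

lemma ip_sum_right: "ip T x (\<lambda>i. \<Sum>e\<in>E. c e * f e i) = (\<Sum>e\<in>E. c e * ip T x (f e))"
  unfolding ip_def sum_distrib_left by (subst sum.swap) (simp add: mult_ac)

lemma ip_diff_right: "ip T x (\<lambda>i. y i - z i) = ip T x y - ip T x z"
  by (simp add: ip_def algebra_simps sum_subtractf)

lemma ip_residual:
  assumes "orthonormal T E" "e \<in> E"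
  shows "ip T e (\<lambda>i. x i - (\<Sum>f\<in>E. ip T f x * f i)) = 0"
  using assms
  by (simp add: orthonormal_def ip_diff_right ip_sum_right if_distrib[of "\<lambda>z. _ * z"] cong: if_cong)

lemma Parseval:
  assumes "orthonormal T E" "\<And>i. i \<in> T \<Longrightarrow> y i = (\<Sum>e\<in>E. ip T e y * e i)"
  shows "ip T y y = (\<Sum>e\<in>E. (ip T e y)\<^sup>2)"
proof -
  have "ip T y y = ip T y (\<lambda>i. \<Sum>e\<in>E. ip T e y * e i)"
    unfolding ip_def[of T y] by (intro sum.cong refl arg_cong2[of _ _ _ _ "(*)"] assms(2))
  also have "\<dots> = (\<Sum>e\<in>E. (ip T e y)\<^sup>2)"
    by (simp add: ip_sum_right ip_commute[of T y] power2_eq_square)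
  finally show ?thesis .
qed

lemma Bessel:
  assumes "orthonormal T E"
  shows "(\<Sum>e\<in>E. (ip T e x)\<^sup>2) \<le> ip T x x"
proof -
  define p where "p = (\<lambda>i. \<Sum>f\<in>E. ip T f x * f i)"
  define w where "w = (\<lambda>i. x i - p i)"
  have e0: "ip T e w = 0" if "e \<in> E" for e
    unfolding w_def p_def using ip_residual[OF assms that] .
  have "ip T w p = 0"
    unfolding p_def ip_sum_right using e0 by (simp add: ip_commute[of T w])
  then have "ip T w w = ip T w x" by (subst (2) w_def) (simp add: ip_diff_right)
  also have "\<dots> = ip T x w" by (rule ip_commute)
  also have "\<dots> = ip T x x - ip T x p" by (simp add: w_def ip_diff_right)
  also have "ip T x p = (\<Sum>e\<in>E. (ip T e x)\<^sup>2)"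
    by (simp add: p_def ip_sum_right ip_commute[of T x] power2_eq_square)
  finally have "ip T x x - (\<Sum>e\<in>E. (ip T e x)\<^sup>2) = ip T w w" by simp
  moreover have "0 \<le> ip T w w" by (simp add: ip_def sum_nonneg)
  ultimately show ?thesis by simp
qed

lemma orthonormal_basis_exists:
  assumes "finite T"
  shows "\<exists>E. orthonormal T E \<and> card E \<le> length ys \<and>
    (\<forall>y\<in>set ys. \<forall>i\<in>T. y i = (\<Sum>e\<in>E. ip T e y * e i))"
proof (induction ys)
  case Nil
  show ?case by (rule exI[of _ "{}"]) (simp add: orthonormal_def)
next
  case (Cons y ys)
  then obtain E where E: "orthonormal T E" "card E \<le> length ys"
    "\<forall>y\<in>set ys. \<forall>i\<in>T. y i = (\<Sum>e\<in>E. ip T e y * e i)" by (elim exE conjE) (rule that)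
  define w where "w = (\<lambda>i. y i - (\<Sum>f\<in>E. ip T f y * f i))"
  have e0: "ip T e w = 0" if "e \<in> E" for e
    unfolding w_def using ip_residual[OF E(1) that] .
  have finE: "finite E" using E(1) by (simp add: orthonormal_def)
  show ?case
  proof (cases "ip T w w = 0")
    case True
    then have "\<forall>i\<in>T. w i = 0"
      using assms by (simp add: ip_def sum_nonneg_eq_0_iff)
    then have *: "\<forall>i\<in>T. y i = (\<Sum>e\<in>E. ip T e y * e i)" unfolding w_def right_minus_eq .
    have "\<forall>z\<in>set (y # ys). \<forall>i\<in>T. z i = (\<Sum>e\<in>E. ip T e z * e i)"
    proof
      fix z assume "z \<in> set (y # ys)"
      then consider "z = y" | "z \<in> set ys" by auto
      then show "\<forall>i\<in>T. z i = (\<Sum>e\<in>E. ip T e z * e i)"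
        by cases (use * in blast, rule bspec[OF E(3)])
    qed
    moreover have "card E \<le> length (y # ys)" using E(2) by simp
    ultimately show ?thesis using E(1) by blast
  next
    case False
    moreover have "0 \<le> ip T w w" by (simp add: ip_def sum_nonneg)
    ultimately have pos: "0 < ip T w w" by linarith
    define g where "g = (\<lambda>i. w i / sqrt (ip T w w))"
    have ipg: "ip T e g = ip T e w / sqrt (ip T w w)" for e
      by (simp add: ip_def g_def sum_divide_distrib)
    have gg: "ip T g g = 1"
    proof -
      have "ip T g g = ip T w w / (sqrt (ip T w w) * sqrt (ip T w w))"
        by (simp add: ip_def g_def sum_divide_distrib)
      then show ?thesis using pos by simp
    qed
    have eg: "ip T e g = 0" if "e \<in> E" for e using e0[OF that] by (simp add: ipg)
    have ge: "ip T g e = 0" if "e \<in> E" for e using eg[OF that] by (subst ip_commute)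
    have gE: "g \<notin> E" using eg gg by auto
    have orth: "orthonormal T (insert g E)"
      using E(1) gg eg ge gE by (auto simp: orthonormal_def)
    have new: "(\<Sum>e\<in>insert g E. ip T e z * e i) = ip T g z * g i + (\<Sum>e\<in>E. ip T e z * e i)" for z i
      using finE gE by simp
    have gz: "ip T g z = 0" if "\<forall>i\<in>T. z i = (\<Sum>e\<in>E. ip T e z * e i)" for z
    proof -
      have "ip T g z = ip T g (\<lambda>i. \<Sum>e\<in>E. ip T e z * e i)"
        unfolding ip_def[of T g] by (intro sum.cong refl arg_cong2[of _ _ _ _ "(*)"] bspec[OF that])
      also have "\<dots> = 0" using ge by (simp add: ip_sum_right)
      finally show ?thesis .
    qed
    have wy: "ip T w y = ip T w w"
    proof -
      have "ip T w w = ip T w y - ip T w (\<lambda>i. \<Sum>f\<in>E. ip T f y * f i)"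
        by (subst (2) w_def) (rule ip_diff_right)
      also have "ip T w (\<lambda>i. \<Sum>f\<in>E. ip T f y * f i) = 0"
        using e0 by (simp add: ip_sum_right ip_commute[of T w])
      finally show ?thesis by simp
    qed
    have gy: "ip T g y * g i = w i" for i
    proof -
      have "ip T g y = ip T w w / sqrt (ip T w w)"
        using ipg[of y] wy by (simp add: ip_commute[of T _ y])
      then show ?thesis using pos by (simp add: g_def)
    qed
    have "z i = (\<Sum>e\<in>insert g E. ip T e z * e i)" if z: "z \<in> set (y # ys)" and i: "i \<in> T" for z i
    proof (cases "z = y")
      case True
      show ?thesis unfolding True new gy by (simp add: w_def)
    next
      case False
      with z have *: "\<forall>i\<in>T. z i = (\<Sum>e\<in>E. ip T e z * e i)" using E(3) by simp
      show ?thesis unfolding new gz[OF *] using bspec[OF * i] by simp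
    qed
    moreover have "card (insert g E) \<le> length (y # ys)" using E(2) finE gE by simp
    ultimately show ?thesis using orth by (intro exI[of _ "insert g E"]) blast
  qed
qed

lemma qf_gram_ip: "qf T (gram ys) x = (\<Sum>y\<leftarrow>ys. (ip T y x)\<^sup>2)"
  by (simp add: qf_gram ip_def)

lemma gram_trace: "(\<Sum>i\<in>T. gram ys i i) = (\<Sum>y\<leftarrow>ys. ip T y y)"
  by (induction ys) (auto simp: ip_def sum.distrib)

lemma sum_sum_list_swap: "(\<Sum>e\<in>E. \<Sum>y\<leftarrow>ys. f e y) = (\<Sum>y\<leftarrow>ys. \<Sum>e\<in>E. f e y)"
  by (induction ys) (auto simp: sum.distrib)

text \<open>For \<open>W\<close> written as a sum of rank-one matrices this is Bessel's inequality,
  applied to each vector.\<close>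

lemma psd_trace_orthonormal:
  assumes "finite T" "psd T W" "orthonormal T E"
  shows "(\<Sum>e\<in>E. qf T W e) \<le> (\<Sum>i\<in>T. W i i)"
proof -
  obtain ws where ws: "\<forall>i\<in>T. \<forall>j\<in>T. W i j = gram ws i j" using psd_imp_gram assms by blast
  have "(\<Sum>e\<in>E. qf T W e) = (\<Sum>e\<in>E. qf T (gram ws) e)"
    by (intro sum.cong qf_cong) (use ws in auto)
  also have "\<dots> = (\<Sum>y\<leftarrow>ws. \<Sum>e\<in>E. (ip T e y)\<^sup>2)"
    by (simp add: qf_gram_ip sum_sum_list_swap ip_commute)
  also have "\<dots> \<le> (\<Sum>y\<leftarrow>ws. ip T y y)"
    by (intro sum_list_mono Bessel assms)
  also have "\<dots> = (\<Sum>i\<in>T. W i i)" using ws by (simp flip: gram_trace)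
  finally show ?thesis .
qed

text \<open>The perturbation \<open>c I\<close> only contributes on the range, which has dimension at most \<open>length ys\<close>.\<close>

lemma gram_trace_bound:
  assumes "finite T" "psd T W" "0 \<le> c"
    and le: "psd T (\<lambda>i j. W i j + (if i = j then c else 0) - gram ys i j)"
  shows "(\<Sum>i\<in>T. gram ys i i) \<le> (\<Sum>i\<in>T. W i i) + c * length ys"
proof -
  obtain E where E: "orthonormal T E" "card E \<le> length ys"
    "\<forall>y\<in>set ys. \<forall>i\<in>T. y i = (\<Sum>e\<in>E. ip T e y * e i)"
    using orthonormal_basis_exists[OF assms(1)] by blast
  have "(\<Sum>i\<in>T. gram ys i i) = (\<Sum>y\<leftarrow>ys. \<Sum>e\<in>E. (ip T e y)\<^sup>2)"
    unfolding gram_trace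
    by (intro arg_cong[of _ _ sum_list] map_cong refl Parseval E) (use E(3) in auto)
  also have "\<dots> = (\<Sum>e\<in>E. qf T (gram ys) e)"
    by (simp add: qf_gram_ip sum_sum_list_swap ip_commute)
  also have "\<dots> \<le> (\<Sum>e\<in>E. qf T W e + c)"
  proof (rule sum_mono)
    fix e assume "e \<in> E"
    then have "ip T e e = 1" using E(1) by (auto simp: orthonormal_def)
    then have "(\<Sum>i\<in>T. c * (e i)\<^sup>2) = c"
      by (simp add: ip_def power2_eq_square flip: sum_distrib_left)
    then show "qf T (gram ys) e \<le> qf T W e + c"
      using psd_qf[OF le, of e] by (simp add: qf_diff_matrix qf_add_matrix qf_diag[OF assms(1), of "\<lambda>_. c"])
  qed
  also have "\<dots> \<le> (\<Sum>i\<in>T. W i i) + c * card E"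
    using psd_trace_orthonormal[OF assms(1,2) E(1)] by (simp add: sum.distrib)
  also have "\<dots> \<le> (\<Sum>i\<in>T. W i i) + c * length ys"
    using E(2) assms(3) by (simp add: mult_left_mono)
  finally show ?thesis .
qed

text \<open>Powers of A = s M s are compared with those of Z through A^(k+1) - Z^(k+1) = (A^k - Z^k)
  Z + (A - Z) A^k, all products entrywise, where both summands are handled by the Schur product
  theorem. As \<open>M\<close> has entries 0 and 1 off the diagonal, only the diagonal is corrected,
  by at most K^2 per factor, while multiplication by \<open>Z\<close> scales the earlier corrections
  by \<open>\<rho>\<close>.\<close>

lemma Hadamard_power_bound:
  assumes fin: "finite T" and M: "psd T M" and K: "1 \<le> K" "\<And>i. i \<in> T \<Longrightarrow> M i i \<le> K"
    and offdiag: "\<And>i j. i \<in> T \<Longrightarrow> j \<in> T \<Longrightarrow> i \<noteq> j \<Longrightarrow> M i j \<in> {0, 1}"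
    and s: "\<And>i. i \<in> T \<Longrightarrow> 0 \<le> s i \<and> s i \<le> 1"
    and Z: "psd T Z" "\<And>i. i \<in> T \<Longrightarrow> Z i i = \<rho>" "1 \<le> \<rho>"
    and le: "psd T (\<lambda>i j. s i * M i j * s j - Z i j)"
  shows "psd T (\<lambda>i j. s i ^ Suc k * M i j * s j ^ Suc k +
    (if i = j then real (Suc k) * K\<^sup>2 * \<rho> ^ Suc k else 0) - Z i j ^ Suc k)"
proof (induction k)
  case 0
  have "psd T (\<lambda>i j. (s i * M i j * s j - Z i j) + (if i = j then K\<^sup>2 * \<rho> else 0))"
    by (intro psd_add le psd_diag fin) (use Z(3) in auto)
  then show ?case by (simp add: algebra_simps cong: if_cong)
next
  case (Suc k)
  define c where "c = real (Suc k) * K\<^sup>2 * \<rho> ^ Suc k"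
  \<comment> \<open>The slack on the diagonal: the allowed error, minus the error inherited from the
    previous power, minus the excess of the squared diagonal entry of \<open>M\<close> over the
    entry itself.\<close>
  define d where "d = (\<lambda>i. real (Suc (Suc k)) * K\<^sup>2 * \<rho> ^ Suc (Suc k) - c * \<rho>
    - s i ^ Suc (Suc k) * ((M i i)\<^sup>2 - M i i) * s i ^ Suc (Suc k))"
  have d: "0 \<le> d i" if "i \<in> T" for i
  proof -
    have m: "0 \<le> M i i" "M i i \<le> K" using psd_diag_entry[OF M fin that] K(2)[OF that] .
    have "s i ^ Suc (Suc k) * ((M i i)\<^sup>2 - M i i) * s i ^ Suc (Suc k)
      \<le> s i ^ Suc (Suc k) * (M i i)\<^sup>2 * s i ^ Suc (Suc k)"
      using m s[OF that] by (intro mult_right_mono mult_left_mono) auto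
    also have "\<dots> \<le> 1 * (M i i)\<^sup>2 * 1"
      using m s[OF that] by (intro mult_mono power_le_one) auto
    also have "\<dots> \<le> K\<^sup>2" using m by (simp add: power_mono)
    also have "\<dots> \<le> K\<^sup>2 * \<rho> ^ Suc (Suc k)"
      using one_le_power[OF Z(3), of "Suc (Suc k)"] by (simp add: mult_le_cancel_left1)
    finally have "s i ^ Suc (Suc k) * ((M i i)\<^sup>2 - M i i) * s i ^ Suc (Suc k) \<le> K\<^sup>2 * \<rho> ^ Suc (Suc k)" .
    then show ?thesis by (simp add: d_def c_def algebra_simps)
  qed
  have P1: "psd T (\<lambda>i j. (s i ^ Suc k * M i j * s j ^ Suc k + (if i = j then c else 0) - Z i j ^ Suc k) * Z i j)"
    using psd_Hadamard[OF fin Suc Z(1)] unfolding c_def .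
  have P2: "psd T (\<lambda>i j. (s i * M i j * s j - Z i j) * (s i ^ Suc k * M i j * s j ^ Suc k))"
    by (intro psd_Hadamard le psd_scale M fin)
  have P3: "psd T (\<lambda>i j. if i = j then d i else 0)"
    by (intro psd_diag fin d)
  show ?case
  proof (subst psd_cong)
    show "psd T (\<lambda>i j. ((s i ^ Suc k * M i j * s j ^ Suc k + (if i = j then c else 0) - Z i j ^ Suc k) * Z i j
       + (s i * M i j * s j - Z i j) * (s i ^ Suc k * M i j * s j ^ Suc k)) + (if i = j then d i else 0))"
      by (intro psd_add P1 P2 P3)
  next
    fix i j assume ij: "i \<in> T" "j \<in> T"
    show "s i ^ Suc (Suc k) * M i j * s j ^ Suc (Suc k) +
        (if i = j then real (Suc (Suc k)) * K\<^sup>2 * \<rho> ^ Suc (Suc k) else 0) - Z i j ^ Suc (Suc k)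
      = ((s i ^ Suc k * M i j * s j ^ Suc k + (if i = j then c else 0) - Z i j ^ Suc k) * Z i j
       + (s i * M i j * s j - Z i j) * (s i ^ Suc k * M i j * s j ^ Suc k)) + (if i = j then d i else 0)"
    proof (cases "i = j")
      case True
      then show ?thesis using Z(2)[OF ij(1)] by (simp add: d_def algebra_simps power2_eq_square)
    next
      case False
      then show ?thesis using offdiag[OF ij] by (auto simp: algebra_simps)
    qed
  qed
qed

text \<open>The large diagonal entries are first scaled down to \<open>\<rho>\<close>, so that the diagonal error of the
  \<open>k\<close>-th entrywise power involves \<open>\<rho> ^ k\<close> instead of \<open>K ^ k\<close>.\<close>

lemma large_diagonal_bound:
  assumes fin: "finite T" and M: "psd T M" and K: "1 \<le> K" "\<And>i. i \<in> T \<Longrightarrow> M i i \<le> K"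
    and offdiag: "\<And>i j. i \<in> T \<Longrightarrow> j \<in> T \<Longrightarrow> i \<noteq> j \<Longrightarrow> M i j \<in> {0, 1}"
    and le: "psd T (\<lambda>i j. M i j - gram ys i j)"
    and \<rho>: "1 \<le> \<rho>" "2 * K \<le> \<rho> ^ k" and k: "1 \<le> k"
  shows "card {i \<in> T. \<rho> \<le> gram ys i i} \<le> 2 * real k * K\<^sup>2 * real (length ys) ^ k"
proof -
  define U where "U = {i \<in> T. \<rho> \<le> gram ys i i}"
  have U: "finite U" "U \<subseteq> T" using fin by (auto simp: U_def)
  define s where "s = (\<lambda>i. sqrt (\<rho> / gram ys i i))"
  have g: "\<rho> \<le> gram ys i i" if "i \<in> U" for i using that by (simp add: U_def)
  have s: "0 \<le> s i \<and> s i \<le> 1" if "i \<in> U" for i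
    using g[OF that] \<rho>(1) by (simp add: s_def field_simps)
  define zs where "zs = map (\<lambda>y i. s i * y i) ys"
  have zs: "gram zs i j = s i * gram ys i j * s j" for i j
    unfolding zs_def by (induction ys) (auto simp: algebra_simps)
  have zs_diag: "gram zs i i = \<rho>" if "i \<in> U" for i
  proof -
    have "gram zs i i = (s i * s i) * gram ys i i" by (simp add: zs)
    then show ?thesis using g[OF that] \<rho>(1) by (simp add: s_def)
  qed
  have MU: "psd U M" by (rule psd_subset[OF M fin U(2)])
  have leU: "psd U (\<lambda>i j. s i * M i j * s j - gram zs i j)"
    using psd_scale[OF psd_subset[OF le fin U(2)], of s] by (simp add: zs algebra_simps)
  obtain k' where k': "k = Suc k'" using k by (cases k) auto
  define c where "c = real k * K\<^sup>2 * \<rho> ^ k"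
  have "psd U (\<lambda>i j. s i ^ k * M i j * s j ^ k + (if i = j then c else 0) - gram zs i j ^ k)"
    unfolding k' c_def
    by (rule Hadamard_power_bound[OF U(1) MU K(1) K(2) offdiag s psd_gram zs_diag \<rho>(1) leU])
      (use U in auto)
  moreover obtain vs where vs: "length vs = length zs ^ k" "\<forall>i j. gram vs i j = gram zs i j ^ k"
    using gram_power_exists by blast
  ultimately have "psd U (\<lambda>i j. s i ^ k * M i j * s j ^ k + (if i = j then c else 0) - gram vs i j)"
    by simp
  then have "(\<Sum>i\<in>U. gram vs i i) \<le> (\<Sum>i\<in>U. s i ^ k * M i i * s i ^ k) + c * length vs"
    by (rule gram_trace_bound[OF U(1) psd_scale[OF MU], rotated]) (use \<rho>(1) in \<open>simp add: c_def\<close>)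
  also have "(\<Sum>i\<in>U. gram vs i i) = card U * \<rho> ^ k" by (simp add: vs zs_diag)
  also have "(\<Sum>i\<in>U. s i ^ k * M i i * s i ^ k) \<le> (\<Sum>i\<in>U. 1 * K * 1)"
  proof (rule sum_mono)
    fix i assume i: "i \<in> U"
    then have "0 \<le> M i i" using psd_diag_entry[OF MU U(1)] by blast
    then show "s i ^ k * M i i * s i ^ k \<le> 1 * K * 1"
      using s[OF i] K(2)[of i] K(1) i U by (intro mult_mono power_le_one) auto
  qed
  also have "\<dots> = card U * K" by simp
  \<comment> \<open>By \<open>2 * K \<le> \<rho> ^ k\<close> the trace of the scaled matrix is at
    most half of the left-hand side and can be absorbed there.\<close>
  also have "\<dots> \<le> card U * (\<rho> ^ k / 2)" using \<rho>(2) by (intro mult_left_mono) auto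
  finally have "card U * \<rho> ^ k \<le> 2 * real k * K\<^sup>2 * real (length ys) ^ k * \<rho> ^ k"
    by (simp add: c_def vs zs_def algebra_simps)
  moreover have "0 < \<rho> ^ k" using \<rho>(1) by simp
  ultimately show ?thesis unfolding U_def by (simp add: mult_le_cancel_right)
qed

section \<open>Low-rank approximation of the adjacency matrix\<close>

lemma power_powr:
  fixes x :: real
  assumes "0 < x"
  shows "(x ^ m) powr r = x powr (real m * r)"
  by (simp add: assms powr_powr flip: powr_realpow)

text \<open>The off-diagonal part of \<open>M\<close> is the adjacency matrix of a graph on \<open>T\<close> whose smallest eigenvalue
  is at least \<open>-K\<close> in the strong sense that it becomes positive semidefinite by adding a diagonal
  with entries at most \<open>K\<close>.\<close>

definition psd_graph :: "'a set \<Rightarrow> ('a \<Rightarrow> 'a \<Rightarrow> real) \<Rightarrow> real \<Rightarrow> bool" where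
  "psd_graph T M K \<longleftrightarrow> finite T \<and> psd T M \<and> 1 \<le> K \<and> (\<forall>i\<in>T. M i i \<le> K) \<and>
    (\<forall>i\<in>T. \<forall>j\<in>T. i \<noteq> j \<longrightarrow> M i j \<in> {0, 1})"

definition adj :: "('a \<Rightarrow> 'a \<Rightarrow> real) \<Rightarrow> 'a \<Rightarrow> 'a \<Rightarrow> real" where
  "adj M i j = (if i = j then 0 else M i j)"

text \<open>A sum over ordered pairs: twice the number of edges inside \<open>T\<close>.\<close>

definition weight :: "'a set \<Rightarrow> ('a \<Rightarrow> 'a \<Rightarrow> real) \<Rightarrow> real" where
  "weight T M = (\<Sum>i\<in>T. \<Sum>j\<in>T. adj M i j)"

lemma psd_graphD:
  assumes "psd_graph T M K"
  shows "finite T" "psd T M" "1 \<le> K" "\<And>i. i \<in> T \<Longrightarrow> M i i \<le> K"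
    "\<And>i j. i \<in> T \<Longrightarrow> j \<in> T \<Longrightarrow> i \<noteq> j \<Longrightarrow> M i j \<in> {0, 1}"
    "\<And>i j. i \<in> T \<Longrightarrow> j \<in> T \<Longrightarrow> adj M i j \<in> {0, 1}"
  using assms by (auto simp: psd_graph_def adj_def)

lemma psd_graph_subset:
  assumes "psd_graph T M K" "S \<subseteq> T"
  shows "psd_graph S M K"
proof -
  note D = psd_graphD[OF assms(1)]
  have "psd S M" by (rule psd_subset[OF D(2,1) assms(2)])
  moreover have "finite S" using D(1) assms(2) by (rule finite_subset[rotated])
  ultimately show ?thesis using D(3-5) assms(2) by (auto simp: psd_graph_def subset_iff)
qed

lemma adj_bounds:
  assumes "psd_graph T M K" "i \<in> T" "j \<in> T"
  shows "0 \<le> adj M i j" "adj M i j \<le> 1" "(adj M i j)\<^sup>2 = adj M i j" "adj M i j * M i j = adj M i j"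
  using psd_graphD(6)[OF assms] by (auto simp: adj_def split: if_splits)

lemma weight_le:
  assumes "psd_graph T M K"
  shows "weight T M \<le> (real (card T))\<^sup>2"
proof -
  have "weight T M \<le> (\<Sum>i\<in>T. \<Sum>j\<in>T. 1)"
    unfolding weight_def using adj_bounds(2)[OF assms] by (intro sum_mono)
  then show ?thesis by (simp add: power2_eq_square)
qed

text \<open>The discarded part has squared Frobenius norm at most \<open>c * \<tau>\<close>, so by
  Cauchy-Schwarz its correlation with the adjacency matrix is small. \<open>Z\<close> is separate
  from \<open>M\<close> so that an approximation found earlier, of smaller trace, can be truncated
  again.\<close>

lemma psd_graph_truncate:
  fixes c \<tau> :: real
  assumes G: "psd_graph T M K" and Z: "psd T Z" and c: "0 < c" and tr: "(\<Sum>i\<in>T. Z i i) \<le> \<tau>"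
  shows "\<exists>ys. psd T (\<lambda>i j. Z i j - gram ys i j) \<and> c * length ys \<le> \<tau> \<and>
    (\<Sum>i\<in>T. \<Sum>j\<in>T. adj M i j * (Z i j - gram ys i j)) \<le> card T * sqrt (c * \<tau>)"
proof -
  note fin = psd_graphD(1)[OF G]
  obtain ys where ys: "psd T (\<lambda>i j. Z i j - gram ys i j)"
      "\<And>x. qf T (\<lambda>i j. Z i j - gram ys i j) x \<le> c * (\<Sum>i\<in>T. (x i)\<^sup>2)"
      "c * length ys \<le> (\<Sum>i\<in>T. gram ys i i)"
    using psd_truncate[OF fin Z c] by blast
  define R where "R = (\<lambda>i j. Z i j - gram ys i j)"
  have Rpos: "0 \<le> R i i" if "i \<in> T" for i
    using psd_diag_entry[OF ys(1) fin that] by (simp add: R_def)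
  have "(\<Sum>i\<in>T. gram ys i i) \<le> (\<Sum>i\<in>T. Z i i)"
    using Rpos by (intro sum_mono) (simp add: R_def)
  moreover have trR: "(\<Sum>i\<in>T. R i i) \<le> \<tau>"
    using sum_nonneg[of T "\<lambda>i. gram ys i i", OF gram_diag_nonneg] tr by (simp add: R_def sum_subtractf)
  moreover have "(\<Sum>i\<in>T. \<Sum>j\<in>T. adj M i j * R i j) \<le> card T * sqrt (c * \<tau>)"
  proof -
    have "(\<Sum>i\<in>T. \<Sum>j\<in>T. adj M i j * R i j)\<^sup>2
        \<le> (\<Sum>i\<in>T. \<Sum>j\<in>T. (adj M i j)\<^sup>2) * (\<Sum>i\<in>T. \<Sum>j\<in>T. (R i j)\<^sup>2)"
      by (rule sum_Cauchy_Schwarz2)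
    also have "(\<Sum>i\<in>T. \<Sum>j\<in>T. (adj M i j)\<^sup>2) = weight T M"
      unfolding weight_def using adj_bounds(3)[OF G] by (intro sum.cong) auto
    also have "(\<Sum>i\<in>T. \<Sum>j\<in>T. (R i j)\<^sup>2) \<le> c * (\<Sum>i\<in>T. R i i)"
      by (rule psd_Frobenius_bound) (use fin ys in \<open>auto simp: R_def\<close>)
    also have "\<dots> \<le> c * \<tau>" using trR c by simp
    finally have "(\<Sum>i\<in>T. \<Sum>j\<in>T. adj M i j * R i j)\<^sup>2 \<le> weight T M * (c * \<tau>)"
      using adj_bounds(1)[OF G] by (simp add: weight_def mult_left_mono sum_nonneg)
    also have "\<dots> \<le> (real (card T))\<^sup>2 * (c * \<tau>)"
      using weight_le[OF G] c trR Rpos sum_nonneg[of T "\<lambda>i. R i i"]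
      by (intro mult_right_mono mult_nonneg_nonneg) auto
    finally have "(\<Sum>i\<in>T. \<Sum>j\<in>T. adj M i j * R i j) \<le> sqrt ((real (card T))\<^sup>2 * (c * \<tau>))"
      by (rule real_le_rsqrt)
    then show ?thesis by (simp add: real_sqrt_mult)
  qed
  ultimately show ?thesis using ys(1,3) tr unfolding R_def by (intro exI[of _ ys]) linarith
qed

text \<open>The power \<open>k\<close> is chosen with x^(128 k) between n and n^2. Then (x^\<eta>)^k
  is at least n^(\<eta>/128), hence at least 2 K, whereas the rank contributes at most x^(16 k)
  \<le> n^(1/4). The factors \<open>k\<close> and K^2 cost at most n^(1/32) and n^(1/64), so the
  product stays below sqrt n.\<close>

lemma large_diagonal_sqrt_bound:
  fixes x n :: real
  assumes G: "psd_graph T M K" and n: "n = real (card T)"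
    and \<eta>: "0 < \<eta>" "\<eta> \<le> 1" and K: "2 * K \<le> n powr (\<eta> / 128)"
    and x: "2 \<le> x\<^sup>2" "0 < x" "x ^ 128 \<le> n"
    and le: "psd T (\<lambda>i j. M i j - gram ys i j)" and len: "length ys \<le> x ^ 16"
  shows "card {i \<in> T. x powr \<eta> \<le> gram ys i i} \<le> sqrt n"
proof -
  note K1 = psd_graphD(3)[OF G]
  have x1: "1 < x"
  proof (rule ccontr)
    assume "\<not> 1 < x"
    then have "x\<^sup>2 \<le> 1" using x(2) by (intro power_le_one) auto
    with x(1) show False by simp
  qed
  have n1: "1 < n" using one_less_power[OF x1, of 128] x(3) by simp
  define k where "k = (LEAST k. n \<le> x ^ (128 * k))"
  obtain k0 where "n < (x ^ 128) ^ k0"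
    using real_arch_pow[of "x ^ 128" n] one_less_power[OF x1, of 128] by auto
  then have "n \<le> x ^ (128 * k0)" by (simp add: power_mult)
  then have k1: "n \<le> x ^ (128 * k)" unfolding k_def by (rule LeastI)
  then have k0: "k \<noteq> 0" using n1 by (intro notI) simp
  have "\<not> n \<le> x ^ (128 * (k - 1))"
    using not_less_Least[of "k - 1" "\<lambda>k. n \<le> x ^ (128 * k)"] k0 unfolding k_def[symmetric] by auto
  moreover have "x ^ (128 * k) = x ^ (128 * (k - 1)) * x ^ 128"
    using k0 by (cases k) (auto simp: power_add[symmetric] algebra_simps)
  ultimately have k2: "x ^ (128 * k) \<le> n * n"
    using x(3) n1 x1 by (simp add: mult_mono)
  have xpow: "x ^ (2 * k * a) \<le> n powr (a / 32)" for a :: nat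
  proof -
    have "x ^ (2 * k * a) = (x ^ (128 * k)) powr (a / 64)"
    proof -
      have "real (2 * k * a) = real (128 * k) * (a / 64)" by simp
      then show ?thesis using x(2) by (simp only: powr_powr powr_realpow[symmetric])
    qed
    also have "\<dots> \<le> (n * n) powr (a / 64)" using k2 x(2) by (intro powr_mono2) auto
    also have "\<dots> = n powr (a / 32)" using n1 by (simp add: powr_mult powr_add[symmetric])
    finally show ?thesis .
  qed
  have rho1: "1 \<le> x powr \<eta>" using x1 \<eta> by (intro ge_one_powr_ge_zero) auto
  have "2 * K \<le> n powr (\<eta> / 128)" by (rule K)
  also have "\<dots> \<le> (x ^ (128 * k)) powr (\<eta> / 128)" using k1 n1 \<eta> by (intro powr_mono2) auto
  also have "\<dots> = (x powr \<eta>) ^ k"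
  proof -
    have "real (128 * k) * (\<eta> / 128) = \<eta> * real k" by simp
    then show ?thesis using x(2) by (simp only: powr_powr powr_realpow[symmetric] powr_gt_zero)
  qed
  finally have rho2: "2 * K \<le> (x powr \<eta>) ^ k" .
  have "card {i \<in> T. x powr \<eta> \<le> gram ys i i} \<le> 2 * real k * K\<^sup>2 * real (length ys) ^ k"
    by (rule large_diagonal_bound[OF psd_graphD(1,2,3)[OF G] _ _ le rho1 rho2])
      (use psd_graphD[OF G] k0 in auto)
  also have "\<dots> \<le> 2 * n powr (1 / 32) * (n powr (1 / 128) / 2)\<^sup>2 * n powr (8 / 32)"
  proof (intro mult_mono power_mono)
    have "real k \<le> 2 ^ k" using of_nat_less_two_power[of k, where ?'a = real] by simp
    also have "\<dots> \<le> x ^ (2 * k * 1)" using x by (simp add: power_mult power_mono)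
    also have "\<dots> \<le> n powr (1 / 32)" using xpow[of 1] by simp
    finally show "real k \<le> n powr (1 / 32)" .
    have "n powr (\<eta> / 128) \<le> n powr (1 / 128)" using n1 \<eta> by (intro powr_mono) auto
    then show "K \<le> n powr (1 / 128) / 2" using K by simp
    have "real (length ys) ^ k \<le> (x ^ 16) ^ k" using len by (intro power_mono) auto
    also have "\<dots> = x ^ (2 * k * 8)" by (simp add: power_mult[symmetric])
    also have "\<dots> \<le> n powr (8 / 32)" using xpow[of 8] by simp
    finally show "real (length ys) ^ k \<le> n powr (8 / 32)" .
  qed (use K1 n1 in auto)
  also have "\<dots> = n powr (1 / 32 + 1 / 64 + 8 / 32) / 2"
    using n1 by (simp add: power2_eq_square powr_add[symmetric])
  also have "\<dots> \<le> n powr (1 / 32 + 1 / 64 + 8 / 32)" by simp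
  also have "\<dots> \<le> n powr (1 / 2)" using n1 by (intro powr_mono) auto
  finally show ?thesis using n1 by (simp add: powr_half_sqrt)
qed

text \<open>The regime where \<open>x\<close> is at least a fixed root of \<open>n\<close>: here K
  \<le> x^4, so the trace of \<open>M\<close> itself is at most x^4 n, and truncation at level n /
  x^8 leaves rank at most x^12 and error at most n^2 / x^2.\<close>

lemma low_rank_approximation_fine:
  fixes x n :: real
  assumes G: "psd_graph T M K" and n: "n = real (card T)"
    and K: "2 * K \<le> n powr (1 / 128)"
    and x: "1 < x" "x ^ 128 \<le> n" "n \<le> x ^ 512"
  shows "\<exists>ys. psd T (\<lambda>i j. M i j - gram ys i j) \<and> length ys \<le> x ^ 16 \<and>
    (\<Sum>i\<in>T. \<Sum>j\<in>T. adj M i j * (M i j - gram ys i j)) \<le> 8 * n\<^sup>2 / x\<^sup>2"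
proof -
  note K1 = psd_graphD(3)[OF G]
  have n0: "0 < n" using x one_le_power[of x 128] by linarith
  have "2 * K \<le> n powr (1 / 128)" by (rule K)
  also have "\<dots> \<le> (x ^ 512) powr (1 / 128)" using x n0 by (intro powr_mono2) auto
  also have "\<dots> = x ^ 4" using x by (simp add: power_powr powr_numeral)
  finally have Kx: "K \<le> x ^ 4" using K1 by simp
  define c where "c = n / x ^ 8"
  have c: "0 < c" using n0 x by (simp add: c_def)
  have "(\<Sum>i\<in>T. M i i) \<le> (\<Sum>i\<in>T. x ^ 4)" using psd_graphD(4)[OF G] Kx by (intro sum_mono) force
  then have tr: "(\<Sum>i\<in>T. M i i) \<le> x ^ 4 * n" by (simp add: n mult.commute)
  from psd_graph_truncate[OF G psd_graphD(2)[OF G] c tr] obtain ys where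
    ys: "psd T (\<lambda>i j. M i j - gram ys i j)" "c * length ys \<le> x ^ 4 * n"
      "(\<Sum>i\<in>T. \<Sum>j\<in>T. adj M i j * (M i j - gram ys i j)) \<le> card T * sqrt (c * (x ^ 4 * n))" by blast
  have "n * length ys \<le> n * x ^ 12"
    using ys(2) x(1) by (simp add: c_def field_simps eval_nat_numeral)
  then have "length ys \<le> x ^ 12" using n0 by simp
  also have "x ^ 12 \<le> x ^ 16" using x(1) by (intro power_increasing) auto
  finally have len: "length ys \<le> x ^ 16" .
  have "c * (x ^ 4 * n) = (n / x\<^sup>2)\<^sup>2"
    using x(1) by (simp add: c_def field_simps eval_nat_numeral)
  then have "card T * sqrt (c * (x ^ 4 * n)) = n\<^sup>2 / x\<^sup>2"
    using n0 by (simp add: n[symmetric]) (simp add: power2_eq_square)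
  also have "\<dots> \<le> 8 * n\<^sup>2 / x\<^sup>2" by (simp add: divide_right_mono)
  finally show ?thesis using ys(1,3) len by (intro exI[of _ ys]) linarith
qed

text \<open>Passing from the scale x^2 to \<open>x\<close>. At most sqrt n diagonal entries of the
  given approximation reach x^2, and each is at most K \<le> sqrt n, so its trace is at most 2 x^2 n
  however large \<open>K\<close> is compared with \<open>x\<close>. Truncating again at level n /
  x^8 costs at most 2 n^2 / x^2, the old error 8 n^2 / x^4 is at most 4 n^2 / x^2, and the constant
  8 survives.\<close>

lemma low_rank_approximation_step:
  fixes x n :: real
  assumes G: "psd_graph T M K" and n: "n = real (card T)"
    and K: "2 * K \<le> n powr (1 / 128)"
    and x: "2 \<le> x\<^sup>2" "0 < x" "(x\<^sup>2) ^ 128 \<le> n"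
    and ys: "psd T (\<lambda>i j. M i j - gram ys i j)" "length ys \<le> (x\<^sup>2) ^ 16"
      "(\<Sum>i\<in>T. \<Sum>j\<in>T. adj M i j * (M i j - gram ys i j)) \<le> 8 * n\<^sup>2 / (x\<^sup>2)\<^sup>2"
  shows "\<exists>ys. psd T (\<lambda>i j. M i j - gram ys i j) \<and> length ys \<le> x ^ 16 \<and>
    (\<Sum>i\<in>T. \<Sum>j\<in>T. adj M i j * (M i j - gram ys i j)) \<le> 8 * n\<^sup>2 / x\<^sup>2"
proof -
  note fin = psd_graphD(1)[OF G] and K1 = psd_graphD(3)[OF G]
  have n1: "1 < n" using one_less_power[of "x\<^sup>2" 128] x by linarith
  have Ksqrt: "K \<le> sqrt n"
  proof -
    have "K \<le> n powr (1 / 128)" using K K1 by linarith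
    also have "\<dots> \<le> n powr (1 / 2)" using n1 by (intro powr_mono) auto
    finally show ?thesis using n1 by (simp add: powr_half_sqrt)
  qed
  define U where "U = {i \<in> T. x\<^sup>2 \<le> gram ys i i}"
  have "2 \<le> (x\<^sup>2)\<^sup>2" using power_mono[OF x(1), of 2] by simp
  then have "card {i \<in> T. (x\<^sup>2) powr 1 \<le> gram ys i i} \<le> sqrt n"
    by (intro large_diagonal_sqrt_bound[OF G n, of 1 "x\<^sup>2"]) (use K x ys in auto)
  then have cardU: "card U \<le> sqrt n" using x(2) by (simp add: U_def)
  have diag: "gram ys i i \<le> K" if "i \<in> T" for i
    using psd_diag_entry[OF ys(1) fin that] psd_graphD(4)[OF G that] by simp
  have U: "U \<subseteq> T" "finite U" using fin by (auto simp: U_def)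
  have "(\<Sum>i\<in>T. gram ys i i) = (\<Sum>i\<in>T - U. gram ys i i) + (\<Sum>i\<in>U. gram ys i i)"
    using U fin by (metis sum.subset_diff)
  also have "(\<Sum>i\<in>T - U. gram ys i i) \<le> (\<Sum>i\<in>T - U. x\<^sup>2)"
    by (intro sum_mono) (auto simp: U_def)
  also have "\<dots> \<le> (\<Sum>i\<in>T. x\<^sup>2)" using fin by (intro sum_mono2) auto
  also have "\<dots> = n * x\<^sup>2" by (simp add: n)
  also have "(\<Sum>i\<in>U. gram ys i i) \<le> (\<Sum>i\<in>U. K)" using diag U by (intro sum_mono) auto
  also have "\<dots> \<le> sqrt n * sqrt n"
    using mult_mono[OF cardU Ksqrt] K1 n1 by simp
  also have "\<dots> \<le> n * x\<^sup>2" using n1 x(1) by (simp add: mult_le_cancel_left1)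
  finally have tr: "(\<Sum>i\<in>T. gram ys i i) \<le> 2 * x\<^sup>2 * n" by (simp add: mult_ac)
  define c where "c = n / x ^ 8"
  have c: "0 < c" using n1 x by (simp add: c_def)
  from psd_graph_truncate[OF G psd_gram c tr] obtain zs where
    zs: "psd T (\<lambda>i j. gram ys i j - gram zs i j)" "c * length zs \<le> 2 * x\<^sup>2 * n"
      "(\<Sum>i\<in>T. \<Sum>j\<in>T. adj M i j * (gram ys i j - gram zs i j)) \<le> card T * sqrt (c * (2 * x\<^sup>2 * n))" by blast
  have "n * length zs \<le> n * (2 * x ^ 10)"
    using zs(2) x(2) by (simp add: c_def field_simps eval_nat_numeral)
  then have "length zs \<le> 2 * x ^ 10" using n1 by simp
  also have "\<dots> \<le> x\<^sup>2 * x ^ 10" using x by (intro mult_right_mono) auto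
  also have "\<dots> \<le> x\<^sup>2 * x ^ 10 * (x\<^sup>2)\<^sup>2"
    using \<open>2 \<le> (x\<^sup>2)\<^sup>2\<close> x(2) mult_left_mono[of 1 "(x\<^sup>2)\<^sup>2" "x\<^sup>2 * x ^ 10"] by simp
  also have "\<dots> = x ^ 16" by (simp add: power_add[symmetric] power_mult[symmetric])
  finally have len: "length zs \<le> x ^ 16" .
  have "psd T (\<lambda>i j. (M i j - gram ys i j) + (gram ys i j - gram zs i j))"
    by (intro psd_add ys zs)
  then have P: "psd T (\<lambda>i j. M i j - gram zs i j)" by simp
  have "c * (2 * x\<^sup>2 * n) \<le> (2 * n / x ^ 3)\<^sup>2"
    using x(2) n1 by (simp add: c_def field_simps eval_nat_numeral)
  also have "(2 * n / x ^ 3)\<^sup>2 \<le> (2 * n / x\<^sup>2)\<^sup>2"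
  proof (intro power_mono divide_left_mono)
    show "x\<^sup>2 \<le> x ^ 3"
    proof (rule power_increasing)
      show "1 \<le> x" using x(1,2) by (smt (verit) power_le_one)
    qed simp
  qed (use n1 x in auto)
  finally have "sqrt (c * (2 * x\<^sup>2 * n)) \<le> 2 * n / x\<^sup>2"
    using n1 by (intro real_le_lsqrt) auto
  then have "card T * sqrt (c * (2 * x\<^sup>2 * n)) \<le> n * (2 * n / x\<^sup>2)"
    unfolding n[symmetric] using n1 by (intro mult_left_mono) auto
  also have "\<dots> = 2 * n\<^sup>2 / x\<^sup>2" by (simp add: power2_eq_square)
  finally have "(\<Sum>i\<in>T. \<Sum>j\<in>T. adj M i j * (gram ys i j - gram zs i j)) \<le> 2 * n\<^sup>2 / x\<^sup>2"
    using zs(3) by linarith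
  moreover have "8 * n\<^sup>2 / (x\<^sup>2)\<^sup>2 \<le> 4 * n\<^sup>2 / x\<^sup>2"
  proof -
    have "8 * n\<^sup>2 / (x\<^sup>2)\<^sup>2 = (8 * n\<^sup>2 / x\<^sup>2) / x\<^sup>2" by (simp add: power2_eq_square)
    also have "\<dots> \<le> (8 * n\<^sup>2 / x\<^sup>2) / 2" using x by (intro divide_left_mono) auto
    finally show ?thesis by simp
  qed
  ultimately have sum: "(\<Sum>i\<in>T. \<Sum>j\<in>T. adj M i j * (M i j - gram ys i j)) +
      (\<Sum>i\<in>T. \<Sum>j\<in>T. adj M i j * (gram ys i j - gram zs i j)) \<le> 8 * n\<^sup>2 / x\<^sup>2"
  proof -
    define r where "r = n\<^sup>2 / x\<^sup>2"
    have "8 * n\<^sup>2 / x\<^sup>2 = 8 * r" "4 * n\<^sup>2 / x\<^sup>2 = 4 * r" "2 * n\<^sup>2 / x\<^sup>2 = 2 * r" "0 \<le> r"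
      by (simp_all add: r_def)
    with ys(3) \<open>_ \<le> 2 * n\<^sup>2 / x\<^sup>2\<close> \<open>8 * n\<^sup>2 / (x\<^sup>2)\<^sup>2 \<le> _\<close> show ?thesis by linarith
  qed
  have "(\<Sum>i\<in>T. \<Sum>j\<in>T. adj M i j * (M i j - gram zs i j)) \<le> 8 * n\<^sup>2 / x\<^sup>2"
    using sum by (simp add: sum.distrib[symmetric] distrib_left[symmetric])
  with P len show ?thesis by blast
qed

text \<open>The scale \<open>x\<close> is reached from a power of \<open>n\<close> by taking iterated square roots. The
  trace bound at each scale makes the truncation errors summable over the scales.\<close>

lemma low_rank_approximation:
  fixes x n :: real
  assumes G: "psd_graph T M K" and n: "n = real (card T)"
    and K: "2 * K \<le> n powr (1 / 128)"
    and x: "2 \<le> x\<^sup>2" "0 < x" "x ^ 128 \<le> n"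
  shows "\<exists>ys. psd T (\<lambda>i j. M i j - gram ys i j) \<and> length ys \<le> x ^ 16 \<and>
    (\<Sum>i\<in>T. \<Sum>j\<in>T. adj M i j * (M i j - gram ys i j)) \<le> 8 * n\<^sup>2 / x\<^sup>2"
proof -
  \<comment> \<open>\<open>l\<close> bounds the number of squarings of \<open>x\<close> until n
    \<le> x^512, where the direct truncation applies.\<close>
  have *: "\<exists>ys. psd T (\<lambda>i j. M i j - gram ys i j) \<and> length ys \<le> x ^ 16 \<and>
    (\<Sum>i\<in>T. \<Sum>j\<in>T. adj M i j * (M i j - gram ys i j)) \<le> 8 * n\<^sup>2 / x\<^sup>2"
    if "2 \<le> x\<^sup>2" "0 < x" "x ^ 128 \<le> n" "n \<le> (x ^ 512) ^ (2 ^ l)" for l :: nat and x :: real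
    using that
  proof (induction l arbitrary: x)
    case (0 x)
    have "1 < x" using 0(1,2) by (smt (verit) power_le_one)
    with 0 show ?case by (intro low_rank_approximation_fine[OF G n K]) auto
  next
    case (Suc l x)
    have x1: "1 < x" using Suc.prems(1,2) by (smt (verit) power_le_one)
    show ?case
    proof (cases "n \<le> x ^ 512")
      case True
      with Suc.prems x1 show ?thesis by (intro low_rank_approximation_fine[OF G n K]) auto
    next
      case False
      \<comment> \<open>The gap between the exponents 128 and 512 leaves room for squaring: x^2
        still satisfies the lower bound on \<open>n\<close>.\<close>
      have "(x\<^sup>2) ^ 128 = x ^ 256" by (simp add: power_mult[symmetric])
      also have "\<dots> \<le> x ^ 512" using x1 by (intro power_increasing) auto
      finally have x2: "(x\<^sup>2) ^ 128 \<le> n" using False by linarith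
      have x3: "2 \<le> (x\<^sup>2)\<^sup>2" using power_mono[OF Suc.prems(1), of 2] by simp
      have "((x\<^sup>2) ^ 512) ^ (2 ^ l) = (x ^ 512) ^ (2 ^ Suc l)"
        by (simp add: power_mult[symmetric] mult_ac)
      with Suc.IH[OF x3 _ x2] Suc.prems obtain ys where "psd T (\<lambda>i j. M i j - gram ys i j)"
        "length ys \<le> (x\<^sup>2) ^ 16" "(\<Sum>i\<in>T. \<Sum>j\<in>T. adj M i j * (M i j - gram ys i j)) \<le> 8 * n\<^sup>2 / (x\<^sup>2)\<^sup>2"
        by auto
      with Suc.prems(1,2) x2 show ?thesis by (intro low_rank_approximation_step[OF G n K])
    qed
  qed
  have x1: "1 < x" using x(1,2) by (smt (verit) power_le_one)
  obtain l where "n < (x ^ 512) ^ l"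
    using real_arch_pow[of "x ^ 512" n] one_less_power[OF x1, of 512] by auto
  also have "\<dots> \<le> (x ^ 512) ^ (2 ^ l)"
    using one_le_power[of x 512] x1 by (intro power_increasing) (auto intro: less_imp_le less_exp)
  finally show ?thesis using *[OF x, of l] by simp
qed

section \<open>Density increment\<close>

lemma qf_const_one:
  assumes "finite S"
  shows "qf S M (\<lambda>_. 1) = weight S M + (\<Sum>i\<in>S. M i i)"
proof -
  have "(\<Sum>j\<in>S. M i j) = (\<Sum>j\<in>S. adj M i j) + M i i" if "i \<in> S" for i
  proof -
    have "(\<Sum>j\<in>S. M i j) = (\<Sum>j\<in>S. adj M i j + (if i = j then M i i else 0))"
      by (intro sum.cong refl) (simp add: adj_def)
    then show ?thesis using assms that by (simp add: sum.distrib)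
  qed
  then show ?thesis by (simp add: qf_def weight_def sum.distrib)
qed

text \<open>Cauchy-Schwarz between the unit vector at \<open>u\<close> and the indicator of
  \<open>S\<close>, in the form \<open>gram ys\<close>, which lies below \<open>M\<close>. For
  \<open>S\<close> the neighbourhood of \<open>u\<close>, a well-approximated row with diagonal
  entry near 1 forces almost all pairs in \<open>S\<close> to be adjacent.\<close>

lemma neighbourhood_weight_bound:
  assumes G: "psd_graph T M K" and le: "psd T (\<lambda>i j. M i j - gram ys i j)"
    and u: "u \<in> T" and S: "S \<subseteq> T"
  shows "(\<Sum>i\<in>S. gram ys u i)\<^sup>2 \<le> gram ys u u * (weight S M + K * card S)"
proof -
  note fin = psd_graphD(1)[OF G]
  have finS: "finite S" using fin S finite_subset by blast
  define e where "e = (\<lambda>i. if i = u then (1::real) else 0)"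
  define y where "y = (\<lambda>i. if i \<in> S then (1::real) else 0)"
  have "bf T (gram ys) e y = (\<Sum>i\<in>T. if i = u then (\<Sum>j\<in>T. gram ys i j * y j) else 0)"
    unfolding bf_eq by (intro sum.cong refl) (simp add: e_def)
  also have "\<dots> = (\<Sum>j\<in>T. if j \<in> S then gram ys u j else 0)"
    using u fin by (auto simp: y_def intro!: sum.cong)
  also have "\<dots> = (\<Sum>j\<in>T \<inter> S. gram ys u j)"
    using fin by (rule sum.inter_restrict[symmetric])
  also have "T \<inter> S = S" using S by blast
  finally have b: "bf T (gram ys) e y = (\<Sum>i\<in>S. gram ys u i)" .
  have e: "qf T (gram ys) e = gram ys u u"
    unfolding qf_eq_bf e_def using fin u u by (rule bf_units)
  have "qf T (gram ys) y \<le> qf T M y"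
    using psd_qf[OF le, of y] by (simp add: qf_diff_matrix)
  also have "\<dots> = qf S M (\<lambda>_. 1)"
    unfolding y_def using qf_subset[OF fin S, of M "\<lambda>_. 1"] by simp
  also have "\<dots> \<le> weight S M + K * card S"
  proof -
    have "(\<Sum>i\<in>S. M i i) \<le> (\<Sum>i\<in>S. K)" using psd_graphD(4)[OF G] S by (intro sum_mono) auto
    then show ?thesis by (simp add: qf_const_one[OF finS] mult.commute)
  qed
  finally have "qf T (gram ys) y \<le> weight S M + K * card S" .
  then show ?thesis
    using psd_Cauchy_Schwarz[OF psd_gram, of T ys e y] gram_diag_nonneg[of ys u]
    unfolding b e by (meson mult_left_mono order_trans)
qed

text \<open>A suitable vertex \<open>u\<close> outside the few with large diagonal entry has its row
  captured by the low-rank approximation, and its neighbourhood is the required set. The bound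
  \<rho> = x^\<eta> on the diagonal entry at \<open>u\<close> is the price that separates the
  density from 1 - 7 \<kappa>.\<close>

lemma densify:
  fixes n \<kappa> q \<eta> :: real
  assumes G: "psd_graph T M K" and n: "n = real (card T)"
    and \<eta>: "0 < \<eta>" "\<eta> \<le> 1" and K: "2 * K \<le> n powr (\<eta> / 128)"
    and \<kappa>: "0 < \<kappa>" "\<kappa> < 1 / 8" and q: "0 < q" "weight T M = q * n\<^sup>2"
    and size: "(8 / (\<kappa> * q)) ^ 64 \<le> n"
  shows "\<exists>S\<subseteq>T. \<kappa>\<^sup>2 * q\<^sup>2 * n / 16 \<le> card S \<and>
    (1 - 7 * \<kappa>) * (real (card S))\<^sup>2 / sqrt (8 / (\<kappa> * q)) powr \<eta> \<le> weight S M"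
proof -
  note fin = psd_graphD(1)[OF G] and K1 = psd_graphD(3)[OF G]
  \<comment> \<open>Chosen so that the approximation error 8 n^2 / x^2 equals \<kappa> times the
    weight q n^2.\<close>
  define x where "x = sqrt (8 / (\<kappa> * q))"
  define \<rho> where "\<rho> = x powr \<eta>"
  have kq0: "0 < \<kappa> * q" using \<kappa> q by simp
  have n0: "0 < n" using size kq0 by (smt (verit) zero_less_divide_iff zero_less_power)
  have q1: "q \<le> 1"
    using weight_le[OF G] n0 q by (simp add: n[symmetric])
  have kq1: "\<kappa> * q \<le> 1 / 8" using \<kappa> q q1 mult_mono[of \<kappa> "1/8" q 1] by simp
  have x2: "x\<^sup>2 = 8 / (\<kappa> * q)" using kq0 by (simp add: x_def)
  have x: "2 \<le> x\<^sup>2" "0 < x" "x ^ 128 \<le> n"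
  proof -
    show "2 \<le> x\<^sup>2" unfolding x2 using kq0 kq1 by (simp add: field_simps)
    show "0 < x" using kq0 by (simp add: x_def)
    have "x ^ 128 = (x\<^sup>2) ^ 64" by (simp add: power_mult[symmetric])
    then show "x ^ 128 \<le> n" using size by (simp add: x2)
  qed
  have x1: "1 \<le> x" using x by (smt (verit) power_le_one)
  have n1: "1 \<le> n" using x(3) one_le_power[OF x1, of 128] by linarith
  \<comment> \<open>In terms of the 128th root of \<open>n\<close> the hypotheses give 2 K \<le> z
    and 8 / z^2 \<le> \<kappa> q, so the smallness conditions on \<open>K\<close> reduce to
    comparing powers of \<open>z\<close>.\<close>
  define z where "z = n powr (1 / 128)"
  have z0: "0 < z" using n0 by (simp add: z_def)
  have zn: "z ^ 128 = n" using n0 by (simp add: z_def powr_realpow[symmetric] powr_powr)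
  have Kz: "2 * K \<le> z"
  proof -
    have "n powr (\<eta> / 128) \<le> z" unfolding z_def using n1 \<eta> by (intro powr_mono) auto
    then show ?thesis using K by linarith
  qed
  have z2: "2 \<le> z" using Kz K1 by linarith
  have kqz: "8 / z\<^sup>2 \<le> \<kappa> * q"
  proof -
    have "(x\<^sup>2) ^ 64 \<le> (z\<^sup>2) ^ 64" using x(3) by (simp add: zn flip: power_mult)
    then have "x\<^sup>2 \<le> z\<^sup>2" by (rule power_le_imp_le_base[of _ 63, simplified]) simp
    then show ?thesis using kq0 z0 by (simp add: x2 field_simps)
  qed
  have K_small1: "K < \<kappa> * q * sqrt n / 2"
  proof -
    have "K < z" using Kz K1 by linarith
    also have "z \<le> z ^ 62" using z2 self_le_power[of z 62] by simp
    also have "\<dots> = (8 / z\<^sup>2) * z ^ 64 / 8" using z0 by (simp add: field_simps power_add[symmetric])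
    also have "\<dots> \<le> (\<kappa> * q) * z ^ 64 / 2"
      using kqz z0 by (intro divide_mono mult_right_mono) auto
    also have "z ^ 64 = sqrt n"
    proof -
      have "(z ^ 64)\<^sup>2 = n" using zn by (simp flip: power_mult)
      then show ?thesis using z0 real_sqrt_unique[of "z ^ 64" n] by simp
    qed
    finally show ?thesis by simp
  qed
  have K_small2: "128 * K \<le> (\<kappa> * q) ^ 4 * n"
  proof -
    have "128 * K \<le> 64 * z" using Kz by linarith
    also have "\<dots> \<le> 4096 * z ^ 120" using z2 self_le_power[of z 120] by simp
    also have "\<dots> = (8 / z\<^sup>2) ^ 4 * z ^ 128" using z0
      by (simp add: field_simps power_mult[symmetric] power_add[symmetric])
    also have "\<dots> \<le> (\<kappa> * q) ^ 4 * z ^ 128"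
      using kqz z0 by (intro mult_right_mono power_mono) auto
    finally show ?thesis by (simp add: zn)
  qed
  have K_small3: "K < \<kappa> * q * n / 2"
  proof -
    have "sqrt n \<le> n" using n1 by (simp add: real_le_lsqrt power2_eq_square)
    then have "\<kappa> * q * sqrt n \<le> \<kappa> * q * n" using kq0 by (intro mult_left_mono) auto
    then show ?thesis using K_small1 by linarith
  qed
  have K128: "2 * K \<le> n powr (1 / 128)" using Kz by (simp add: z_def)
  obtain ys where ys: "psd T (\<lambda>i j. M i j - gram ys i j)" "length ys \<le> x ^ 16"
    "(\<Sum>i\<in>T. \<Sum>j\<in>T. adj M i j * (M i j - gram ys i j)) \<le> 8 * n\<^sup>2 / x\<^sup>2"
    using low_rank_approximation[OF G n K128 x] by blast
  define U where "U = {i \<in> T. \<rho> \<le> gram ys i i}"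
  have U: "U \<subseteq> T" "finite U" using fin by (auto simp: U_def)
  have cardU: "card U \<le> sqrt n"
    unfolding U_def \<rho>_def by (rule large_diagonal_sqrt_bound[OF G n \<eta> K x ys(1,2)])
  define d where "d = (\<lambda>u. \<Sum>i\<in>T. adj M u i)"
  define w where "w = (\<lambda>u. \<Sum>i\<in>T. adj M u i * gram ys u i)"
  have diag: "gram ys i i \<le> K" if "i \<in> T" for i
    using psd_diag_entry[OF ys(1) fin that] psd_graphD(4)[OF G that] by simp
  have wK: "w u \<le> n * K" if "u \<in> T" for u
  proof -
    have "adj M u i * gram ys u i \<le> K" if i: "i \<in> T" for i
    proof -
      have "(gram ys u i)\<^sup>2 \<le> gram ys u u * gram ys i i"
        using psd_entry_bound[OF psd_gram fin \<open>u \<in> T\<close> i] .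
      also have "\<dots> \<le> K * K" using diag i \<open>u \<in> T\<close> gram_diag_nonneg K1 by (intro mult_mono) auto
      finally have "\<bar>gram ys u i\<bar> \<le> K" using K1 abs_le_square_iff[of "gram ys u i" K]
        by (simp add: power2_eq_square)
      then show ?thesis using psd_graphD(6)[OF G \<open>u \<in> T\<close> i] K1 by auto
    qed
    then have "w u \<le> (\<Sum>i\<in>T. K)" unfolding w_def by (intro sum_mono)
    then show ?thesis by (simp add: n)
  qed
  have sum_w: "(1 - \<kappa>) * q * n\<^sup>2 \<le> (\<Sum>u\<in>T. w u)"
  proof -
    have "(\<Sum>i\<in>T. \<Sum>j\<in>T. adj M i j * M i j) = (\<Sum>i\<in>T. \<Sum>j\<in>T. adj M i j)"
      using adj_bounds(4)[OF G] by (intro sum.cong refl)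
    then have "(\<Sum>i\<in>T. \<Sum>j\<in>T. adj M i j * (M i j - gram ys i j)) = weight T M - (\<Sum>u\<in>T. w u)"
      by (simp add: weight_def w_def right_diff_distrib sum_subtractf)
    moreover have "8 * n\<^sup>2 / x\<^sup>2 = \<kappa> * q * n\<^sup>2" using kq0 by (simp add: x2)
    ultimately show ?thesis using ys(3) q by (simp add: algebra_simps)
  qed
  \<comment> \<open>Averaging: the vertices of \<open>U\<close> contribute at most sqrt n times n K,
    less than \<kappa> q n^2 / 2, so failure at all others would leave a total below (1 - 3/2
    \<kappa>) q n^2. The additive term \<kappa> q n prevents \<open>u\<close> from having too few
    neighbours.\<close>
  have "\<exists>u\<in>T - U. (1 - 3 * \<kappa>) * d u + \<kappa> * q * n < w u"
  proof (rule ccontr)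
    assume "\<not> ?thesis"
    then have small: "w u \<le> (1 - 3 * \<kappa>) * d u + \<kappa> * q * n" if "u \<in> T - U" for u
      using that by force
    have dn: "0 \<le> d u" if "u \<in> T" for u
      using adj_bounds(1)[OF G that] by (simp add: d_def sum_nonneg)
    have "(\<Sum>u\<in>T. w u) = (\<Sum>u\<in>T - U. w u) + (\<Sum>u\<in>U. w u)"
      using sum.subset_diff[OF U(1) fin] .
    also have "(\<Sum>u\<in>T - U. w u) \<le> (\<Sum>u\<in>T - U. (1 - 3 * \<kappa>) * d u + \<kappa> * q * n)"
      by (intro sum_mono small)
    also have "\<dots> \<le> (\<Sum>u\<in>T. (1 - 3 * \<kappa>) * d u + \<kappa> * q * n)"
      using fin \<kappa> kq0 n0 dn by (intro sum_mono2) auto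
    also have "\<dots> = (1 - 3 * \<kappa>) * (q * n\<^sup>2) + \<kappa> * q * n\<^sup>2"
      using q(2) by (simp add: sum.distrib weight_def d_def n power2_eq_square flip: sum_distrib_left)
    also have "(\<Sum>u\<in>U. w u) \<le> (\<Sum>u\<in>U. n * K)" using U wK by (intro sum_mono) auto
    also have "\<dots> \<le> sqrt n * (n * K)" using cardU n0 K1 by (simp add: mult_right_mono)
    also have "\<dots> < sqrt n * (n * (\<kappa> * q * sqrt n / 2))"
      using K_small1 n0 by (intro mult_strict_left_mono) auto
    also have "\<dots> = \<kappa> * q * n\<^sup>2 / 2" using n0 by (simp add: power2_eq_square)
    finally have "(\<Sum>u\<in>T. w u) < (1 - 3 * \<kappa>) * (q * n\<^sup>2) + \<kappa> * q * n\<^sup>2 + \<kappa> * q * n\<^sup>2 / 2" by simp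
    moreover have "0 \<le> \<kappa> * q * n\<^sup>2" using kq0 by simp
    ultimately show False using sum_w by (simp add: algebra_simps)
  qed
  then obtain u where u: "u \<in> T" "u \<notin> U" "(1 - 3 * \<kappa>) * d u + \<kappa> * q * n < w u" by blast
  define S where "S = {i \<in> T. adj M u i = 1}"
  have S: "S \<subseteq> T" "finite S" using fin by (auto simp: S_def)
  have restrict: "(\<Sum>i\<in>T. adj M u i * f i) = (\<Sum>i\<in>S. f i)" for f
  proof -
    have "(\<Sum>i\<in>T. adj M u i * f i) = (\<Sum>i\<in>S. adj M u i * f i)"
      using fin S psd_graphD(6)[OF G u(1)] by (intro sum.mono_neutral_right) (auto simp: S_def)
    then show ?thesis by (simp add: S_def)
  qed
  define D where "D = real (card S)"
  have d: "d u = D" using restrict[of "\<lambda>_. 1"] by (simp add: d_def D_def)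
  have w: "w u = (\<Sum>i\<in>S. gram ys u i)" unfolding w_def by (rule restrict)
  have D0: "0 \<le> D" by (simp add: D_def)
  have wS: "weight S M \<le> D\<^sup>2"
    using weight_le[OF psd_graph_subset[OF G S(1)]] by (simp add: D_def)
  have wS0: "0 \<le> weight S M"
    unfolding weight_def using adj_bounds(1)[OF psd_graph_subset[OF G S(1)]] by (simp add: sum_nonneg)
  have rho0: "0 < \<rho>" using x by (simp add: \<rho>_def)
  have "(w u)\<^sup>2 \<le> gram ys u u * (weight S M + K * D)"
    using neighbourhood_weight_bound[OF G ys(1) u(1) S(1)] by (simp add: w D_def)
  also have "\<dots> \<le> \<rho> * (weight S M + K * D)"
    using u wS0 K1 D0 by (intro mult_right_mono) (auto simp: U_def)
  finally have w2: "(w u)\<^sup>2 \<le> \<rho> * (weight S M + K * D)" .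
  have rho_le: "\<rho> \<le> 8 / (\<kappa> * q)"
  proof -
    have "\<rho> \<le> x powr 1" unfolding \<rho>_def using x1 \<eta> by (intro powr_mono) auto
    also have "\<dots> \<le> x\<^sup>2" using x1 by (simp add: power2_eq_square)
    finally show ?thesis by (simp add: x2)
  qed
  \<comment> \<open>With fewer than \<open>D'\<close> neighbours, the trivial bound D^2 on their
    weight would contradict w u \<ge> \<kappa> q n.\<close>
  define D' where "D' = \<kappa>\<^sup>2 * q\<^sup>2 * n / 16"
  have D'0: "0 < D'" using \<kappa> q n0 by (simp add: D'_def)
  have large: "D' \<le> D"
  proof (rule ccontr)
    assume "\<not> D' \<le> D"
    then have less: "D \<le> D'" by simp
    have "(\<kappa> * q * n)\<^sup>2 \<le> (w u)\<^sup>2"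
    proof (rule power_mono)
      have "0 \<le> (1 - 3 * \<kappa>) * d u" using \<kappa> D0 by (simp add: d)
      then show "\<kappa> * q * n \<le> w u" using u(3) by linarith
    qed (use kq0 n0 in simp)
    also note w2
    also have "\<rho> * (weight S M + K * D) \<le> 8 / (\<kappa> * q) * (D'\<^sup>2 + K * D')"
    proof (intro mult_mono add_mono)
      show "weight S M \<le> D'\<^sup>2" using wS power_mono[OF less D0, of 2] by linarith
    qed (use rho_le wS0 less D0 K1 kq0 in auto)
    also have "\<dots> = (\<kappa> * q) ^ 3 * n\<^sup>2 / 32 + \<kappa> * q * n / 2 * K"
      using \<kappa> q by (simp add: D'_def field_simps eval_nat_numeral)
    also have "(\<kappa> * q) ^ 3 * n\<^sup>2 / 32 \<le> (\<kappa> * q)\<^sup>2 * n\<^sup>2 / 32"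
      using kq0 kq1 by (intro divide_right_mono mult_right_mono power_decreasing) auto
    also have "\<kappa> * q * n / 2 * K < \<kappa> * q * n / 2 * (\<kappa> * q * n / 2)"
      using K_small3 kq0 n0 by (intro mult_strict_left_mono) auto
    also have "(\<kappa> * q)\<^sup>2 * n\<^sup>2 / 32 + \<kappa> * q * n / 2 * (\<kappa> * q * n / 2) \<le> (\<kappa> * q * n)\<^sup>2"
    proof -
      have "(\<kappa> * q)\<^sup>2 * n\<^sup>2 / 32 + \<kappa> * q * n / 2 * (\<kappa> * q * n / 2) = 9 / 32 * (\<kappa> * q * n)\<^sup>2"
        by (simp add: power2_eq_square)
      also have "\<dots> \<le> 1 * (\<kappa> * q * n)\<^sup>2" by (intro mult_right_mono) auto
      finally show ?thesis by simp
    qed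
    finally show False by simp
  qed
  have KD: "K * D \<le> \<kappa> / \<rho> * D\<^sup>2"
  proof -
    have "\<rho> * K \<le> 8 / (\<kappa> * q) * K" using rho_le K1 by (intro mult_right_mono) auto
    also have "\<dots> \<le> 8 / (\<kappa> * q) * ((\<kappa> * q) ^ 4 * n / 128)"
      using K_small2 kq0 by (intro mult_left_mono) auto
    also have "\<dots> = (\<kappa> * q) ^ 3 * n / 16" using \<kappa> q by (simp add: field_simps eval_nat_numeral)
    also have "\<dots> = \<kappa> * q * D'" by (simp add: D'_def power_mult_distrib eval_nat_numeral)
    also have "\<dots> \<le> \<kappa> * 1 * D" using large q1 q \<kappa> D'0 by (intro mult_mono) auto
    finally have "\<rho> * K * D \<le> \<kappa> * D * D" using D0 by (simp add: mult_right_mono)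
    then show ?thesis using rho0 by (simp add: field_simps power2_eq_square)
  qed
  have "(1 - 6 * \<kappa>) * D\<^sup>2 \<le> ((1 - 3 * \<kappa>) * D)\<^sup>2"
  proof -
    have "(1 - 3 * \<kappa>)\<^sup>2 = 1 - 6 * \<kappa> + 9 * \<kappa>\<^sup>2" by (simp add: power2_eq_square algebra_simps)
    then have "1 - 6 * \<kappa> \<le> (1 - 3 * \<kappa>)\<^sup>2" by simp
    then show ?thesis unfolding power_mult_distrib by (rule mult_right_mono) simp
  qed
  also have "\<dots> \<le> (w u)\<^sup>2"
  proof (rule power_mono)
    have "0 < \<kappa> * q * n" using kq0 n0 by (rule mult_pos_pos)
    then show "(1 - 3 * \<kappa>) * D \<le> w u" using u(3) unfolding d by linarith
  qed (use \<kappa> D0 in simp)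
  also note w2
  finally have "(1 - 6 * \<kappa>) * D\<^sup>2 / \<rho> \<le> weight S M + K * D"
    using rho0 by (simp add: field_simps)
  then have "(1 - 7 * \<kappa>) * D\<^sup>2 / \<rho> \<le> weight S M"
  proof -
    define r where "r = D\<^sup>2 / \<rho>"
    have "(1 - 6 * \<kappa>) * D\<^sup>2 / \<rho> = r - 6 * (\<kappa> * r)" "(1 - 7 * \<kappa>) * D\<^sup>2 / \<rho> = r - 7 * (\<kappa> * r)"
      "\<kappa> / \<rho> * D\<^sup>2 = \<kappa> * r"
      by (simp_all add: r_def left_diff_distrib diff_divide_distrib)
    with KD \<open>_ \<le> weight S M + K * D\<close> show ?thesis by linarith
  qed
  then show ?thesis using S(1) large unfolding D_def D'_def \<rho>_def x_def by blast
qed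

lemma finite_subset_maximizer:
  fixes f :: "'a set \<Rightarrow> 'b :: linorder"
  assumes "finite V"
  shows "\<exists>T\<subseteq>V. \<forall>S\<subseteq>V. f S \<le> f T"
proof -
  have "Max (f ` Pow V) \<in> f ` Pow V" using assms by (intro Max_in) auto
  then obtain T where "T \<subseteq> V" "Max (f ` Pow V) = f T" by auto
  moreover have "f S \<le> Max (f ` Pow V)" if "S \<subseteq> V" for S
    using assms that by (intro Max_ge) auto
  ultimately show ?thesis by metis
qed

text \<open>At a maximizer of |T| dens(T)^C with density q \<le> 1 - b, \<open>densify\<close> would
  produce a better set: the size falls at most by the factor \<kappa>^2 q^2 / 16, but the density
  rises to at least (1 - 8 \<kappa>) sqrt q. Comparison with \<open>V\<close> bounds the size of the
  maximizer from below.\<close>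

lemma dense_subset_exists:
  fixes b :: real
  assumes b: "0 < b" "b < 1"
  shows "\<exists>\<kappa> \<eta> :: real. \<exists>c :: nat. 0 < \<kappa> \<and> 0 < \<eta> \<and> \<eta> \<le> 1 \<and>
    (\<forall>(V :: 'a set) M K N q0. psd_graph V M K \<longrightarrow> N = real (card V) \<longrightarrow> 0 < q0 \<longrightarrow> q0 * N\<^sup>2 \<le> weight V M \<longrightarrow>
      (8 / (\<kappa> * q0)) ^ 64 \<le> N * q0 ^ c \<longrightarrow> 2 * K \<le> (N * q0 ^ c) powr (\<eta> / 128) \<longrightarrow>
      (\<exists>T\<subseteq>V. N * q0 ^ c \<le> card T \<and> (1 - b) * (real (card T))\<^sup>2 \<le> weight T M))"
proof -
  define \<kappa> where "\<kappa> = b / 32"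
  have \<kappa>: "0 < \<kappa>" "\<kappa> < 1 / 8" using b by (auto simp: \<kappa>_def)
  \<comment> \<open>Small enough that the price (8 / (\<kappa> q))^(\<eta>/2) costs at most a factor
    1 - \<kappa> through \<kappa> and a factor sqrt q through q.\<close>
  define \<eta> where "\<eta> = min 1 (2 * \<kappa> / ln (8 / \<kappa>))"
  have ln0: "0 < ln (8 / \<kappa>)" using \<kappa> by (intro ln_gt_zero) (simp add: field_simps)
  have \<eta>: "0 < \<eta>" "\<eta> \<le> 1" using \<kappa> ln0 by (auto simp: \<eta>_def)
  have \<eta>2: "1 - \<kappa> \<le> sqrt (\<kappa> / 8) powr \<eta>"
  proof -
    have "\<eta> * ln (8 / \<kappa>) \<le> 2 * \<kappa>" using ln0 by (simp add: \<eta>_def min_def field_simps)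
    moreover have "ln (sqrt (\<kappa> / 8)) = - ln (8 / \<kappa>) / 2"
      using \<kappa> by (simp add: ln_sqrt ln_div)
    ultimately have "- \<kappa> \<le> \<eta> * ln (sqrt (\<kappa> / 8))" by simp
    have "1 - \<kappa> \<le> exp (- \<kappa>)" using exp_ge_add_one_self[of "- \<kappa>"] by simp
    also have "\<dots> \<le> exp (\<eta> * ln (sqrt (\<kappa> / 8)))" using \<open>- \<kappa> \<le> _\<close> by simp
    also have "\<dots> = sqrt (\<kappa> / 8) powr \<eta>" using \<kappa> by (simp add: powr_def)
    finally show ?thesis .
  qed
  have b4: "0 < 1 - b / 4" "1 - b / 4 < 1" using b by auto
  have "(\<lambda>c. ((1 - b / 4)\<^sup>2) ^ c) \<longlonglongrightarrow> 0"
    using b4 power_strict_mono[of "1 - b / 4" 1 2] by (intro LIMSEQ_power_zero) auto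
  moreover have "0 < \<kappa>\<^sup>2 / 16 * (1 - b)\<^sup>2" using \<kappa> b by simp
  ultimately have "\<forall>\<^sub>F c in sequentially. ((1 - b / 4)\<^sup>2) ^ c < \<kappa>\<^sup>2 / 16 * (1 - b)\<^sup>2"
    by (rule order_tendstoD)
  then have "\<forall>\<^sub>F c in sequentially. ((1 - b / 4)\<^sup>2) ^ c < \<kappa>\<^sup>2 / 16 * (1 - b)\<^sup>2 \<and> 2 \<le> c"
    by (rule eventually_conj) (rule eventually_ge_at_top)
  then obtain c where c: "((1 - b / 4)\<^sup>2) ^ c < \<kappa>\<^sup>2 / 16 * (1 - b)\<^sup>2" "2 \<le> c"
    using eventually_happens'[OF sequentially_bot] by blast
  define C where "C = 2 * c"
  \<comment> \<open>A lower bound for the gain of the functional. Since 2 \<le> c, the worst case is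
    q = 1 - b, and 1 - b \<le> (1 - b/4)^4 with 1 - 8 \<kappa> = 1 - b/4 makes the quotient at least
    (1 - b/4)^(-2 c), which beats the fixed factors for large \<open>c\<close>.\<close>
  have key: "1 < \<kappa>\<^sup>2 / 16 * q\<^sup>2 * ((1 - 8 * \<kappa>) ^ C / q ^ c)" if q: "0 < q" "q \<le> 1 - b" for q :: real
  proof -
    have "(1 - b) ^ c \<le> ((1 - b / 4) ^ 4) ^ c"
      using Bernoulli_inequality[of "- b / 4" 4] b by (intro power_mono) auto
    also have "\<dots> = ((1 - b / 4)\<^sup>2) ^ c * (1 - b / 4) ^ C"
      by (simp add: C_def power_mult[symmetric] power_add[symmetric])
    also have "\<dots> < (\<kappa>\<^sup>2 / 16 * (1 - b)\<^sup>2) * (1 - b / 4) ^ C"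
      using c(1) b4 by (intro mult_strict_right_mono) auto
    finally have 1: "(1 - b) ^ c < (\<kappa>\<^sup>2 / 16 * (1 - b / 4) ^ C) * (1 - b)\<^sup>2" by (simp add: mult_ac)
    have "(1 - b) ^ c = (1 - b) ^ (c - 2) * (1 - b)\<^sup>2"
      using power_add[of "1 - b" "c - 2" 2] c(2) by (metis le_add_diff_inverse2)
    with 1 b have "(1 - b) ^ (c - 2) < \<kappa>\<^sup>2 / 16 * (1 - b / 4) ^ C" by simp
    moreover have "q ^ (c - 2) \<le> (1 - b) ^ (c - 2)" using q by (intro power_mono) auto
    ultimately have "q ^ (c - 2) * q\<^sup>2 < \<kappa>\<^sup>2 / 16 * (1 - b / 4) ^ C * q\<^sup>2"
      using q by (intro mult_strict_right_mono) auto
    also have "q ^ (c - 2) * q\<^sup>2 = q ^ c" using power_add[of q "c - 2" 2] c(2) by (metis le_add_diff_inverse2)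
    finally have "q ^ c < \<kappa>\<^sup>2 / 16 * (1 - b / 4) ^ C * q\<^sup>2" .
    moreover have "(1 - 8 * \<kappa>) = 1 - b / 4" by (simp add: \<kappa>_def)
    ultimately have "q ^ c < \<kappa>\<^sup>2 / 16 * q\<^sup>2 * (1 - 8 * \<kappa>) ^ C" by (simp only: mult_ac)
    then have "1 < \<kappa>\<^sup>2 / 16 * q\<^sup>2 * (1 - 8 * \<kappa>) ^ C / q ^ c"
      using q by (simp only: less_divide_eq_1_pos zero_less_power)
    then show ?thesis by simp
  qed
  show ?thesis
  proof (rule exI[of _ \<kappa>], rule exI[of _ \<eta>], rule exI[of _ C], intro conjI allI impI)
    show "0 < \<kappa>" "0 < \<eta>" "\<eta> \<le> 1" by fact+
  next
    fix V :: "'a set" and M K and N q0 :: real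
    assume G: "psd_graph V M K" and N: "N = real (card V)" and q0: "0 < q0" "q0 * N\<^sup>2 \<le> weight V M"
      and size: "(8 / (\<kappa> * q0)) ^ 64 \<le> N * q0 ^ C" and K: "2 * K \<le> (N * q0 ^ C) powr (\<eta> / 128)"
    \<comment> \<open>Division by zero gives \<open>dens {} = 0\<close>; the empty set is excluded
      as a maximizer because \<Psi> is positive at \<open>V\<close>.\<close>
    define dens where "dens = (\<lambda>T. weight T M / (real (card T))\<^sup>2)"
    define \<Psi> where "\<Psi> = (\<lambda>T. real (card T) * dens T ^ C)"
    have finV: "finite V" using psd_graphD(1)[OF G] .
    have GS: "psd_graph S M K" if "S \<subseteq> V" for S using psd_graph_subset[OF G that] .
    have dens01: "0 \<le> dens S" "dens S \<le> 1" if "S \<subseteq> V" for S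
    proof -
      have "0 \<le> weight S M"
        unfolding weight_def using adj_bounds(1)[OF GS[OF that]] by (simp add: sum_nonneg)
      then show "0 \<le> dens S" by (simp add: dens_def)
      show "dens S \<le> 1"
        unfolding dens_def by (rule divide_le_eq_1[THEN iffD2]) (use weight_le[OF GS[OF that]] in force)
    qed
    have "0 < (8 / (\<kappa> * q0)) ^ 64" using \<kappa> q0 by simp
    then have pos: "0 < N * q0 ^ C" using size by linarith
    then have N0: "0 < N" using q0 by (simp add: zero_less_mult_iff)
    obtain T where T: "T \<subseteq> V" "\<And>S. S \<subseteq> V \<Longrightarrow> \<Psi> S \<le> \<Psi> T"
      using finite_subset_maximizer[OF finV, of \<Psi>] by blast
    define n where "n = real (card T)"
    define q where "q = dens T"
    have "q0 \<le> dens V" using q0(2) N0 by (simp add: dens_def N[symmetric] field_simps)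
    then have "N * q0 ^ C \<le> \<Psi> V" using q0(1) N0 by (simp add: \<Psi>_def N[symmetric] power_mono)
    also have "\<dots> \<le> \<Psi> T" using T(2) by blast
    finally have PsiT: "N * q0 ^ C \<le> n * q ^ C" by (simp add: \<Psi>_def n_def q_def)
    have nN: "n \<le> N" using card_mono[OF finV T(1)] by (simp add: n_def N)
    have q01: "0 \<le> q" "q \<le> 1" using dens01[OF T(1)] by (auto simp: q_def)
    have "n \<noteq> 0" using PsiT pos by (intro notI) simp
    then have n0: "0 < n" by (simp add: n_def)
    have nlarge: "N * q0 ^ C \<le> n"
    proof -
      have "n * q ^ C \<le> n * 1" using q01 n0 by (intro mult_left_mono power_le_one) auto
      then show ?thesis using PsiT by simp
    qed
    have qq0: "q0 \<le> q"
    proof (rule ccontr)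
      assume "\<not> q0 \<le> q"
      then have "q ^ C < q0 ^ C" using q01 c(2) by (intro power_strict_mono) (auto simp: C_def)
      then have "n * q ^ C < N * q0 ^ C" using nN n0 q01 by (intro mult_le_less_imp_less) auto
      then show False using PsiT by linarith
    qed
    have q0': "0 < q" using qq0 q0 by linarith
    have wq: "weight T M = q * n\<^sup>2" using n0 by (simp add: q_def dens_def n_def)
    have "1 - b < q"
    proof (rule ccontr)
      assume "\<not> 1 - b < q"
      then have qb: "q \<le> 1 - b" by simp
      have "2 * K \<le> n powr (\<eta> / 128)"
        using K powr_mono2[of "\<eta> / 128" "N * q0 ^ C" n] nlarge pos \<eta> by simp
      moreover have "(8 / (\<kappa> * q)) ^ 64 \<le> n"
      proof -
        have "(8 / (\<kappa> * q)) ^ 64 \<le> (8 / (\<kappa> * q0)) ^ 64"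
          using qq0 q0 \<kappa> by (intro power_mono divide_left_mono mult_left_mono) auto
        then show ?thesis using size nlarge by linarith
      qed
      ultimately obtain S where S: "S \<subseteq> T" "\<kappa>\<^sup>2 * q\<^sup>2 * n / 16 \<le> card S"
        "(1 - 7 * \<kappa>) * (real (card S))\<^sup>2 / sqrt (8 / (\<kappa> * q)) powr \<eta> \<le> weight S M"
        using densify[OF GS[OF T(1)] n_def \<eta> _ \<kappa> q0' wq] by blast
      have "0 < \<kappa>\<^sup>2 * q\<^sup>2 * n / 16" using \<kappa> q0' n0 by simp
      then have S0: "0 < real (card S)" using S(2) by linarith
      have "(1 - 7 * \<kappa>) / sqrt (8 / (\<kappa> * q)) powr \<eta> \<le> dens S"
        using S(3) S0 by (simp add: dens_def field_simps)
      moreover have "(1 - 8 * \<kappa>) * sqrt q \<le> (1 - 7 * \<kappa>) / sqrt (8 / (\<kappa> * q)) powr \<eta>"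
      proof -
        have "1 / sqrt (8 / (\<kappa> * q)) powr \<eta> = sqrt ((\<kappa> / 8) * q) powr \<eta>"
          using \<kappa> q0' by (simp add: real_sqrt_divide powr_divide real_sqrt_mult field_simps)
        also have "\<dots> = sqrt (\<kappa> / 8) powr \<eta> * sqrt q powr \<eta>"
          using \<kappa> q0' by (simp only: real_sqrt_mult powr_mult real_sqrt_ge_zero divide_nonneg_nonneg less_imp_le)
        also have "\<dots> \<ge> (1 - \<kappa>) * sqrt q powr 1"
          using \<eta>2 \<kappa> \<eta> q01 q0' by (intro mult_mono powr_mono') auto
        finally have "(1 - 7 * \<kappa>) * ((1 - \<kappa>) * sqrt q) \<le> (1 - 7 * \<kappa>) * (1 / sqrt (8 / (\<kappa> * q)) powr \<eta>)"
          using \<kappa> q0' by (intro mult_left_mono) auto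
        moreover have "(1 - 8 * \<kappa>) * sqrt q \<le> (1 - 7 * \<kappa>) * (1 - \<kappa>) * sqrt q"
          using q0' by (intro mult_right_mono) (simp_all add: algebra_simps)
        ultimately show ?thesis by (simp add: mult.assoc)
      qed
      ultimately have "((1 - 8 * \<kappa>) * sqrt q) ^ C \<le> dens S ^ C"
        using b q0' by (intro power_mono) (auto simp: \<kappa>_def)
      then have "(1 - 8 * \<kappa>) ^ C * q ^ c \<le> dens S ^ C"
        using q0' by (simp add: C_def power_mult_distrib power_mult)
      then have "(\<kappa>\<^sup>2 * q\<^sup>2 * n / 16) * ((1 - 8 * \<kappa>) ^ C * q ^ c) \<le> \<Psi> S"
        unfolding \<Psi>_def using S(2) n0 b q0' by (intro mult_mono) (auto simp: \<kappa>_def)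
      also have "\<dots> \<le> \<Psi> T" using T S by auto
      also have "\<dots> = n * q ^ C" by (simp add: \<Psi>_def n_def q_def)
      also have "\<dots> < (n * q ^ C) * (\<kappa>\<^sup>2 / 16 * q\<^sup>2 * ((1 - 8 * \<kappa>) ^ C / q ^ c))"
        using mult_strict_left_mono[OF key[OF q0' qb], of "n * q ^ C"] n0 q0' by simp
      also have "\<dots> = (\<kappa>\<^sup>2 * q\<^sup>2 * n / 16) * ((1 - 8 * \<kappa>) ^ C * q ^ c)"
        using q0' by (simp add: C_def mult_2 power_add)
      finally show False by simp
    qed
    then have "(1 - b) * n\<^sup>2 \<le> weight T M" unfolding wq by (intro mult_right_mono) auto
    then show "\<exists>T\<subseteq>V. N * q0 ^ C \<le> card T \<and> (1 - b) * (real (card T))\<^sup>2 \<le> weight T M"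
      using T(1) nlarge unfolding n_def by blast
  qed
qed

section \<open>From density close to one to a clique\<close>

text \<open>Counts non-neighbours including \<open>i\<close> itself, because
  \<open>adj M i i = 0\<close>; so it is at least 1 on \<open>T\<close>.\<close>

definition codeg :: "'a set \<Rightarrow> ('a \<Rightarrow> 'a \<Rightarrow> real) \<Rightarrow> 'a \<Rightarrow> real" where
  "codeg T M i = (\<Sum>j\<in>T. 1 - adj M i j)"

lemma sum_codeg: "(\<Sum>i\<in>T. codeg T M i) = (real (card T))\<^sup>2 - weight T M"
  by (simp add: codeg_def weight_def sum_subtractf power2_eq_square)

lemma codeg_ge_one:
  assumes "psd_graph T M K" "i \<in> T"
  shows "1 \<le> codeg T M i"
proof -
  have "(\<Sum>j\<in>{i}. 1 - adj M i j) \<le> codeg T M i"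
    unfolding codeg_def using assms psd_graphD(1)[OF assms(1)] adj_bounds(2)[OF assms(1)]
    by (intro sum_mono2) auto
  then show ?thesis by (simp add: adj_def)
qed

lemma cube_mono: "x ^ 3 \<le> y ^ 3" if "x \<le> y" for x y :: real
  using that by (simp add: power_mono_odd)

text \<open>Subtracting the mean direction leaves entries that are tiny on edges and close to \<open>-1\<close> on
  non-edges. The entrywise cube is still positive semidefinite, so its total is nonnegative, and the
  non-edges are outweighed only by the cubes of the tiny entries.\<close>

lemma nonedges_cube_bound:
  fixes \<beta> n :: real
  assumes G: "psd_graph T M K" and n: "n = real (card T)" "0 < n"
    and \<beta>: "0 \<le> \<beta>" "\<beta> \<le> 1 / 100" "\<And>i. i \<in> T \<Longrightarrow> codeg T M i \<le> \<beta> * n" and K: "K \<le> n / 100"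
  shows "n\<^sup>2 - weight T M \<le> 40 * \<beta> ^ 3 * n\<^sup>2 + 8 * n * K ^ 3"
proof -
  note fin = psd_graphD(1)[OF G] and K1 = psd_graphD(3)[OF G]
  define v where "v = (\<lambda>i. \<Sum>k\<in>T. M i k)"
  define Q where "Q = qf T M (\<lambda>_. 1)"
  define k where "k = K / n"
  have k: "0 \<le> k" "k \<le> 1 / 100" using K K1 n by (auto simp: k_def field_simps)
  have v_eq: "v i = n - codeg T M i + M i i" if "i \<in> T" for i
  proof -
    have "v i = (\<Sum>j\<in>T. adj M i j + (if i = j then M i i else 0))"
      unfolding v_def by (intro sum.cong refl) (simp add: adj_def)
    then show ?thesis using fin that by (simp add: sum.distrib codeg_def sum_subtractf n)
  qed
  have v: "(1 - \<beta>) * n \<le> v i" "v i \<le> (1 + k) * n" if "i \<in> T" for i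
  proof -
    have "0 \<le> M i i" "M i i \<le> K" using psd_diag_entry[OF psd_graphD(2)[OF G] fin that] psd_graphD(4)[OF G that] .
    moreover have "(1 + k) * n = n + K" using n by (simp add: k_def field_simps)
    ultimately show "(1 - \<beta>) * n \<le> v i" "v i \<le> (1 + k) * n"
      using \<beta>(3)[OF that] codeg_ge_one[OF G that] by (auto simp: v_eq[OF that] algebra_simps)
  qed
  have Q_eq: "Q = (\<Sum>i\<in>T. v i)" by (simp add: Q_def qf_def v_def)
  have "(\<Sum>i\<in>T. (1 - \<beta>) * n) \<le> Q" unfolding Q_eq using v by (intro sum_mono)
  then have Q1: "(1 - \<beta>) * n\<^sup>2 \<le> Q" by (simp add: n(1) power2_eq_square mult_ac)
  have "Q \<le> (\<Sum>i\<in>T. (1 + k) * n)" unfolding Q_eq using v by (intro sum_mono)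
  then have Q2: "Q \<le> (1 + k) * n\<^sup>2" by (simp add: n(1) power2_eq_square mult_ac)
  have "0 < (1 - \<beta>) * n\<^sup>2" using \<beta> n by simp
  then have Q0: "0 < Q" using Q1 by linarith
  define W where "W = (\<lambda>i j. M i j - v i * v j / Q)"
  have psdW: "psd T W"
    using psd_diff_rank_one[OF psd_graphD(2)[OF G], of "\<lambda>_. 1"] Q0 by (simp add: W_def v_def Q_def)
  have "psd T (\<lambda>i j. W i j * (W i j * W i j))"
    by (intro psd_Hadamard psdW fin)
  then have "0 \<le> qf T (\<lambda>i j. W i j * (W i j * W i j)) (\<lambda>_. 1)" by (rule psd_qf)
  then have pos: "0 \<le> (\<Sum>i\<in>T. \<Sum>j\<in>T. W i j ^ 3)" by (simp add: qf_def power3_eq_cube mult.assoc)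
  \<comment> \<open>A lower bound for the entries of the mean direction: an entry of
    \<open>W\<close> is at most 1 - g on an edge and at most -g on a non-edge.\<close>
  define g where "g = (1 - \<beta>)\<^sup>2 / (1 + k)"
  have g_le: "g \<le> v i * v j / Q" if "i \<in> T" "j \<in> T" for i j
  proof -
    have "(1 - \<beta>) * n * ((1 - \<beta>) * n) \<le> v i * v j"
    proof (intro mult_mono v that)
      have "0 \<le> (1 - \<beta>) * n" using \<beta> n by simp
      then show "0 \<le> (1 - \<beta>) * n" "0 \<le> v i" using v(1)[OF that(1)] by linarith+
    qed
    then have "g * ((1 + k) * n\<^sup>2) \<le> v i * v j" using k by (simp add: g_def power2_eq_square mult_ac)
    moreover have "g * Q \<le> g * ((1 + k) * n\<^sup>2)" using Q2 k by (intro mult_left_mono) (auto simp: g_def)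
    ultimately show ?thesis using Q0 by (simp add: field_simps)
  qed
  have g1: "1 - g \<le> 2 * \<beta> + k"
  proof -
    have "(1 - 2 * \<beta> - k) * (1 + k) \<le> 1 - 2 * \<beta>" using k \<beta> by (simp add: algebra_simps)
    also have "\<dots> \<le> (1 - \<beta>)\<^sup>2" by (simp add: power2_eq_square algebra_simps)
    finally have "1 - 2 * \<beta> - k \<le> g" using k by (simp add: g_def field_simps)
    then show ?thesis by linarith
  qed
  have g97: "97 / 100 \<le> g" using g1 \<beta> k by linarith
  define t where "t = (2 * \<beta> + k) ^ 3"
  have t0: "0 \<le> t" using \<beta> k by (simp add: t_def)
  \<comment> \<open>The summand 1 beside \<open>K ^ 3\<close> pays for the diagonal, where
    \<open>1 - adj M i i\<close> equals 1. Non-edges give at most -(97/100)^3, hence the coefficient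
    9/10.\<close>
  have W_le: "W i j ^ 3 \<le> t + (if i = j then K ^ 3 + 1 else 0) - 9 / 10 * (1 - adj M i j)"
    if ij: "i \<in> T" "j \<in> T" for i j
  proof -
    consider "i = j" | "i \<noteq> j" "M i j = 1" | "i \<noteq> j" "M i j = 0"
      using psd_graphD(5)[OF G ij] by auto
    then show ?thesis
    proof cases
      case 1
      have "W i j \<le> K" using g_le[OF ij] g97 psd_graphD(4)[OF G ij(1)] 1 by (simp add: W_def)
      then have "W i j ^ 3 \<le> K ^ 3" by (rule cube_mono)
      then show ?thesis using t0 1 by (simp add: adj_def)
    next
      case 2
      have "W i j \<le> 2 * \<beta> + k" using g_le[OF ij] g1 2 by (simp add: W_def)
      then have "W i j ^ 3 \<le> t" unfolding t_def by (rule cube_mono)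
      then show ?thesis using 2 by (simp add: adj_def)
    next
      case 3
      have "97 / 100 \<le> v i * v j / Q" using g_le[OF ij] g97 by linarith
      then have "W i j \<le> - (97 / 100)" using 3 by (simp only: W_def)
      then have "W i j ^ 3 \<le> (- (97 / 100)) ^ 3" by (rule cube_mono)
      also have "\<dots> \<le> - (9 / 10)" by (simp add: power3_eq_cube)
      finally show ?thesis using 3 t0 by (simp add: adj_def)
    qed
  qed
  have "0 \<le> (\<Sum>i\<in>T. \<Sum>j\<in>T. t + (if i = j then K ^ 3 + 1 else 0) - 9 / 10 * (1 - adj M i j))"
    using pos by (rule order_trans) (intro sum_mono W_le)
  also have "\<dots> = n\<^sup>2 * t + n * (K ^ 3 + 1) - 9 / 10 * (n\<^sup>2 - weight T M)"
  proof -
    have "(\<Sum>j\<in>T. t + (if i = j then K ^ 3 + 1 else 0) - 9 / 10 * (1 - adj M i j))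
        = n * t + (K ^ 3 + 1) - 9 / 10 * codeg T M i" if "i \<in> T" for i
      unfolding codeg_def sum_distrib_left using fin that by (simp add: sum.distrib sum_subtractf n(1))
    then have "(\<Sum>i\<in>T. \<Sum>j\<in>T. t + (if i = j then K ^ 3 + 1 else 0) - 9 / 10 * (1 - adj M i j))
        = (\<Sum>i\<in>T. n * t + (K ^ 3 + 1) - 9 / 10 * codeg T M i)" by (rule sum.cong[OF refl])
    also have "\<dots> = n * (n * t + (K ^ 3 + 1)) - 9 / 10 * (\<Sum>i\<in>T. codeg T M i)"
      by (simp add: sum_subtractf sum_distrib_left n(1))
    finally show ?thesis by (simp add: sum_codeg n(1) power2_eq_square algebra_simps)
  qed
  finally have main: "9 / 10 * (n\<^sup>2 - weight T M) \<le> n\<^sup>2 * t + n * (K ^ 3 + 1)" by linarith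
  \<comment> \<open>Power mean inequality for two numbers; 4 * 2^3 = 32, and division by 9/10 leads
    to at most 40.\<close>
  have "t \<le> 4 * ((2 * \<beta>) ^ 3 + k ^ 3)"
  proof -
    define a where "a = 2 * \<beta>"
    have "4 * (a ^ 3 + k ^ 3) - (a + k) ^ 3 = 3 * (a + k) * (a - k)\<^sup>2"
      by (simp add: power3_eq_cube power2_eq_square algebra_simps)
    moreover have "0 \<le> 3 * (a + k) * (a - k)\<^sup>2" using \<beta> k by (simp add: a_def)
    ultimately show ?thesis unfolding t_def a_def by linarith
  qed
  then have "n\<^sup>2 * t \<le> n\<^sup>2 * (4 * ((2 * \<beta>) ^ 3 + k ^ 3))" by (intro mult_left_mono) auto
  also have "\<dots> = 32 * \<beta> ^ 3 * n\<^sup>2 + 4 * (n\<^sup>2 * k ^ 3)" by (simp add: power_mult_distrib algebra_simps)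
  also have "n\<^sup>2 * k ^ 3 = K ^ 3 / n" using n by (simp add: k_def power_divide eval_nat_numeral)
  also have "\<dots> \<le> n * K ^ 3"
  proof -
    have n1: "1 \<le> n" using K K1 by linarith
    have "K ^ 3 / n \<le> K ^ 3 / 1" using n1 K1 by (intro divide_left_mono) auto
    also have "\<dots> \<le> n * K ^ 3" using mult_right_mono[OF n1, of "K ^ 3"] K1 by simp
    finally show ?thesis .
  qed
  finally have "n\<^sup>2 * t \<le> 32 * \<beta> ^ 3 * n\<^sup>2 + 4 * (n * K ^ 3)" by simp
  moreover have "n * (K ^ 3 + 1) \<le> 2 * (n * K ^ 3)"
  proof -
    have "n * 1 \<le> n * K ^ 3" using K1 n(2) by (intro mult_left_mono) auto
    then show ?thesis by (simp add: algebra_simps)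
  qed
  moreover have "0 \<le> \<beta> ^ 3 * n\<^sup>2" "0 \<le> n * K ^ 3" using \<beta> K1 n by auto
  moreover define p r X where "p = \<beta> ^ 3 * n\<^sup>2" and "r = n * K ^ 3" and "X = n\<^sup>2 - weight T M"
  ultimately have "n\<^sup>2 * t \<le> 32 * p + 4 * r" "n * (K ^ 3 + 1) \<le> 2 * r" "0 \<le> p" "0 \<le> r"
    by (simp_all add: mult.assoc)
  moreover have "9 / 10 * X \<le> n\<^sup>2 * t + n * (K ^ 3 + 1)" using main by (simp add: X_def)
  ultimately have "X \<le> 40 * p + 8 * r" by argo
  then show ?thesis by (simp add: X_def p_def r_def mult.assoc)
qed

text \<open>Let s be the root of the non-edge density. Discarding the vertices with more than s n
  non-neighbours costs at most s n vertices, and on the rest \<open>nonedges_cube_bound\<close> with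
  \<beta> = 2 s brings the density below s^2 / 4 unless the K^3 term dominates. The coefficient 4 in
  the functional makes this a strict gain, as (1 - s)(1 - 2 s) > 1 - 4 s. Hence the K^3 term
  dominates at the maximizer, which is the claim.\<close>

lemma sparse_complement:
  fixes n0 :: real
  assumes G: "psd_graph V M K" and n0: "n0 = real (card V)"
    and dense: "(1 - 1 / 10 ^ 8) * n0\<^sup>2 \<le> weight V M" and K: "1000 * K \<le> n0"
  shows "\<exists>T\<subseteq>V. n0 \<le> 2 * real (card T) \<and> (real (card T))\<^sup>2 - weight T M \<le> 128 * K ^ 3 * real (card T)"
proof -
  note finV = psd_graphD(1)[OF G] and K1 = psd_graphD(3)[OF G]
  define b where "b = (\<lambda>T. 1 - weight T M / (real (card T))\<^sup>2)"
  define \<Psi> where "\<Psi> = (\<lambda>T. real (card T) * (1 - 4 * sqrt (b T)))"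
  have GS: "psd_graph S M K" if "S \<subseteq> V" for S using psd_graph_subset[OF G that] .
  have n00: "0 < n0" using K K1 by linarith
  obtain T where T: "T \<subseteq> V" "\<And>S. S \<subseteq> V \<Longrightarrow> \<Psi> S \<le> \<Psi> T"
    using finite_subset_maximizer[OF finV, of \<Psi>] by blast
  define n where "n = real (card T)"
  define s where "s = sqrt (b T)"
  have "b V \<le> (1 / 10 ^ 4)\<^sup>2" using dense n00 by (simp add: b_def n0[symmetric] field_simps)
  then have "sqrt (b V) \<le> 1 / 10 ^ 4" by (rule real_le_lsqrt[rotated]) simp
  then have "n0 * (1 - 4 / 10 ^ 4) \<le> \<Psi> V" unfolding \<Psi>_def n0[symmetric] using n00 by (intro mult_left_mono) auto
  also have "\<dots> \<le> \<Psi> T" using T(2) by blast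
  finally have PsiT: "n0 * (1 - 4 / 10 ^ 4) \<le> n * (1 - 4 * s)" by (simp add: \<Psi>_def n_def s_def)
  have nn0: "n \<le> n0" using card_mono[OF finV T(1)] by (simp add: n_def n0)
  have n_pos: "0 < n"
  proof -
    have "n \<noteq> 0" using PsiT n00 by (intro notI) simp
    then show ?thesis by (simp add: n_def)
  qed
  have fin: "finite T" using T(1) finV finite_subset by blast
  have b_eq: "b S * (real (card S))\<^sup>2 = (real (card S))\<^sup>2 - weight S M" if "0 < real (card S)" for S
    using that by (simp add: b_def field_simps)
  have b_nonneg: "0 \<le> b S" if "S \<subseteq> V" "0 < real (card S)" for S
    using weight_le[OF GS[OF that(1)]] that(2) by (simp add: b_def)
  have s0: "0 \<le> s" using b_nonneg[OF T(1)] n_pos by (simp add: s_def n_def)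
  have s2: "s * s = b T" using b_nonneg[OF T(1)] n_pos by (simp add: s_def n_def)
  have s_small: "s \<le> 1 / 10 ^ 4"
  proof (rule ccontr)
    assume "\<not> ?thesis"
    then have "n * (1 - 4 * s) < n * (1 - 4 / 10 ^ 4)" using n_pos by (intro mult_strict_left_mono) auto
    also have "\<dots> \<le> n0 * (1 - 4 / 10 ^ 4)" using nn0 by (intro mult_right_mono) auto
    finally show False using PsiT by linarith
  qed
  have "n * (1 - 4 * s) \<le> n * 1" using s0 n_pos by (intro mult_left_mono) auto
  moreover have "n0 / 2 \<le> n0 * (1 - 4 / 10 ^ 4)" using n00 by simp
  ultimately have half: "n0 \<le> 2 * n" using PsiT by linarith
  have sum_cd: "(\<Sum>i\<in>T. codeg T M i) = s * s * n\<^sup>2"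
    using b_eq[of T] n_pos by (simp add: sum_codeg s2 n_def)
  \<comment> \<open>Every vertex is its own non-neighbour, so \<open>s\<close> cannot vanish and
    halving it is a strict improvement.\<close>
  have s_pos: "0 < s"
  proof -
    have "(\<Sum>i\<in>T. 1) \<le> (\<Sum>i\<in>T. codeg T M i)" using codeg_ge_one[OF GS[OF T(1)]] by (intro sum_mono)
    then have "n \<le> s * s * n\<^sup>2" unfolding sum_cd by (simp add: n_def)
    then have "s \<noteq> 0" using n_pos by auto
    then show ?thesis using s0 by simp
  qed
  have "s * s * n\<^sup>2 \<le> 128 * K ^ 3 * n"
  proof (rule ccontr)
    assume "\<not> ?thesis"
    then have "128 * K ^ 3 * n < s * s * n * n" by (simp add: power2_eq_square mult.assoc)
    then have big: "128 * K ^ 3 < s * s * n" using n_pos by simp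
    define S where "S = {i \<in> T. codeg T M i \<le> s * n}"
    have S: "S \<subseteq> T" by (auto simp: S_def)
    define n' where "n' = real (card S)"
    have "real (card (T - S)) * (s * n) = (\<Sum>i\<in>T - S. s * n)" by simp
    also have "\<dots> \<le> (\<Sum>i\<in>T - S. codeg T M i)" by (intro sum_mono) (auto simp: S_def)
    also have "\<dots> \<le> (\<Sum>i\<in>T. codeg T M i)"
      using fin codeg_ge_one[OF GS[OF T(1)]] by (intro sum_mono2) force+
    also have "\<dots> = (s * n) * (s * n)" unfolding sum_cd by (simp add: power2_eq_square mult_ac)
    finally have "real (card (T - S)) \<le> s * n" using s_pos n_pos by (simp add: mult_le_cancel_right)
    moreover have "card T = card (T - S) + card S"
      using S fin card_Diff_subset[of S T] card_mono[of T S] finite_subset by fastforce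
    ultimately have n'1: "(1 - s) * n \<le> n'" by (simp add: n_def n'_def algebra_simps)
    have "n / 2 \<le> (1 - s) * n" using s_small n_pos by (simp add: field_simps)
    then have n'2: "n \<le> 2 * n'" using n'1 by linarith
    then have n'0: "0 < n'" using n_pos by linarith
    have SV: "S \<subseteq> V" using S T(1) by blast
    have cd: "codeg S M i \<le> (2 * s) * n'" if i: "i \<in> S" for i
    proof -
      have "codeg S M i \<le> codeg T M i"
        unfolding codeg_def using fin S i adj_bounds(2)[OF GS[OF T(1)]] by (intro sum_mono2) auto
      also have "\<dots> \<le> s * n" using i by (simp add: S_def)
      also have "\<dots> \<le> s * (2 * n')" using n'2 s0 by (intro mult_left_mono)
      finally show ?thesis by simp
    qed
    have Kn': "K \<le> n' / 100" using K half n'2 K1 by linarith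
    have "n'\<^sup>2 - weight S M \<le> 40 * (2 * s) ^ 3 * n'\<^sup>2 + 8 * n' * K ^ 3"
      by (rule nonedges_cube_bound[OF GS[OF SV] n'_def n'0 _ _ cd Kn']) (use s0 s_small in auto)
    also have "8 * n' * K ^ 3 \<le> (s * s / 8) * n'\<^sup>2"
    proof -
      have "64 * K ^ 3 \<le> s * s * n / 2" using big by linarith
      also have "\<dots> \<le> s * s * n'" using mult_left_mono[OF n'2, of "s * s"] by simp
      finally have "(64 * K ^ 3) * (n' / 8) \<le> (s * s * n') * (n' / 8)" using n'0 by (intro mult_right_mono) auto
      then show ?thesis by (simp add: power2_eq_square mult_ac)
    qed
    also have "40 * (2 * s) ^ 3 * n'\<^sup>2 \<le> (s * s / 8) * n'\<^sup>2"
    proof (intro mult_right_mono)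
      have "40 * (2 * s) ^ 3 = (320 * s) * (s * s)" by (simp add: power3_eq_cube)
      also have "\<dots> \<le> (1 / 8) * (s * s)" using s_small by (intro mult_right_mono) auto
      finally show "40 * (2 * s) ^ 3 \<le> s * s / 8" by simp
    qed simp
    finally have "b S * n'\<^sup>2 \<le> (s / 2)\<^sup>2 * n'\<^sup>2"
      using b_eq[of S] n'0 by (simp add: n'_def power2_eq_square)
    then have "b S \<le> (s / 2)\<^sup>2" using n'0 by simp
    then have bS: "sqrt (b S) \<le> s / 2" using s0 by (intro real_le_lsqrt) auto
    have "(1 - s) * n * (1 - 2 * s) \<le> n' * (1 - 4 * sqrt (b S))"
      using n'1 bS s_small n'0 by (intro mult_mono) auto
    also have "\<dots> \<le> n * (1 - 4 * s)" using T(2)[OF SV] by (simp add: \<Psi>_def n'_def n_def s_def)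
    finally have "n * ((1 - s) * (1 - 2 * s)) \<le> n * (1 - 4 * s)" by (simp add: mult_ac)
    then have "(1 - s) * (1 - 2 * s) \<le> 1 - 4 * s" using n_pos by simp
    then have "s + 2 * (s * s) \<le> 0" by (simp add: algebra_simps)
    moreover have "0 \<le> s * s" by simp
    ultimately show False using s_pos by linarith
  qed
  then have "n\<^sup>2 - weight T M \<le> 128 * K ^ 3 * n" using sum_cd by (simp add: sum_codeg n_def)
  then show ?thesis using T(1) half unfolding n_def by blast
qed

text \<open>At least half of the vertices have at most 2 L non-neighbours. A largest clique among
  them leaves no further one adjacent to all its members, so the non-neighbourhoods of the members,
  each containing the member itself, cover these vertices.\<close>

lemma sparse_complement_clique:
  fixes L :: real
  assumes G: "psd_graph T M K" and sparse: "(real (card T))\<^sup>2 - weight T M \<le> L * real (card T)" and L: "1 \<le> L"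
  shows "\<exists>I\<subseteq>T. (\<forall>i\<in>I. \<forall>j\<in>I. i \<noteq> j \<longrightarrow> M i j = 1) \<and> real (card T) \<le> 4 * L * real (card I)"
proof -
  note fin = psd_graphD(1)[OF G]
  define n where "n = real (card T)"
  define S where "S = {i \<in> T. codeg T M i \<le> 2 * L}"
  have S: "S \<subseteq> T" "finite S" using fin by (auto simp: S_def)
  have "real (card (T - S)) * (2 * L) = (\<Sum>i\<in>T - S. 2 * L)" by simp
  also have "\<dots> \<le> (\<Sum>i\<in>T - S. codeg T M i)" by (intro sum_mono) (auto simp: S_def)
  also have "\<dots> \<le> (\<Sum>i\<in>T. codeg T M i)"
    using fin codeg_ge_one[OF G] by (intro sum_mono2) force+
  also have "\<dots> \<le> n * L" using sparse by (simp add: sum_codeg n_def mult.commute)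
  finally have "real (card (T - S)) \<le> n / 2" using L by (simp add: field_simps)
  moreover have "card T = card (T - S) + card S"
    using S fin card_Diff_subset[of S T] card_mono[of T S] by simp
  ultimately have half: "n \<le> 2 * real (card S)" by (simp add: n_def)
  \<comment> \<open>Non-cliques get the value 0, so maximizing over all subsets finds the largest
    clique size; if the maximizer is not a clique, that size is 0 and the empty set serves.\<close>
  define f where "f = (\<lambda>I. if I \<subseteq> S \<and> (\<forall>i\<in>I. \<forall>j\<in>I. i \<noteq> j \<longrightarrow> M i j = 1) then card I else 0)"
  obtain J where J: "J \<subseteq> S" "\<And>I. I \<subseteq> S \<Longrightarrow> f I \<le> f J"
    using finite_subset_maximizer[OF S(2), of f] by blast
  obtain I where I: "I \<subseteq> S" "\<forall>i\<in>I. \<forall>j\<in>I. i \<noteq> j \<longrightarrow> M i j = 1" "card I = f J"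
  proof (cases "\<forall>i\<in>J. \<forall>j\<in>J. i \<noteq> j \<longrightarrow> M i j = 1")
    case True
    then show ?thesis using J(1) that[of J] by (simp add: f_def)
  next
    case False
    then have "f J = 0" unfolding f_def by auto
    then show ?thesis using that[of "{}"] by simp
  qed
  have finI: "finite I" using I(1) S(2) finite_subset by blast
  have "S \<subseteq> (\<Union>i\<in>I. {j \<in> T. adj M i j = 0})"
  proof
    fix j assume j: "j \<in> S"
    show "j \<in> (\<Union>i\<in>I. {j \<in> T. adj M i j = 0})"
    proof (rule ccontr)
      assume no: "j \<notin> (\<Union>i\<in>I. {j \<in> T. adj M i j = 0})"
      then have jI: "j \<notin> I" using j S(1) by (auto simp: adj_def)
      have one: "M i j = 1" if "i \<in> I" for i
      proof -
        have "adj M i j \<noteq> 0" using no that j S(1) by auto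
        then show ?thesis using psd_graphD(5)[OF G, of i j] that I(1) j S(1) by (auto simp: adj_def split: if_splits)
      qed
      have one': "M j i = 1" if "i \<in> I" for i
        using one[OF that] psd_sym[OF psd_graphD(2)[OF G], of i j] that I(1) j S(1) by auto
      have "f (insert j I) = Suc (card I)"
        using I(1,2) j one one' jI finI by (auto simp: f_def)
      then show False using J(2)[of "insert j I"] I j by auto
    qed
  qed
  then have "card S \<le> (\<Sum>i\<in>I. card {j \<in> T. adj M i j = 0})"
    using fin finI by (intro order_trans[OF card_mono card_UN_le]) auto
  then have "real (card S) \<le> (\<Sum>i\<in>I. real (card {j \<in> T. adj M i j = 0}))"
    unfolding of_nat_sum[symmetric] by (rule of_nat_mono)
  also have "\<dots> \<le> (\<Sum>i\<in>I. 2 * L)"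
  proof (rule sum_mono)
    fix i assume "i \<in> I"
    then have i: "i \<in> T" "codeg T M i \<le> 2 * L" using I(1) by (auto simp: S_def)
    have "real (card {j \<in> T. adj M i j = 0}) = (\<Sum>j\<in>{j \<in> T. adj M i j = 0}. 1 - adj M i j)" by simp
    also have "\<dots> \<le> codeg T M i"
      unfolding codeg_def using fin adj_bounds(2)[OF G i(1)] by (intro sum_mono2) auto
    finally show "real (card {j \<in> T. adj M i j = 0}) \<le> 2 * L" using i(2) by linarith
  qed
  finally have "real (card S) \<le> 2 * L * real (card I)" by (simp add: mult_ac)
  then have "n \<le> 4 * L * real (card I)" using half by linarith
  then show ?thesis using I(1,2) S(1) unfolding n_def by (intro exI[of _ I]) auto
qed

section \<open>Small cuts and semidefinite duality\<close>

text \<open>The exponential moment of \<open>x\<close> times a random sign. On [0, 1] the quadratic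
  bounds for exp x and exp (-x) average to 1 + x^2; beyond 1 already the exponent x is at most
  x^2.\<close>

lemma cosh_le_exp_square: "cosh x \<le> exp (x\<^sup>2)" for x :: real
proof -
  have *: "cosh x \<le> exp (x\<^sup>2)" if "0 \<le> x" for x :: real
  proof (cases "x \<le> 1")
    case True
    have "exp (- x) \<le> 1 - x + x\<^sup>2"
    proof -
      have "1 \<le> (1 - x + x\<^sup>2) * (1 + x)" using that by (simp add: algebra_simps power2_eq_square)
      also have "\<dots> \<le> (1 - x + x\<^sup>2) * exp x"
      proof (rule mult_left_mono)
        have "0 \<le> (1 - x) + x\<^sup>2" using True by (intro add_nonneg_nonneg) auto
        then show "0 \<le> 1 - x + x\<^sup>2" .
      qed (use exp_ge_add_one_self[of x] in auto)
      finally show ?thesis by (simp add: exp_minus field_simps)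
    qed
    moreover have "exp x \<le> 1 + x + x\<^sup>2" using exp_bound[of x] that True by simp
    ultimately have "cosh x \<le> 1 + x\<^sup>2" by (simp add: cosh_field_def)
    also have "\<dots> \<le> exp (x\<^sup>2)" by (rule exp_ge_add_one_self)
    finally show ?thesis .
  next
    case False
    then have "x \<le> x\<^sup>2" by (simp add: power2_eq_square)
    moreover have "cosh x \<le> exp x" using that by (simp add: cosh_field_def)
    ultimately show ?thesis by (meson exp_le_cancel_iff order_trans)
  qed
  show ?thesis using *[of x] *[of "- x"] by (cases "0 \<le> x") auto
qed

lemma qf_mult_const: "qf V A (\<lambda>i. c * x i) = c\<^sup>2 * qf V A x"
  by (simp add: qf_def sum_distrib_left power2_eq_square mult_ac)

text \<open>Averaging over both signs leaves \<open>\<Sum>\<^sub>t qf V A (x t)\<close> and controls all coordinates at once through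
  the exponential moments.\<close>

lemma sign_choice:
  fixes x :: "'b \<Rightarrow> 'a \<Rightarrow> real"
  assumes "finite I" and sym: "\<And>i j. i \<in> V \<Longrightarrow> j \<in> V \<Longrightarrow> A i j = A j i" and "\<And>i. i \<in> V \<Longrightarrow> 0 \<le> c i"
  shows "\<exists>\<epsilon>. (\<forall>t. \<epsilon> t \<in> {-1, 1::real}) \<and>
    qf V A (\<lambda>i. a i + (\<Sum>t\<in>I. \<epsilon> t * x t i)) + (\<Sum>i\<in>V. c i * cosh (a i + (\<Sum>t\<in>I. \<epsilon> t * x t i)))
    \<le> qf V A a + (\<Sum>t\<in>I. qf V A (x t)) + (\<Sum>i\<in>V. c i * cosh (a i) * exp (\<Sum>t\<in>I. (x t i)\<^sup>2))"
  using assms(1)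
proof (induction I arbitrary: a rule: finite_induct)
  case empty
  show ?case by (rule exI[of _ "\<lambda>_. 1"]) simp
next
  case (insert u I)
  define F where "F = (\<lambda>\<sigma>. qf V A (\<lambda>i. a i + \<sigma> * x u i) +
    (\<Sum>i\<in>V. c i * cosh (a i + \<sigma> * x u i) * exp (\<Sum>t\<in>I. (x t i)\<^sup>2)))"
  define R where "R = qf V A a + qf V A (x u) + (\<Sum>i\<in>V. c i * cosh (a i) * exp (\<Sum>t\<in>insert u I. (x t i)\<^sup>2))"
  have q: "qf V A (\<lambda>i. a i + \<sigma> * x u i) = qf V A a + 2 * \<sigma> * bf V A a (x u) + \<sigma>\<^sup>2 * qf V A (x u)" for \<sigma>
    by (rule qf_add_scaled) (rule sym)
  \<comment> \<open>Method of conditional expectations: adding both signs cancels the cross term of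
    the form, and the hyperbolic cosines average to
    \<open>cosh (a i) * cosh (x u i)\<close>.\<close>
  have "F 1 + F (- 1) \<le> 2 * R"
  proof -
    have "F 1 + F (- 1) = 2 * qf V A a + 2 * qf V A (x u)
        + 2 * (\<Sum>i\<in>V. c i * cosh (a i) * cosh (x u i) * exp (\<Sum>t\<in>I. (x t i)\<^sup>2))"
      unfolding F_def q
      by (simp add: cosh_add cosh_diff algebra_simps sum_distrib_left flip: sum.distrib)
    also have "(\<Sum>i\<in>V. c i * cosh (a i) * cosh (x u i) * exp (\<Sum>t\<in>I. (x t i)\<^sup>2))
      \<le> (\<Sum>i\<in>V. c i * cosh (a i) * exp ((x u i)\<^sup>2) * exp (\<Sum>t\<in>I. (x t i)\<^sup>2))"
      using assms(3) cosh_le_exp_square by (intro sum_mono mult_right_mono mult_left_mono) auto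
    also have "\<dots> = (\<Sum>i\<in>V. c i * cosh (a i) * exp (\<Sum>t\<in>insert u I. (x t i)\<^sup>2))"
      using insert.hyps by (simp add: exp_add mult_ac)
    finally show ?thesis by (simp add: R_def)
  qed
  then have "\<exists>\<sigma>\<in>{-1, 1}. F \<sigma> \<le> R" by (cases "F 1 \<le> R") auto
  then obtain \<sigma> where \<sigma>: "\<sigma> \<in> {-1, 1}" "F \<sigma> \<le> R" by blast
  from insert.IH[of "\<lambda>i. a i + \<sigma> * x u i"] obtain \<epsilon> where \<epsilon>: "\<forall>t. \<epsilon> t \<in> {-1, 1::real}"
    "qf V A (\<lambda>i. a i + \<sigma> * x u i + (\<Sum>t\<in>I. \<epsilon> t * x t i))
      + (\<Sum>i\<in>V. c i * cosh (a i + \<sigma> * x u i + (\<Sum>t\<in>I. \<epsilon> t * x t i)))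
    \<le> qf V A (\<lambda>i. a i + \<sigma> * x u i) + (\<Sum>t\<in>I. qf V A (x t))
      + (\<Sum>i\<in>V. c i * cosh (a i + \<sigma> * x u i) * exp (\<Sum>t\<in>I. (x t i)\<^sup>2))" by blast
  define \<epsilon>' where "\<epsilon>' = \<epsilon>(u := \<sigma>)"
  have sum: "(\<Sum>t\<in>insert u I. \<epsilon>' t * x t i) = \<sigma> * x u i + (\<Sum>t\<in>I. \<epsilon> t * x t i)" for i
  proof -
    have "(\<Sum>t\<in>I. \<epsilon>' t * x t i) = (\<Sum>t\<in>I. \<epsilon> t * x t i)"
      using insert.hyps by (intro sum.cong) (auto simp: \<epsilon>'_def)
    then show ?thesis using insert.hyps by (simp add: \<epsilon>'_def)
  qed
  have "qf V A (\<lambda>i. a i + (\<Sum>t\<in>insert u I. \<epsilon>' t * x t i))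
      + (\<Sum>i\<in>V. c i * cosh (a i + (\<Sum>t\<in>insert u I. \<epsilon>' t * x t i)))
    \<le> F \<sigma> + (\<Sum>t\<in>I. qf V A (x t))"
    using \<epsilon>(2) unfolding sum F_def by (simp add: add_ac)
  also have "\<dots> \<le> R + (\<Sum>t\<in>I. qf V A (x t))" using \<sigma>(2) by simp
  also have "\<dots> = qf V A a + (\<Sum>t\<in>insert u I. qf V A (x t))
      + (\<Sum>i\<in>V. c i * cosh (a i) * exp (\<Sum>t\<in>insert u I. (x t i)\<^sup>2))"
    using insert.hyps by (simp add: R_def)
  finally show ?case using \<epsilon>(1) \<sigma>(1) by (intro exI[of _ \<epsilon>']) (auto simp: \<epsilon>'_def)
qed

section \<open>The cut hypothesis as a lower bound for a quadratic form\<close>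

definition adjacency :: "'a set \<Rightarrow> ('a \<Rightarrow> 'a \<Rightarrow> real) \<Rightarrow> bool" where
  "adjacency V A \<longleftrightarrow> finite V \<and> (\<forall>i\<in>V. \<forall>j\<in>V. A i j = A j i \<and> A i j \<in> {0, 1}) \<and> (\<forall>i\<in>V. A i i = 0)"

text \<open>Stated on the cube [-1, 1]^V rather than for sign vectors, so that vectors with zero
  coordinates and rescaled vectors can be tested directly; \<open>round_to_signs\<close> reduces it
  to sign vectors.\<close>

definition cut_bounded :: "'a set \<Rightarrow> ('a \<Rightarrow> 'a \<Rightarrow> real) \<Rightarrow> real \<Rightarrow> bool" where
  "cut_bounded V A H \<longleftrightarrow> (\<forall>x. (\<forall>i\<in>V. \<bar>x i\<bar> \<le> 1) \<longrightarrow> - H \<le> qf V A x)"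

lemma adjacencyD:
  assumes "adjacency V A"
  shows "finite V" "\<And>i j. i \<in> V \<Longrightarrow> j \<in> V \<Longrightarrow> A i j = A j i"
    "\<And>i j. i \<in> V \<Longrightarrow> j \<in> V \<Longrightarrow> A i j \<in> {0, 1}" "\<And>i. i \<in> V \<Longrightarrow> A i i = 0"
  using assms by (auto simp: adjacency_def)

text \<open>As the diagonal of \<open>A\<close> vanishes, the form is affine in each coordinate
  separately, so a coordinate can be moved to an end of [-1, 1] without increasing the form.\<close>

lemma round_to_signs:
  assumes A: "adjacency V A" and W: "W \<subseteq> V" and x: "\<And>i. i \<in> V \<Longrightarrow> \<bar>x i\<bar> \<le> 1"
  shows "\<exists>y. (\<forall>i\<in>W. y i \<in> {-1, 1}) \<and> (\<forall>i. i \<notin> W \<longrightarrow> y i = x i) \<and> qf V A y \<le> qf V A x"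
proof -
  have "finite W" using adjacencyD(1)[OF A] W by (rule finite_subset[rotated])
  then show ?thesis using W
  proof (induction W rule: finite_induct)
    case empty
    show ?case by (rule exI[of _ x]) simp
  next
    case (insert k W)
    then obtain y where y: "\<forall>i\<in>W. y i \<in> {-1, 1}" "\<forall>i. i \<notin> W \<longrightarrow> y i = x i" "qf V A y \<le> qf V A x"
      by auto
    have k: "k \<in> V" using insert.prems by simp
    define e where "e = (\<lambda>i. if i = k then (1::real) else 0)"
    define z where "z = y(k := 0)"
    define \<beta> where "\<beta> = bf V A z e"
    have e0: "qf V A e = 0"
      unfolding qf_eq_bf e_def using bf_units[OF adjacencyD(1)[OF A] k k] adjacencyD(4)[OF A k] by simp
    have q: "qf V A (\<lambda>i. z i + c * e i) = qf V A z + 2 * c * \<beta>" for c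
      using qf_add_scaled[where T = V and M = A and x = z and c = c and y = e] adjacencyD(2)[OF A]
      by (simp add: e0 \<beta>_def)
    have yz: "y = (\<lambda>i. z i + y k * e i)" by (auto simp: z_def e_def)
    have yk: "\<bar>y k\<bar> \<le> 1" using y(2) insert.hyps x[OF k] by simp
    define \<sigma> where "\<sigma> = (if 0 \<le> \<beta> then - 1 else (1::real))"
    have "\<sigma> * \<beta> \<le> y k * \<beta>"
      using yk by (auto simp: \<sigma>_def abs_le_iff mult_le_cancel_right intro: mult_right_mono)
    then have "qf V A (\<lambda>i. z i + \<sigma> * e i) \<le> qf V A y"
      by (subst yz) (simp add: q)
    then show ?case
      using y insert.hyps
      by (intro exI[of _ "\<lambda>i. z i + \<sigma> * e i"]) (auto simp: z_def e_def \<sigma>_def)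
  qed
qed

lemma cut_bounded_scaled:
  assumes "cut_bounded V A H" "\<And>i. i \<in> V \<Longrightarrow> \<bar>y i\<bar> \<le> Y"
  shows "- H * Y\<^sup>2 \<le> qf V A y"
proof (cases "0 < Y")
  case True
  have "- H \<le> qf V A (\<lambda>i. inverse Y * y i)"
    using assms True unfolding cut_bounded_def by (auto simp: abs_mult field_simps)
  then show ?thesis using True unfolding qf_mult_const by (simp add: field_simps)
next
  case False
  then have "y i = 0" if "i \<in> V" for i using assms(2)[OF that] by linarith
  then have "qf V A y = 0" by (simp add: qf_def)
  moreover have "0 \<le> H"
    using assms(1)[unfolded cut_bounded_def, rule_format, of "\<lambda>_. 0"] by (simp add: qf_def)
  ultimately show ?thesis by simp
qed

text \<open>A lower bound for sign vectors is, up to a logarithmic factor, a lower bound for the semidefinite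
  relaxation.\<close>

lemma semidefinite_bound_unit:
  fixes x :: "'b \<Rightarrow> 'a \<Rightarrow> real"
  assumes A: "adjacency V A" and H: "cut_bounded V A H" "1 \<le> H"
    and I: "finite I" "\<And>i. i \<in> V \<Longrightarrow> (\<Sum>t\<in>I. (x t i)\<^sup>2) \<le> 1"
  shows "- (H * (2 * ln (16 * H))\<^sup>2 + 3 * real (card V)) \<le> (\<Sum>t\<in>I. qf V A (x t))"
proof -
  note fin = adjacencyD(1)[OF A]
  obtain \<epsilon> where \<epsilon>: "qf V A (\<lambda>i. 0 + (\<Sum>t\<in>I. \<epsilon> t * x t i)) + (\<Sum>i\<in>V. 1 * cosh (0 + (\<Sum>t\<in>I. \<epsilon> t * x t i)))
      \<le> qf V A (\<lambda>_. 0) + (\<Sum>t\<in>I. qf V A (x t)) + (\<Sum>i\<in>V. 1 * cosh 0 * exp (\<Sum>t\<in>I. (x t i)\<^sup>2))"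
    using sign_choice[where I = I and V = V and A = A and c = "\<lambda>_. 1" and a = "\<lambda>_. 0" and x = x]
      adjacencyD(2)[OF A] I(1) by auto
  define y where "y = (\<lambda>i. \<Sum>t\<in>I. \<epsilon> t * x t i)"
  have "(\<Sum>i\<in>V. exp (\<Sum>t\<in>I. (x t i)\<^sup>2)) \<le> (\<Sum>i\<in>V. 3)"
  proof (rule sum_mono)
    fix i assume "i \<in> V"
    then have "exp (\<Sum>t\<in>I. (x t i)\<^sup>2) \<le> exp 1" using I(2) by simp
    also have "\<dots> \<le> (3::real)" by (rule exp_le)
    finally show "exp (\<Sum>t\<in>I. (x t i)\<^sup>2) \<le> 3" .
  qed
  then have main: "qf V A y + (\<Sum>i\<in>V. cosh (y i)) \<le> (\<Sum>t\<in>I. qf V A (x t)) + 3 * card V"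
  proof -
    have "qf V A (\<lambda>_. 0) = 0" by (simp add: qf_def)
    with \<epsilon> have "qf V A y + (\<Sum>i\<in>V. cosh (y i))
        \<le> (\<Sum>t\<in>I. qf V A (x t)) + (\<Sum>i\<in>V. exp (\<Sum>t\<in>I. (x t i)\<^sup>2))"
      by (simp add: y_def)
    then show ?thesis using \<open>_ \<le> (\<Sum>i\<in>V. 3)\<close> by simp
  qed
  show ?thesis
  proof (cases "V = {}")
    case True
    then show ?thesis using H by (simp add: qf_def)
  next
    case False
    define Y where "Y = Max ((\<lambda>i. \<bar>y i\<bar>) ` V)"
    have Y: "\<bar>y i\<bar> \<le> Y" if "i \<in> V" for i using fin that by (simp add: Y_def)
    have "Y \<in> (\<lambda>i. \<bar>y i\<bar>) ` V" unfolding Y_def using fin False by (intro Max_in) auto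
    then obtain k where k: "k \<in> V" "Y = \<bar>y k\<bar>" by auto
    have "cosh Y = cosh (y k)" by (simp add: k(2) abs_if)
    also have "\<dots> \<le> (\<Sum>i\<in>V. cosh (y i))" using fin k(1) by (intro member_le_sum) auto
    finally have "cosh Y \<le> (\<Sum>i\<in>V. cosh (y i))" .
    moreover have "exp Y / 2 \<le> cosh Y" by (simp add: cosh_field_def)
    ultimately have coshY: "exp Y / 2 \<le> (\<Sum>i\<in>V. cosh (y i))" by linarith
    \<comment> \<open>A large coordinate is paid for by the hyperbolic cosines: beyond 2 ln (16 H)
      both 16 H and Y^2 / 8 are at most exp (Y / 2), so the loss H Y^2 is at most exp Y / 2.\<close>
    have "H * Y\<^sup>2 \<le> H * (2 * ln (16 * H))\<^sup>2 + exp Y / 2"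
    proof (cases "Y \<le> 2 * ln (16 * H)")
      case True
      then have "Y\<^sup>2 \<le> (2 * ln (16 * H))\<^sup>2" using k(2) by (intro power_mono) auto
      then have "H * Y\<^sup>2 \<le> H * (2 * ln (16 * H))\<^sup>2" using H(2) by (intro mult_left_mono) auto
      then show ?thesis by (smt (verit) exp_ge_zero divide_nonneg_nonneg)
    next
      case False
      then have "exp (ln (16 * H)) \<le> exp (Y / 2)" by simp
      then have 1: "16 * H \<le> exp (Y / 2)" using H(2) by simp
      have "1 + Y / 2 + (Y / 2)\<^sup>2 / 2 \<le> exp (Y / 2)"
        using k(2) by (intro exp_lower_Taylor_quadratic) auto
      then have 2: "Y\<^sup>2 / 8 \<le> exp (Y / 2)" using k(2) by (simp add: power2_eq_square)
      have "(16 * H) * (Y\<^sup>2 / 8) \<le> exp (Y / 2) * exp (Y / 2)" using 1 2 by (intro mult_mono) auto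
      also have "\<dots> = exp Y" by (simp flip: exp_add)
      finally have "H * Y\<^sup>2 \<le> exp Y / 2" by simp
      then show ?thesis using H(2) by (smt (verit) mult_nonneg_nonneg zero_le_power2)
    qed
    moreover have "- H * Y\<^sup>2 \<le> qf V A y" by (rule cut_bounded_scaled[OF H(1) Y])
    ultimately show ?thesis using main coshY by simp
  qed
qed

lemma semidefinite_bound:
  fixes x :: "'b \<Rightarrow> 'a \<Rightarrow> real"
  assumes A: "adjacency V A" and H: "cut_bounded V A H" "1 \<le> H"
    and I: "finite I" "\<And>i. i \<in> V \<Longrightarrow> (\<Sum>t\<in>I. (x t i)\<^sup>2) \<le> g" and g: "0 < g"
  shows "- g * (H * (2 * ln (16 * H))\<^sup>2 + 3 * real (card V)) \<le> (\<Sum>t\<in>I. qf V A (x t))"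
proof -
  have "(\<Sum>t\<in>I. (inverse (sqrt g) * x t i)\<^sup>2) \<le> 1" if "i \<in> V" for i
  proof -
    have "(\<Sum>t\<in>I. (inverse (sqrt g) * x t i)\<^sup>2) = inverse g * (\<Sum>t\<in>I. (x t i)\<^sup>2)"
      using g by (simp add: power_mult_distrib sum_distrib_left power_inverse)
    also have "\<dots> \<le> inverse g * g" using I(2)[OF that] g by (intro mult_left_mono) auto
    finally show ?thesis using g by simp
  qed
  from semidefinite_bound_unit[OF A H I(1) this]
  have "- (H * (2 * ln (16 * H))\<^sup>2 + 3 * real (card V)) \<le> inverse g * (\<Sum>t\<in>I. qf V A (x t))"
    using g by (simp add: qf_mult_const power_inverse sum_distrib_left)
  then show ?thesis using g by (simp add: field_simps)
qed

text \<open>Semidefinite duality by multiplicative weights: as long as the current diagonal does not work, a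
  violating unit vector is collected and the weights of its large coordinates are increased. The
  collected vectors cannot violate the bound \<open>B\<close> for long.\<close>

lemma semidefinite_dual:
  fixes V :: "'a set"
  assumes A: "adjacency V A" and V: "V \<noteq> {}" and B: "0 < B"
    and sdp: "\<And>(x :: nat \<Rightarrow> 'a \<Rightarrow> real) I g. finite I \<Longrightarrow> 0 < g \<Longrightarrow>
      (\<And>i. i \<in> V \<Longrightarrow> (\<Sum>t\<in>I. (x t i)\<^sup>2) \<le> g) \<Longrightarrow> - g * B \<le> (\<Sum>t\<in>I. qf V A (x t))"
  shows "\<exists>d. (\<forall>i. 0 \<le> d i) \<and> (\<Sum>i\<in>V. d i) \<le> 2 * B \<and>
    psd V (\<lambda>i j. A i j + (if i = j then d i + 1 else 0))"
proof (rule ccontr)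
  assume contr: "\<not> ?thesis"
  note fin = adjacencyD(1)[OF A]
  have viol: "\<exists>x. (\<Sum>i\<in>V. (x i)\<^sup>2) = 1 \<and> qf V A x < - 1 - (\<Sum>i\<in>V. d i * (x i)\<^sup>2)"
    if d: "\<forall>i. 0 \<le> d i" "(\<Sum>i\<in>V. d i) \<le> 2 * B" for d
  proof -
    have "\<not> psd V (\<lambda>i j. A i j + (if i = j then d i + 1 else 0))" using contr d by blast
    then obtain z where "qf V (\<lambda>i j. A i j + (if i = j then d i + 1 else 0)) z < 0"
      using adjacencyD(2)[OF A] unfolding psd_def by (auto simp: not_le split: if_splits)
    then have z: "qf V A z + (\<Sum>i\<in>V. (d i + 1) * (z i)\<^sup>2) < 0"
      by (simp add: qf_add_matrix qf_diag[OF fin])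
    define r where "r = (\<Sum>i\<in>V. (z i)\<^sup>2)"
    have "r \<noteq> 0"
    proof
      assume "r = 0"
      then have "\<forall>i\<in>V. z i = 0" using fin by (simp add: r_def sum_nonneg_eq_0_iff)
      then show False using z by (simp add: qf_def)
    qed
    moreover have "0 \<le> r" by (simp add: r_def sum_nonneg)
    ultimately have r: "0 < r" by simp
    define x where "x = (\<lambda>i. inverse (sqrt r) * z i)"
    have x2: "(x i)\<^sup>2 = inverse r * (z i)\<^sup>2" for i
      using r by (simp add: x_def power_mult_distrib power_inverse)
    have "(\<Sum>i\<in>V. (x i)\<^sup>2) = 1" using r by (simp add: x2 r_def flip: sum_distrib_left)
    moreover have "qf V A x = inverse r * qf V A z"
      using r by (simp add: x_def qf_mult_const power_inverse)
    moreover have "(\<Sum>i\<in>V. d i * (x i)\<^sup>2) = inverse r * (\<Sum>i\<in>V. d i * (z i)\<^sup>2)"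
      by (simp add: x2 sum_distrib_left mult_ac)
    moreover have "qf V A z < - r - (\<Sum>i\<in>V. d i * (z i)\<^sup>2)"
      using z by (simp add: r_def distrib_right sum.distrib)
    moreover have "inverse r * qf V A z < - 1 - inverse r * (\<Sum>i\<in>V. d i * (z i)\<^sup>2)"
      using mult_strict_left_mono[OF \<open>qf V A z < _\<close>, of "inverse r"] r by (simp add: right_diff_distrib)
    ultimately show ?thesis by (intro exI[of _ x]) simp
  qed
  \<comment> \<open>Exponential weights of the accumulated squares; the diagonal tried in each round
    is \<open>2 * B * p g\<close>, which uses the full permitted trace.\<close>
  define p where "p = (\<lambda>g i. exp (g i) / (\<Sum>j\<in>V. exp (g j :: real)))"
  have sumexp: "0 < (\<Sum>j\<in>V. exp (g j :: real))" for g using fin V by (intro sum_pos) auto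
  have p: "0 \<le> p g i" "(\<Sum>i\<in>V. p g i) = 1" for g i
    using sumexp[of g] by (auto simp: p_def sum_divide_distrib[symmetric])
  define X where "X = (\<lambda>g. SOME x. (\<Sum>i\<in>V. (x i)\<^sup>2) = 1 \<and> qf V A x < - 1 - (\<Sum>i\<in>V. 2 * B * p g i * (x i)\<^sup>2))"
  have X: "(\<Sum>i\<in>V. (X g i)\<^sup>2) = 1" "qf V A (X g) < - 1 - 2 * B * (\<Sum>i\<in>V. p g i * (X g i)\<^sup>2)" for g
  proof -
    have "\<exists>x. (\<Sum>i\<in>V. (x i)\<^sup>2) = 1 \<and> qf V A x < - 1 - (\<Sum>i\<in>V. 2 * B * p g i * (x i)\<^sup>2)"
      using B p by (intro viol) (auto simp: sum_distrib_left[symmetric])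
    then have "(\<Sum>i\<in>V. (X g i)\<^sup>2) = 1 \<and> qf V A (X g) < - 1 - (\<Sum>i\<in>V. 2 * B * p g i * (X g i)\<^sup>2)"
      unfolding X_def by (rule someI_ex)
    then show "(\<Sum>i\<in>V. (X g i)\<^sup>2) = 1" "qf V A (X g) < - 1 - 2 * B * (\<Sum>i\<in>V. p g i * (X g i)\<^sup>2)"
      by (auto simp: sum_distrib_left mult.assoc)
  qed
  define G where "G = rec_nat (\<lambda>_. 0) (\<lambda>_ g i. g i + (X g i)\<^sup>2)"
  have G: "G 0 = (\<lambda>_. 0)" "G (Suc t) = (\<lambda>i. G t i + (X (G t) i)\<^sup>2)" for t by (simp_all add: G_def)
  have G_sum: "G t i = (\<Sum>s<t. (X (G s) i)\<^sup>2)" for t i by (induction t) (simp_all add: G)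
  define P where "P = (\<lambda>s. \<Sum>i\<in>V. p (G s) i * (X (G s) i)\<^sup>2)"
  have P0: "0 \<le> P s" for s unfolding P_def using p by (intro sum_nonneg mult_nonneg_nonneg) auto
  have potential: "(\<Sum>i\<in>V. exp (G t i)) \<le> card V * exp (2 * (\<Sum>s<t. P s))" for t
  proof (induction t)
    case 0
    show ?case by (simp add: G)
  next
    case (Suc t)
    define \<Phi> where "\<Phi> = (\<Sum>i\<in>V. exp (G t i))"
    have "(\<Sum>i\<in>V. exp (G (Suc t) i)) = (\<Sum>i\<in>V. exp (G t i) * exp ((X (G t) i)\<^sup>2))"
      by (simp add: G exp_add)
    \<comment> \<open>On [0, 1] one has exp z \<le> 1 + 2 z; the factor 2 is what the factor 2 in
      the trace \<open>2 * B\<close> has to match.\<close>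
    also have "\<dots> \<le> (\<Sum>i\<in>V. exp (G t i) * (1 + 2 * (X (G t) i)\<^sup>2))"
    proof (intro sum_mono mult_left_mono)
      fix i assume i: "i \<in> V"
      define z where "z = (X (G t) i)\<^sup>2"
      have "z \<le> (\<Sum>i\<in>V. (X (G t) i)\<^sup>2)" unfolding z_def using fin i by (intro member_le_sum) auto
      then have z: "0 \<le> z" "z \<le> 1" using X(1) by (simp_all add: z_def)
      then have "exp z \<le> 1 + z + z\<^sup>2" by (rule exp_bound)
      also have "\<dots> \<le> 1 + 2 * z" using z mult_left_mono[of z 1 z] by (simp add: power2_eq_square)
      finally show "exp ((X (G t) i)\<^sup>2) \<le> 1 + 2 * (X (G t) i)\<^sup>2" by (simp add: z_def)
    qed simp
    also have "\<dots> = \<Phi> * (1 + 2 * P t)"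
    proof -
      have "\<Phi> * P t = (\<Sum>i\<in>V. exp (G t i) * (X (G t) i)\<^sup>2)"
        unfolding P_def sum_distrib_left
        by (intro sum.cong refl) (use sumexp[of "G t"] in \<open>simp add: p_def \<Phi>_def\<close>)
      moreover have "(\<Sum>i\<in>V. exp (G t i) * (1 + 2 * (X (G t) i)\<^sup>2))
          = \<Phi> + 2 * (\<Sum>i\<in>V. exp (G t i) * (X (G t) i)\<^sup>2)"
        by (simp add: \<Phi>_def distrib_left sum.distrib sum_distrib_left mult_ac)
      ultimately show ?thesis by (simp add: distrib_left)
    qed
    also have "\<dots> \<le> \<Phi> * exp (2 * P t)"
      using exp_ge_add_one_self[of "2 * P t"] sumexp[of "G t"] by (intro mult_left_mono) (auto simp: \<Phi>_def)
    also have "\<dots> \<le> (card V * exp (2 * (\<Sum>s<t. P s))) * exp (2 * P t)"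
      using Suc by (intro mult_right_mono) (auto simp: \<Phi>_def)
    finally show ?case by (simp add: exp_add algebra_simps)
  qed
  have n1: "1 \<le> real (card V)" using fin V by (simp add: Suc_le_eq card_gt_0_iff)
  \<comment> \<open>Enough rounds for the loss of more than 1 per round to exceed B ln (3 |V|), as
    the terms \<open>2 * B * S\<close> cancel. The 3 keeps the logarithm positive.\<close>
  obtain t :: nat where t: "ln (3 * card V) * B \<le> real t" "0 < t"
  proof -
    obtain m :: nat where "ln (3 * card V) * B \<le> real m" using real_arch_simple by blast
    then show ?thesis using that[of "Suc m"] by simp
  qed
  define S where "S = (\<Sum>s<t. P s)"
  have S0: "0 \<le> S" using P0 by (simp add: S_def sum_nonneg)
  have ln0: "0 < ln (3 * card V)" using n1 by simp
  have "(\<Sum>s<t. (X (G s) i)\<^sup>2) \<le> ln (3 * card V) + 2 * S" if i: "i \<in> V" for i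
  proof -
    have "exp (G t i) \<le> (\<Sum>i\<in>V. exp (G t i))" using fin i by (intro member_le_sum) auto
    also have "\<dots> \<le> card V * exp (2 * S)" using potential[of t] by (simp add: S_def)
    also have "\<dots> \<le> (3 * card V) * exp (2 * S)" by simp
    also have "\<dots> = exp (ln (3 * card V) + 2 * S)" using n1 by (simp add: exp_add)
    finally show ?thesis by (simp add: G_sum)
  qed
  then have "- (ln (3 * card V) + 2 * S) * B \<le> (\<Sum>s<t. qf V A (X (G s)))"
    using ln0 S0 by (intro sdp) auto
  also have "\<dots> < (\<Sum>s<t. - 1 - 2 * B * P s)"
    using t(2) X(2) by (intro sum_strict_mono) (auto simp: P_def)
  also have "\<dots> = - real t - 2 * B * S" by (simp add: sum_subtractf S_def flip: sum_distrib_left)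
  finally show False using t(1) by (simp add: algebra_simps)
qed

text \<open>The vector with 1 at the centre and -1 on the leaves has form value -2 |S t|. Signs, one
  per star, can be chosen so that the interaction of different stars does not increase the total,
  and disjoint supports keep all coordinates in [-1, 1].\<close>

lemma disjoint_stars_bound:
  fixes u :: "'b \<Rightarrow> 'a"
  assumes A: "adjacency V A" and H: "cut_bounded V A H"
    and J: "finite J" "\<And>t. t \<in> J \<Longrightarrow> u t \<in> V - S t" "\<And>t. t \<in> J \<Longrightarrow> S t \<subseteq> V"
    and star: "\<And>t i. t \<in> J \<Longrightarrow> i \<in> S t \<Longrightarrow> A (u t) i = 1"
    and indep: "\<And>t i j. t \<in> J \<Longrightarrow> i \<in> S t \<Longrightarrow> j \<in> S t \<Longrightarrow> A i j = 0"
    and disj: "\<And>s t. s \<in> J \<Longrightarrow> t \<in> J \<Longrightarrow> s \<noteq> t \<Longrightarrow> insert (u s) (S s) \<inter> insert (u t) (S t) = {}"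
  shows "2 * (\<Sum>t\<in>J. real (card (S t))) \<le> H"
proof -
  note fin = adjacencyD(1)[OF A]
  define e where "e = (\<lambda>t i. if i = u t then (1::real) else 0)"
  define f where "f = (\<lambda>t i. if i \<in> S t then (1::real) else 0)"
  define x where "x = (\<lambda>t i. e t i + (- 1) * f t i)"
  have qx: "qf V A (x t) = - 2 * real (card (S t))" if t: "t \<in> J" for t
  proof -
    have ut: "u t \<in> V" using J(2)[OF t] by simp
    have "qf V A (e t) = 0"
      unfolding qf_eq_bf e_def using bf_units[OF fin ut ut] adjacencyD(4)[OF A ut] by simp
    moreover have "qf V A (f t) = 0"
      unfolding qf_def f_def using indep[OF t] by (intro sum.neutral ballI) auto
    moreover have "bf V A (e t) (f t) = card (S t)"
    proof -
      have "bf V A (e t) (f t) = (\<Sum>i\<in>V. if i = u t then (\<Sum>j\<in>V. A i j * f t j) else 0)"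
        unfolding bf_eq by (intro sum.cong refl) (simp add: e_def)
      also have "\<dots> = (\<Sum>j\<in>V. if j \<in> S t then A (u t) j else 0)"
        using ut fin by (auto simp: f_def intro!: sum.cong)
      also have "\<dots> = (\<Sum>j\<in>V \<inter> S t. A (u t) j)"
        using fin by (rule sum.inter_restrict[symmetric])
      also have "V \<inter> S t = S t" using J(3)[OF t] by blast
      finally show ?thesis using star[OF t] by simp
    qed
    ultimately show ?thesis
      unfolding x_def using qf_add_scaled[where T = V and M = A and x = "e t" and c = "- 1" and y = "f t"]
        adjacencyD(2)[OF A] by simp
  qed
  obtain \<epsilon> where \<epsilon>: "\<forall>t. \<epsilon> t \<in> {-1, 1::real}"
    "qf V A (\<lambda>i. 0 + (\<Sum>t\<in>J. \<epsilon> t * x t i)) \<le> qf V A (\<lambda>_. 0) + (\<Sum>t\<in>J. qf V A (x t))"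
    using sign_choice[where I = J and V = V and A = A and c = "\<lambda>_. 0" and a = "\<lambda>_. 0" and x = x]
      adjacencyD(2)[OF A] J(1) by auto
  have bound: "\<bar>\<Sum>t\<in>J. \<epsilon> t * x t i\<bar> \<le> 1" for i
  proof (cases "\<exists>t\<in>J. i \<in> insert (u t) (S t)")
    case True
    then obtain t where t: "t \<in> J" "i \<in> insert (u t) (S t)" by blast
    have "x s i = 0" if "s \<in> J - {t}" for s
      using disj[of s t] that t by (auto simp: x_def e_def f_def)
    then have "(\<Sum>s\<in>J. \<epsilon> s * x s i) = (\<Sum>s\<in>{t}. \<epsilon> s * x s i)"
      using J(1) t(1) by (intro sum.mono_neutral_right) auto
    moreover have "\<bar>x t i\<bar> \<le> 1" using J(2)[OF t(1)] by (auto simp: x_def e_def f_def)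
    moreover have "\<bar>\<epsilon> t\<bar> = 1" using \<epsilon>(1)[rule_format, of t] by auto
    ultimately show ?thesis by (simp add: abs_mult)
  next
    case False
    then have "(\<Sum>t\<in>J. \<epsilon> t * x t i) = 0"
      by (intro sum.neutral) (auto simp: x_def e_def f_def)
    then show ?thesis by simp
  qed
  have "- H \<le> qf V A (\<lambda>i. \<Sum>t\<in>J. \<epsilon> t * x t i)"
    using H[unfolded cut_bounded_def, rule_format, OF bound] .
  also have "\<dots> \<le> (\<Sum>t\<in>J. qf V A (x t))" using \<epsilon>(2) by (simp add: qf_def)
  also have "\<dots> = - 2 * (\<Sum>t\<in>J. real (card (S t)))" using qx by (simp add: sum_distrib_left)
  finally show ?thesis by simp
qed

text \<open>A maximum matching, viewed as stars with one leaf, covers at most H vertices. The others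
  are independent and each has a covered neighbour; assigning each to one of these gives disjoint
  stars, with at most H / 2 leaves in all.\<close>

lemma nonisolated_vertices_bound:
  assumes A: "adjacency V A" and H: "cut_bounded V A H"
    and nonisolated: "\<And>i. i \<in> V \<Longrightarrow> \<exists>j\<in>V. A i j = 1"
  shows "2 * real (card V) \<le> 3 * H"
proof -
  note fin = adjacencyD(1)[OF A]
  define matching where "matching = (\<lambda>F. (\<forall>p\<in>F. A (fst p) (snd p) = 1) \<and>
    (\<forall>p\<in>F. \<forall>q\<in>F. p \<noteq> q \<longrightarrow> {fst p, snd p} \<inter> {fst q, snd q} = {}))"
  define f where "f = (\<lambda>F. if matching F then card F else 0)"
  obtain F0 where F0: "F0 \<subseteq> V \<times> V" "\<And>F. F \<subseteq> V \<times> V \<Longrightarrow> f F \<le> f F0"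
    using finite_subset_maximizer[of "V \<times> V" f] fin by auto
  obtain F where F: "F \<subseteq> V \<times> V" "matching F" "card F = f F0"
  proof (cases "matching F0")
    case True
    then show ?thesis using F0(1) that[of F0] by (simp add: f_def)
  next
    case False
    then have "f F0 = 0" by (simp only: f_def if_False)
    then show ?thesis using that[of "{}"] by (simp add: matching_def)
  qed
  have finF: "finite F" using F(1) fin finite_subset by blast
  define U where "U = fst ` F \<union> snd ` F"
  have U: "finite U" "U \<subseteq> V" using F(1) finF by (auto simp: U_def)
  have neq: "fst p \<noteq> snd p" if "p \<in> F" for p
  proof
    assume eq: "fst p = snd p"
    have "A (fst p) (snd p) = 1" using that F(2) by (simp add: matching_def)
    moreover have "snd p \<in> V" using that F(1) by (auto simp: mem_Times_iff)
    ultimately show False using adjacencyD(4)[OF A, of "snd p"] eq by simp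
  qed
  have "2 * (\<Sum>p\<in>F. real (card {snd p})) \<le> H"
  proof (rule disjoint_stars_bound[OF A H finF])
    show "insert (fst p) {snd p} \<inter> insert (fst q) {snd q} = {}" if "p \<in> F" "q \<in> F" "p \<noteq> q" for p q
      using that F(2) by (simp add: matching_def)
  qed (use F neq adjacencyD(4)[OF A] in \<open>auto simp: matching_def\<close>)
  then have FH: "2 * real (card F) \<le> H" by simp
  have "card U \<le> card (fst ` F) + card (snd ` F)" unfolding U_def by (rule card_Un_le)
  also have "\<dots> \<le> 2 * card F" using card_image_le[OF finF, of fst] card_image_le[OF finF, of snd] by simp
  finally have UH: "real (card U) \<le> H" using FH by simp
  have indep: "A i j = 0" if ij: "i \<in> V - U" "j \<in> V - U" for i j
  proof (rule ccontr)
    assume "A i j \<noteq> 0"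
    then have 1: "A i j = 1" using adjacencyD(3)[OF A, of i j] ij by auto
    have new: "(i, j) \<notin> F" using ij by (force simp: U_def)
    have "matching (insert (i, j) F)"
      using F(2) ij 1 by (auto simp: matching_def U_def)
    then have "f (insert (i, j) F) = Suc (card F)" using new finF by (simp add: f_def)
    moreover have "f (insert (i, j) F) \<le> f F0" using F(1) ij by (intro F0(2)) auto
    ultimately show False using F(3) by simp
  qed
  define h where "h = (\<lambda>i. SOME j. j \<in> V \<and> A i j = 1)"
  have h: "h i \<in> V" "A i (h i) = 1" if "i \<in> V" for i
    using someI_ex[of "\<lambda>j. j \<in> V \<and> A i j = 1"] nonisolated[OF that] by (auto simp: h_def)
  have hU: "h i \<in> U" if "i \<in> V - U" for i
    using indep[OF that, of "h i"] h[of i] that by auto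
  define S where "S = (\<lambda>u. {i \<in> V - U. h i = u})"
  have "2 * (\<Sum>u\<in>U. real (card (S u))) \<le> H"
  proof (rule disjoint_stars_bound[OF A H U(1), where u = "\<lambda>u. u"])
    show "A u i = 1" if "u \<in> U" "i \<in> S u" for u i
      using that h[of i] adjacencyD(2)[OF A, of i u] U(2) by (auto simp: S_def)
    show "A i j = 0" if "i \<in> S u" "j \<in> S u" for u i j
      using that indep by (auto simp: S_def)
  qed (use U in \<open>auto simp: S_def\<close>)
  moreover have "card (V - U) = (\<Sum>u\<in>U. card (S u))"
  proof -
    have "V - U = (\<Union>u\<in>U. S u)" using hU by (auto simp: S_def)
    moreover have "card (\<Union>u\<in>U. S u) = (\<Sum>u\<in>U. card (S u))"
      by (rule card_UN_disjoint) (use U fin in \<open>auto simp: S_def\<close>)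
    ultimately show ?thesis by (simp only:)
  qed
  ultimately have "2 * real (card (V - U)) \<le> H" by simp
  moreover have "card V = card U + card (V - U)"
    using U fin card_Diff_subset[of U V] card_mono[of V U] by simp
  ultimately show ?thesis using UH by simp
qed

section \<open>The main theorem\<close>

lemma powr_eventually_large:
  fixes C a :: real
  assumes "0 < a"
  shows "\<exists>N0. \<forall>N\<ge>N0. 1 \<le> N \<and> C \<le> N powr a"
proof -
  have "C \<le> N powr a" if "max 1 (max 1 C powr (1 / a)) \<le> N" for N
  proof -
    have "C \<le> max 1 C" by simp
    also have "\<dots> = (max 1 C powr (1 / a)) powr a" using assms by (simp add: powr_powr)
    also have "\<dots> \<le> N powr a" using that assms by (intro powr_mono2) auto
    finally show ?thesis .
  qed
  then show ?thesis by (intro exI[of _ "max 1 (max 1 C powr (1 / a))"]) auto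
qed

text \<open>The density is at least N^(-\<epsilon>) and K is at most N^\<epsilon>, so the size loss
  N^(c \<epsilon>) of the dense subset and the loss K^3 of the final extraction are both small
  powers of \<open>N\<close>.\<close>

lemma psd_graph_large_clique:
  fixes \<alpha> :: real
  assumes \<alpha>: "0 < \<alpha>"
  shows "\<exists>\<epsilon> N0. 0 < \<epsilon> \<and> (\<forall>(V :: 'a set) M K N. psd_graph V M K \<longrightarrow> N = real (card V) \<longrightarrow> N0 \<le> N \<longrightarrow>
    K \<le> N powr \<epsilon> \<longrightarrow> N powr (2 - \<epsilon>) \<le> weight V M \<longrightarrow>
    (\<exists>I\<subseteq>V. (\<forall>i\<in>I. \<forall>j\<in>I. i \<noteq> j \<longrightarrow> M i j = 1) \<and> N powr (1 - \<alpha>) \<le> real (card I)))"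
proof -
  have "0 < 1 / (10 :: real) ^ 8" "1 / (10 :: real) ^ 8 < 1" by simp_all
  from dense_subset_exists[OF this, where 'a = 'a] obtain \<kappa> \<eta> :: real and c :: nat
    where c: "0 < \<kappa>" "0 < \<eta>" "\<eta> \<le> 1"
      and "\<forall>(V :: 'a set) M K N q0. psd_graph V M K \<longrightarrow> N = real (card V) \<longrightarrow> 0 < q0 \<longrightarrow>
        q0 * N\<^sup>2 \<le> weight V M \<longrightarrow> (8 / (\<kappa> * q0)) ^ 64 \<le> N * q0 ^ c \<longrightarrow>
        2 * K \<le> (N * q0 ^ c) powr (\<eta> / 128) \<longrightarrow>
        (\<exists>T\<subseteq>V. N * q0 ^ c \<le> card T \<and> (1 - 1 / 10 ^ 8) * (real (card T))\<^sup>2 \<le> weight T M)"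
    by blast
  note dense = this(4)[rule_format]
  \<comment> \<open>The bound \<alpha>/2 on (c + 3) \<epsilon> covers the losses c \<epsilon> and 3
    \<epsilon>, the bound 1/2 ensures N q^c \<ge> sqrt N, and \<eta>/1024 makes \<open>2 * K\<close>
    fit below the required power of sqrt N.\<close>
  define \<epsilon> where "\<epsilon> = min (\<eta> / 1024) (min 1 \<alpha> / (2 * (c + 3)))"
  have \<epsilon>0: "0 < \<epsilon>" using c \<alpha> by (simp add: \<epsilon>_def)
  have \<epsilon>1: "\<epsilon> \<le> \<eta> / 1024" unfolding \<epsilon>_def by (rule min.cobounded1)
  have "\<epsilon> \<le> min 1 \<alpha> / (2 * (c + 3))" unfolding \<epsilon>_def by (rule min.cobounded2)
  then have "(c + 3) * \<epsilon> \<le> min 1 \<alpha> / 2" by (simp add: field_simps)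
  then have \<epsilon>2: "(c + 3) * \<epsilon> \<le> \<alpha> / 2" "(c + 3) * \<epsilon> \<le> 1 / 2" by auto
  have c\<epsilon>: "c * \<epsilon> \<le> 1 / 2" using \<epsilon>2 \<epsilon>0 by (simp add: algebra_simps)
  have \<epsilon>3: "\<epsilon> \<le> 1 / 1024" using \<epsilon>1 c by simp
  obtain N1 where N1: "\<And>N. N1 \<le> N \<Longrightarrow> 1 \<le> N \<and> (8 / \<kappa>) ^ 64 \<le> N powr (1 / 4)"
    using powr_eventually_large[of "1 / 4" "(8 / \<kappa>) ^ 64"] by auto
  obtain N2 where N2: "\<And>N. N2 \<le> N \<Longrightarrow> 2 \<le> N powr (\<eta> / 1024)"
    using powr_eventually_large[of "\<eta> / 1024" 2] c by auto
  obtain N3 where N3: "\<And>N :: real. N3 \<le> N \<Longrightarrow> 1000 \<le> N powr (1 / 4)"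
    using powr_eventually_large[of "1 / 4" 1000] by auto
  obtain N4 where N4: "\<And>N. N4 \<le> N \<Longrightarrow> 1024 \<le> N powr (\<alpha> / 2)"
    using powr_eventually_large[of "\<alpha> / 2" 1024] \<alpha> by auto
  show ?thesis
  proof (rule exI[of _ \<epsilon>], rule exI[of _ "max (max N1 N2) (max N3 N4)"], intro conjI allI impI)
    show "0 < \<epsilon>" by (rule \<epsilon>0)
  next
    fix V :: "'a set" and M and K N :: real
    assume G: "psd_graph V M K" and N: "N = real (card V)" "max (max N1 N2) (max N3 N4) \<le> N"
      and K: "K \<le> N powr \<epsilon>" and w: "N powr (2 - \<epsilon>) \<le> weight V M"
    have n1: "1 \<le> N" "(8 / \<kappa>) ^ 64 \<le> N powr (1 / 4)" using N1[of N] N(2) by auto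
    have n2: "2 \<le> N powr (\<eta> / 1024)" using N2[of N] N(2) by auto
    have n3: "1000 \<le> N powr (1 / 4)" using N3[of N] N(2) by auto
    have n4: "1024 \<le> N powr (\<alpha> / 2)" using N4[of N] N(2) by auto
    note K1 = psd_graphD(3)[OF G]
    define q where "q = N powr (- \<epsilon>)"
    have q0: "0 < q" using n1 by (simp add: q_def)
    have Nq: "N * q ^ c = N powr (1 - c * \<epsilon>)"
    proof -
      have "q ^ c = N powr (- (c * \<epsilon>))" using n1 by (simp add: q_def powr_power mult.commute)
      then show ?thesis using n1 powr_add[of N 1 "- (c * \<epsilon>)"] by simp
    qed
    have w': "q * N\<^sup>2 \<le> weight V M"
    proof -
      have "q * N\<^sup>2 = N powr (2 - \<epsilon>)"
        using n1 powr_add[of N "- \<epsilon>" 2] by (simp add: q_def powr_numeral)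
      then show ?thesis using w by simp
    qed
    have half: "N powr (1 / 2) \<le> N * q ^ c" unfolding Nq using c\<epsilon> n1 by (intro powr_mono) auto
    have size: "(8 / (\<kappa> * q)) ^ 64 \<le> N * q ^ c"
    proof -
      have "(8 / (\<kappa> * q)) ^ 64 = (8 / \<kappa>) ^ 64 * N powr (64 * \<epsilon>)"
      proof -
        have "8 / (\<kappa> * q) = (8 / \<kappa>) * N powr \<epsilon>" by (simp add: q_def powr_minus divide_inverse)
        then show ?thesis using n1 by (simp only: power_mult_distrib) (simp add: powr_power mult.commute)
      qed
      also have "\<dots> \<le> N powr (1 / 4) * N powr (1 / 4)"
        using n1 \<epsilon>3 by (intro mult_mono powr_mono) auto
      also have "\<dots> = N powr (1 / 2)" by (simp flip: powr_add)
      finally show ?thesis using half by linarith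
    qed
    have K2: "2 * K \<le> (N * q ^ c) powr (\<eta> / 128)"
    proof -
      have "2 * K \<le> N powr (\<eta> / 1024) * N powr (\<eta> / 1024)"
      proof (rule mult_mono)
        show "K \<le> N powr (\<eta> / 1024)"
          using K powr_mono[OF \<epsilon>1 n1(1)] by linarith
      qed (use n2 K1 in auto)
      also have "\<dots> = N powr (\<eta> / 512)" by (simp flip: powr_add)
      also have "\<dots> \<le> N powr (\<eta> / 256)" using n1 c by (intro powr_mono) auto
      also have "\<dots> = (N powr (1 / 2)) powr (\<eta> / 128)" by (simp add: powr_powr)
      also have "\<dots> \<le> (N * q ^ c) powr (\<eta> / 128)" using half c by (intro powr_mono2) auto
      finally show ?thesis .
    qed
    obtain T where T: "T \<subseteq> V" "N * q ^ c \<le> card T" "(1 - 1 / 10 ^ 8) * (real (card T))\<^sup>2 \<le> weight T M"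
      using dense[OF G N(1) q0 w' size K2] by blast
    have "1000 * K \<le> N powr (1 / 4) * N powr (1 / 4)"
    proof (rule mult_mono)
      have "N powr \<epsilon> \<le> N powr (1 / 4)" using n1 \<epsilon>3 by (intro powr_mono) auto
      then show "K \<le> N powr (1 / 4)" using K by linarith
    qed (use n3 K1 in auto)
    also have "\<dots> = N powr (1 / 2)" by (simp flip: powr_add)
    finally have "1000 * K \<le> real (card T)" using half T(2) by linarith
    then obtain S where S: "S \<subseteq> T" "real (card T) \<le> 2 * real (card S)"
      "(real (card S))\<^sup>2 - weight S M \<le> 128 * K ^ 3 * real (card S)"
      using sparse_complement[OF psd_graph_subset[OF G T(1)] refl T(3)] by blast
    have SV: "S \<subseteq> V" using S T by blast
    have L: "1 \<le> 128 * K ^ 3" using one_le_power[OF K1, of 3] by linarith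
    obtain I where I: "I \<subseteq> S" "\<forall>i\<in>I. \<forall>j\<in>I. i \<noteq> j \<longrightarrow> M i j = 1"
      "real (card S) \<le> 4 * (128 * K ^ 3) * real (card I)"
      using sparse_complement_clique[OF psd_graph_subset[OF G SV] S(3) L] by blast
    have "N powr (1 - \<alpha>) * (1024 * N powr (3 * \<epsilon>)) \<le> N powr (1 - \<alpha>) * (N powr (\<alpha> / 2) * N powr (3 * \<epsilon>))"
      using n4 by (intro mult_left_mono mult_right_mono) auto
    also have "\<dots> = N powr (1 - \<alpha> / 2 + 3 * \<epsilon>)" by (simp add: algebra_simps flip: powr_add)
    also have "\<dots> \<le> N powr (1 - c * \<epsilon>)" using n1 \<epsilon>2 by (intro powr_mono) (auto simp: algebra_simps)
    \<comment> \<open>1024 = 2 * 4 * 128 collects the losses from \<open>T\<close> to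
      \<open>S\<close> and from \<open>S\<close> to \<open>I\<close>.\<close>
    also have "\<dots> \<le> 1024 * K ^ 3 * real (card I)" using T(2) S(2) I(3) Nq by simp
    also have "\<dots> \<le> 1024 * (N powr \<epsilon>) ^ 3 * real (card I)"
      using K K1 by (intro mult_right_mono mult_left_mono power_mono) auto
    also have "\<dots> = real (card I) * (1024 * N powr (3 * \<epsilon>))" using n1 by (simp add: powr_power mult_ac)
    finally have "N powr (1 - \<alpha>) \<le> real (card I)" using n1 by simp
    then show "\<exists>I\<subseteq>V. (\<forall>i\<in>I. \<forall>j\<in>I. i \<noteq> j \<longrightarrow> M i j = 1) \<and> N powr (1 - \<alpha>) \<le> real (card I)"
      using I SV by (intro exI[of _ I]) auto
  qed
qed

section \<open>Cuts of a graph and its adjacency matrix\<close>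

definition graph_matrix :: "'a set set \<Rightarrow> 'a \<Rightarrow> 'a \<Rightarrow> real" where
  "graph_matrix E i j = (if {i, j} \<in> E then 1 else 0)"

lemma simple_graph_edge:
  assumes "simple_graph V E" "e \<in> E"
  shows "\<exists>a b. e = {a, b} \<and> a \<noteq> b"
proof -
  have "card e = 2" using assms by (auto simp: simple_graph_def nsets_def)
  then show ?thesis by (auto simp: card_2_iff)
qed

lemma simple_graph_finite:
  assumes "simple_graph V E"
  shows "finite V" "finite E" "\<Union>E \<subseteq> V"
proof -
  show "finite V" using assms by (simp add: simple_graph_def)
  show "\<Union>E \<subseteq> V" using assms by (auto simp: simple_graph_def nsets_def)
  then show "finite E" using \<open>finite V\<close> by (meson finite_UnionD finite_subset)
qed

lemma adjacency_graph_matrix: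
  assumes "simple_graph V E"
  shows "adjacency (\<Union>E) (graph_matrix E)"
proof -
  have "{i} \<notin> E" for i using assms by (auto simp: simple_graph_def nsets_def)
  moreover have "finite (\<Union>E)" using simple_graph_finite[OF assms] finite_subset by blast
  ultimately show ?thesis by (auto simp: adjacency_def graph_matrix_def insert_commute)
qed

text \<open>An edge arises from two ordered pairs, hence the factor 2. The product is expressed by a
  function \<open>g\<close> of the edge because an unordered pair does not single out its
  ends.\<close>

lemma graph_matrix_qf:
  assumes G: "simple_graph V E" and g: "\<And>a b. {a, b} \<in> E \<Longrightarrow> a \<noteq> b \<Longrightarrow> 2 * x a * x b = g {a, b}"
  shows "qf (\<Union>E) (graph_matrix E) x = (\<Sum>e\<in>E. g e)"
proof -
  note fin = simple_graph_finite[OF G]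
  have finU: "finite (\<Union>E)" using fin finite_subset by blast
  define P where "P = {p \<in> \<Union>E \<times> \<Union>E. {fst p, snd p} \<in> E}"
  have finP: "finite P" using finU by (simp add: P_def)
  have "qf (\<Union>E) (graph_matrix E) x = (\<Sum>p\<in>\<Union>E \<times> \<Union>E. graph_matrix E (fst p) (snd p) * x (fst p) * x (snd p))"
    by (simp add: qf_def sum.cartesian_product case_prod_unfold)
  also have "\<dots> = (\<Sum>p\<in>P. x (fst p) * x (snd p))"
    using finU by (intro sum.mono_neutral_cong_right) (auto simp: P_def graph_matrix_def)
  also have "\<dots> = (\<Sum>e\<in>E. \<Sum>p\<in>{p \<in> P. {fst p, snd p} = e}. x (fst p) * x (snd p))"
    using finP fin(2) by (intro sum.group[symmetric]) (auto simp: P_def)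
  also have "\<dots> = (\<Sum>e\<in>E. g e)"
  proof (rule sum.cong[OF refl])
    fix e assume e: "e \<in> E"
    obtain a b where ab: "e = {a, b}" "a \<noteq> b" using simple_graph_edge[OF G e] by blast
    have "{p \<in> P. {fst p, snd p} = e} = {(a, b), (b, a)}"
      using e ab by (auto simp: P_def doubleton_eq_iff insert_commute)
    then show "(\<Sum>p\<in>{p \<in> P. {fst p, snd p} = e}. x (fst p) * x (snd p)) = g e"
      using ab e g[of a b] by simp
  qed
  finally show ?thesis .
qed

lemma graph_matrix_total:
  assumes "simple_graph V E"
  shows "qf (\<Union>E) (graph_matrix E) (\<lambda>_. 1) = 2 * card E"
  using graph_matrix_qf[OF assms, of "\<lambda>_. 1" "\<lambda>_. 2"] by simp

lemma graph_matrix_cut: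
  assumes G: "simple_graph V E" and x: "\<And>i. i \<in> \<Union>E \<Longrightarrow> x i \<in> {-1, 1}"
  shows "\<exists>U W. is_cut V U W \<and> qf (\<Union>E) (graph_matrix E) x = 2 * card E - 4 * real (cut_size E U W)"
proof -
  note fin = simple_graph_finite[OF G]
  \<comment> \<open>Isolated vertices are placed by whatever value \<open>x\<close> has there; they
    meet no edge.\<close>
  define U where "U = {i \<in> V. x i = 1}"
  define W where "W = V - U"
  have "is_cut V U W" by (auto simp: is_cut_def U_def W_def)
  define g where "g = (\<lambda>e. 2 - 4 * (if e \<in> cut_edges E U W then 1 else (0::real)))"
  have "qf (\<Union>E) (graph_matrix E) x = (\<Sum>e\<in>E. g e)"
  proof (rule graph_matrix_qf[OF G])
    fix a b assume ab: "{a, b} \<in> E" "a \<noteq> b"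
    have V: "a \<in> V" "b \<in> V" using ab fin(3) by auto
    have "x a \<in> {-1, 1}" "x b \<in> {-1, 1}" using x[of a] x[of b] ab(1) by blast+
    then consider "x a = 1" "x b = 1" | "x a = 1" "x b = -1" | "x a = -1" "x b = 1" | "x a = -1" "x b = -1"
      by auto
    then show "2 * x a * x b = g {a, b}"
      by cases (use ab V in \<open>auto simp: g_def cut_edges_def U_def W_def Int_insert_left\<close>)
  qed
  also have "\<dots> = 2 * card E - 4 * real (cut_size E U W)"
  proof -
    have "(\<Sum>e\<in>E. if e \<in> cut_edges E U W then 1 else (0::real)) = real (card (E \<inter> cut_edges E U W))"
      using fin(2) by (simp add: sum.inter_restrict[symmetric])
    also have "E \<inter> cut_edges E U W = cut_edges E U W" by (auto simp: cut_edges_def)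
    finally show ?thesis by (simp add: g_def sum_subtractf cut_size_def sum_distrib_left[symmetric])
  qed
  finally show ?thesis using \<open>is_cut V U W\<close> by blast
qed

lemma cut_bounded_graph_matrix:
  assumes G: "simple_graph V E" and "\<And>U W. is_cut V U W \<Longrightarrow> real (cut_size E U W) \<le> real (card E) / 2 + s"
  shows "cut_bounded (\<Union>E) (graph_matrix E) (4 * s)"
  unfolding cut_bounded_def
proof (intro allI impI)
  fix x :: "'a \<Rightarrow> real" assume x: "\<forall>i\<in>\<Union>E. \<bar>x i\<bar> \<le> 1"
  obtain y where y: "\<forall>i\<in>\<Union>E. y i \<in> {-1, 1}" "qf (\<Union>E) (graph_matrix E) y \<le> qf (\<Union>E) (graph_matrix E) x"
    using round_to_signs[OF adjacency_graph_matrix[OF G] subset_refl, of x] x by blast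
  obtain U W where "is_cut V U W" "qf (\<Union>E) (graph_matrix E) y = 2 * card E - 4 * real (cut_size E U W)"
    using graph_matrix_cut[OF G, of y] y(1) by blast
  then show "- (4 * s) \<le> qf (\<Union>E) (graph_matrix E) x" using assms(2) y(2) by fastforce
qed

lemma qf_one_restrict:
  assumes A: "adjacency V A" and S: "S \<subseteq> V"
  shows "qf V A (\<lambda>_. 1) \<le> qf S A (\<lambda>_. 1) + 2 * real (card (V - S)) * real (card V)"
proof -
  note fin = adjacencyD(1)[OF A]
  have le1: "A i j \<le> 1" if "i \<in> V" "j \<in> V" for i j using adjacencyD(3)[OF A that] by auto
  have "qf V A (\<lambda>_. 1) = (\<Sum>i\<in>V - S. \<Sum>j\<in>V. A i j) + (\<Sum>i\<in>S. (\<Sum>j\<in>V - S. A i j) + (\<Sum>j\<in>S. A i j))"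
    by (simp add: qf_def sum.subset_diff[OF S fin, symmetric])
  also have "\<dots> \<le> (\<Sum>i\<in>V - S. \<Sum>j\<in>V. 1) + (\<Sum>i\<in>S. (\<Sum>j\<in>V - S. 1) + (\<Sum>j\<in>S. A i j))"
    using le1 S by (intro add_mono sum_mono) auto
  also have "\<dots> = real (card (V - S)) * real (card V) + real (card S) * real (card (V - S)) + qf S A (\<lambda>_. 1)"
    by (simp add: sum.distrib qf_def)
  also have "real (card S) * real (card (V - S)) \<le> real (card V) * real (card (V - S))"
    using card_mono[OF fin S] by (intro mult_right_mono) auto
  finally show ?thesis by (simp add: mult_ac)
qed

text \<open>Duality bounds only the sum of the diagonal, so the vertices with
  \<open>d i + 1 > K\<close> are discarded: there are at most 4 B / K of them, and each meets at
  most 2 |V| ordered pairs.\<close>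

lemma psd_subgraph:
  fixes K :: real
  assumes A: "adjacency V A" "V \<noteq> {}" and H: "cut_bounded V A H" "1 \<le> H" and K: "2 \<le> K"
  defines "B \<equiv> H * (2 * ln (16 * H))\<^sup>2 + 3 * real (card V)"
  shows "\<exists>S M. S \<subseteq> V \<and> psd_graph S M K \<and> (\<forall>i\<in>S. \<forall>j\<in>S. i \<noteq> j \<longrightarrow> M i j = A i j) \<and>
    qf V A (\<lambda>_. 1) \<le> weight S M + 8 * B * real (card V) / K"
proof -
  note fin = adjacencyD(1)[OF A(1)]
  have V1: "0 < real (card V)" using fin A(2) by (simp add: card_gt_0_iff)
  have B0: "0 < B" using V1 H(2) by (simp add: B_def add_nonneg_pos)
  have "\<exists>d. (\<forall>i. 0 \<le> d i) \<and> (\<Sum>i\<in>V. d i) \<le> 2 * B \<and>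
      psd V (\<lambda>i j. A i j + (if i = j then d i + 1 else 0))"
  proof (rule semidefinite_dual[OF A B0])
    fix x :: "nat \<Rightarrow> 'a \<Rightarrow> real" and I and g :: real
    assume "finite I" "0 < g" "\<And>i. i \<in> V \<Longrightarrow> (\<Sum>t\<in>I. (x t i)\<^sup>2) \<le> g"
    then show "- g * B \<le> (\<Sum>t\<in>I. qf V A (x t))"
      unfolding B_def by (intro semidefinite_bound[OF A(1) H])
  qed
  then obtain d where d: "\<forall>i. 0 \<le> d i" "(\<Sum>i\<in>V. d i) \<le> 2 * B"
    "psd V (\<lambda>i j. A i j + (if i = j then d i + 1 else 0))" by blast
  define M where "M = (\<lambda>i j. A i j + (if i = j then d i + 1 else 0))"
  define S where "S = {i \<in> V. d i + 1 \<le> K}"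
  have S: "S \<subseteq> V" by (auto simp: S_def)
  have G: "psd_graph S M K"
    unfolding psd_graph_def
  proof (intro conjI ballI impI)
    show "finite S" using fin by (simp add: S_def)
    show "psd S M" using psd_subset[OF d(3) fin S] by (simp add: M_def)
    show "1 \<le> K" using K by simp
  next
    fix i assume "i \<in> S"
    then show "M i i \<le> K" using adjacencyD(4)[OF A(1), of i] by (simp add: M_def S_def)
  next
    fix i j assume "i \<in> S" "j \<in> S" "i \<noteq> j"
    then show "M i j \<in> {0, 1}" using adjacencyD(3)[OF A(1), of i j] by (simp add: M_def S_def)
  qed
  have w: "weight S M = qf S A (\<lambda>_. 1)"
    unfolding weight_def qf_def
    using adjacencyD(4)[OF A(1)] S by (intro sum.cong refl) (auto simp: adj_def M_def)
  have "real (card (V - S)) * (K - 1) = (\<Sum>i\<in>V - S. K - 1)" by simp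
  also have "\<dots> \<le> (\<Sum>i\<in>V - S. d i)" by (intro sum_mono) (auto simp: S_def)
  also have "\<dots> \<le> (\<Sum>i\<in>V. d i)" using fin d(1) by (intro sum_mono2) auto
  finally have "real (card (V - S)) * (K - 1) \<le> 2 * B" using d(2) by linarith
  moreover have "real (card (V - S)) * (K / 2) \<le> real (card (V - S)) * (K - 1)"
    using K by (intro mult_left_mono) auto
  ultimately have "real (card (V - S)) * K \<le> 4 * B" by simp
  then have "real (card (V - S)) \<le> 4 * B / K" using K by (simp add: field_simps)
  then have "2 * real (card (V - S)) * real (card V) \<le> 2 * (4 * B / K) * real (card V)"
    by (intro mult_right_mono mult_left_mono) auto
  then have "qf V A (\<lambda>_. 1) \<le> weight S M + 8 * B * real (card V) / K"
    using qf_one_restrict[OF A(1) S] w by simp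
  moreover have "\<forall>i\<in>S. \<forall>j\<in>S. i \<noteq> j \<longrightarrow> M i j = A i j" by (simp add: M_def)
  ultimately show ?thesis using S G by blast
qed

theorem theorem1p1:
  shows "\<forall>\<delta>::real. \<delta> > 0 \<longrightarrow>
    (\<exists>\<epsilon>::real. \<epsilon> > 0 \<and>
      (\<exists>m\<^sub>0::nat. \<forall>m::nat. m \<ge> m\<^sub>0 \<longrightarrow>
        (\<forall>(V :: 'a set) E.
          simple_graph V E \<longrightarrow> card E = m \<longrightarrow>
          \<not> (\<exists>K. K \<subseteq> V \<and> clique K E \<and> real (card K) \<ge> real m powr (1/2 - \<delta>)) \<longrightarrow>
          (\<exists>U W. is_cut V U W \<and>
            real (cut_size E U W) \<ge> real m / 2 + real m powr (1/2 + \<epsilon>)))))"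
proof (intro allI impI)
  fix \<delta> :: real assume \<delta>: "\<delta> > 0"
  \<comment> \<open>The cap 1/2 keeps the exponent 1 - \<alpha> nonnegative.\<close>
  define \<alpha> where "\<alpha> = min \<delta> (1 / 2)"
  have \<alpha>: "0 < \<alpha>" "\<alpha> \<le> \<delta>" "\<alpha> \<le> 1 / 2" using \<delta> by (auto simp: \<alpha>_def)
  obtain \<epsilon>\<^sub>1 N0 where \<epsilon>1: "0 < \<epsilon>\<^sub>1" and clq: "\<And>(V :: 'a set) M K N. psd_graph V M K \<Longrightarrow>
    N = real (card V) \<Longrightarrow> N0 \<le> N \<Longrightarrow> K \<le> N powr \<epsilon>\<^sub>1 \<Longrightarrow> N powr (2 - \<epsilon>\<^sub>1) \<le> weight V M \<Longrightarrow>
    \<exists>I\<subseteq>V. (\<forall>i\<in>I. \<forall>j\<in>I. i \<noteq> j \<longrightarrow> M i j = 1) \<and> N powr (1 - \<alpha>) \<le> real (card I)"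
    using psd_graph_large_clique[OF \<alpha>(1), where 'a = 'a] by metis
  \<comment> \<open>This gives K = m^(3 \<epsilon>) \<le> N^(6 \<epsilon>) with 6 \<epsilon> \<le>
    \<open>\<epsilon>\<^sub>1\<close>, and 2 \<epsilon> \<le> \<open>\<epsilon>\<^sub>1 / 4\<close>
    in the density estimate.\<close>
  define \<epsilon> where "\<epsilon> = min (1 / 2) (\<epsilon>\<^sub>1 / 8)"
  have \<epsilon>: "0 < \<epsilon>" "\<epsilon> \<le> 1 / 2" "8 * \<epsilon> \<le> \<epsilon>\<^sub>1" using \<epsilon>1 by (auto simp: \<epsilon>_def)
  \<comment> \<open>The first summand comes from bounding a squared logarithm by m^(\<epsilon>/2);
    the 5 covers 3 |X| \<le> 9/2 H.\<close>
  define C where "C = 512 / \<epsilon>\<^sup>2 + 5"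
  obtain m1 where m1: "\<And>m. m1 \<le> m \<Longrightarrow> 1 \<le> m \<and> 768 * C \<le> m powr (\<epsilon> / 2)"
    using powr_eventually_large[of "\<epsilon> / 2" "768 * C"] \<epsilon> by auto
  obtain m2 where m2: "\<And>m. m2 \<le> m \<Longrightarrow> 36 \<le> m powr (\<epsilon>\<^sub>1 / 4)"
    using powr_eventually_large[of "\<epsilon>\<^sub>1 / 4" 36] \<epsilon>1 by auto
  obtain m3 where m3: "\<And>m. m3 \<le> m \<Longrightarrow> N0 \<le> m powr (1 / 2)"
    using powr_eventually_large[of "1 / 2" N0] by auto
  obtain m0 :: nat where m0: "max m1 (max m2 m3) \<le> real m0" using real_arch_simple by blast
  show "\<exists>\<epsilon>::real. \<epsilon> > 0 \<and>
      (\<exists>m\<^sub>0::nat. \<forall>m::nat. m \<ge> m\<^sub>0 \<longrightarrow>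
        (\<forall>(V :: 'a set) E.
          simple_graph V E \<longrightarrow> card E = m \<longrightarrow>
          \<not> (\<exists>K. K \<subseteq> V \<and> clique K E \<and> real (card K) \<ge> real m powr (1/2 - \<delta>)) \<longrightarrow>
          (\<exists>U W. is_cut V U W \<and>
            real (cut_size E U W) \<ge> real m / 2 + real m powr (1/2 + \<epsilon>))))"
  proof (rule exI[of _ \<epsilon>], intro conjI, rule \<epsilon>(1), rule exI[of _ m0], intro allI impI)
    fix n :: nat and V :: "'a set" and E
    assume n: "n \<ge> m0" and G: "simple_graph V E" and E: "card E = n"
      and no_clique: "\<not> (\<exists>K. K \<subseteq> V \<and> clique K E \<and> real (card K) \<ge> real n powr (1/2 - \<delta>))"
    define m where "m = real n"
    have m: "1 \<le> m" "768 * C \<le> m powr (\<epsilon> / 2)" "36 \<le> m powr (\<epsilon>\<^sub>1 / 4)" "N0 \<le> m powr (1 / 2)"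
      using m1[of m] m2[of m] m3[of m] m0 n by (auto simp: m_def)
    show "\<exists>U W. is_cut V U W \<and> real (cut_size E U W) \<ge> real n / 2 + real n powr (1/2 + \<epsilon>)"
    proof (rule ccontr)
      assume no_cut: "\<not> ?thesis"
      define H where "H = 4 * m powr (1 / 2 + \<epsilon>)"
      \<comment> \<open>Isolated vertices are dropped: the cut hypothesis bounds only the number of
        the others.\<close>
      define X where "X = \<Union>E"
      define A where "A = graph_matrix E"
      have A: "adjacency X A" unfolding X_def A_def by (rule adjacency_graph_matrix[OF G])
      have H: "cut_bounded X A H"
        unfolding X_def A_def H_def
        by (rule cut_bounded_graph_matrix[OF G]) (use no_cut E in \<open>auto simp: m_def not_le less_imp_le\<close>)
      have "m powr 0 \<le> m powr (1 / 2 + \<epsilon>)" using m(1) \<epsilon> by (intro powr_mono) auto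
      then have H1: "1 \<le> H" using m(1) by (simp add: H_def)
      have "E \<noteq> {}" using E m(1) by (auto simp: m_def)
      then have Xne: "X \<noteq> {}" using simple_graph_edge[OF G] unfolding X_def by blast
      have "\<exists>j\<in>X. A i j = 1" if i: "i \<in> X" for i
      proof -
        obtain e where e: "e \<in> E" "i \<in> e" using i by (auto simp: X_def)
        obtain a b where ab: "e = {a, b}" using simple_graph_edge[OF G e(1)] by blast
        define j where "j = (if i = a then b else a)"
        have "{i, j} = e" using e(2) ab by (auto simp: j_def)
        then have "A i j = 1" "j \<in> X" using e(1) by (auto simp: A_def graph_matrix_def X_def)
        then show ?thesis by blast
      qed
      then have cardX: "2 * real (card X) \<le> 3 * H" by (rule nonisolated_vertices_bound[OF A H])
      \<comment> \<open>B |X| is at most a constant times m^(1 + 5/2 \<epsilon>). The exponent 3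
        \<epsilon> leaves m^(\<epsilon>/2) to absorb the constant, so deletion loses at most m of
        the 2 m ordered adjacent pairs.\<close>
      define K where "K = m powr (3 * \<epsilon>)"
      have C5: "5 \<le> C" by (simp add: C_def)
      have K2: "2 \<le> K"
      proof -
        have "m powr (\<epsilon> / 2) \<le> K" unfolding K_def using m(1) \<epsilon> by (intro powr_mono) auto
        then show ?thesis using m(2) C5 by linarith
      qed
      define B where "B = H * (2 * ln (16 * H))\<^sup>2 + 3 * real (card X)"
      obtain S M where S: "S \<subseteq> X" and SG: "psd_graph S M K"
        and SM: "\<forall>i\<in>S. \<forall>j\<in>S. i \<noteq> j \<longrightarrow> M i j = A i j"
        and SW: "qf X A (\<lambda>_. 1) \<le> weight S M + 8 * B * real (card X) / K"
        using psd_subgraph[OF A Xne H H1 K2] unfolding B_def by blast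
      have B_le: "B \<le> H * (C * m powr (\<epsilon> / 2))"
      proof -
        have "H \<le> 4 * m powr 1" unfolding H_def using m(1) \<epsilon> by (intro mult_left_mono powr_mono) auto
        then have "ln (16 * H) \<le> ln (64 * m)" using m(1) H1 by simp
        also have "\<dots> \<le> (64 * m) powr (\<epsilon> / 4) / (\<epsilon> / 4)" using m(1) \<epsilon> by (intro ln_powr_bound) auto
        finally have "(2 * ln (16 * H))\<^sup>2 \<le> (2 * ((64 * m) powr (\<epsilon> / 4) / (\<epsilon> / 4)))\<^sup>2"
          using H1 by (intro power_mono mult_left_mono) auto
        also have "\<dots> = 64 / \<epsilon>\<^sup>2 * ((64 * m) powr (\<epsilon> / 4))\<^sup>2" by (simp add: power2_eq_square)
        also have "((64 * m) powr (\<epsilon> / 4))\<^sup>2 = (64 * m) powr (\<epsilon> / 2)"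
          by (simp add: power2_eq_square flip: powr_add)
        also have "\<dots> = 64 powr (\<epsilon> / 2) * m powr (\<epsilon> / 2)" by (rule powr_mult)
        also have "64 / \<epsilon>\<^sup>2 * (64 powr (\<epsilon> / 2) * m powr (\<epsilon> / 2)) \<le> 64 / \<epsilon>\<^sup>2 * (8 * m powr (\<epsilon> / 2))"
        proof (intro mult_left_mono mult_right_mono)
          have "64 powr (\<epsilon> / 2) \<le> (64 :: real) powr (1 / 2)" using \<epsilon> by (intro powr_mono) auto
          also have "\<dots> = sqrt 64" by (rule powr_half_sqrt) simp
          also have "\<dots> = 8" by (rule real_sqrt_unique) auto
          finally show "64 powr (\<epsilon> / 2) \<le> (8 :: real)" .
        qed auto
        finally have "(2 * ln (16 * H))\<^sup>2 \<le> 512 / \<epsilon>\<^sup>2 * m powr (\<epsilon> / 2)" by simp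
        moreover have "5 \<le> 5 * m powr (\<epsilon> / 2)" using m(1) \<epsilon> by (simp add: ge_one_powr_ge_zero)
        ultimately have "(2 * ln (16 * H))\<^sup>2 + 5 \<le> C * m powr (\<epsilon> / 2)" by (simp add: C_def distrib_right)
        then have "H * ((2 * ln (16 * H))\<^sup>2 + 5) \<le> H * (C * m powr (\<epsilon> / 2))" using H1 by (intro mult_left_mono) auto
        moreover have "B \<le> H * ((2 * ln (16 * H))\<^sup>2 + 5)" using cardX H1 by (simp add: B_def distrib_left)
        ultimately show ?thesis by linarith
      qed
      have "8 * B * real (card X) \<le> m * K"
      proof -
        have "8 * B * real (card X) \<le> 8 * (H * (C * m powr (\<epsilon> / 2))) * (3 / 2 * H)"
        proof (intro mult_mono B_le)
          show "real (card X) \<le> 3 / 2 * H" using cardX by linarith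
        qed (use H1 C5 in \<open>auto simp: B_def\<close>)
        also have "\<dots> = 192 * C * (m powr (1 / 2 + \<epsilon>) * m powr (1 / 2 + \<epsilon>) * m powr (\<epsilon> / 2))"
          by (simp add: H_def)
        also have "m powr (1 / 2 + \<epsilon>) * m powr (1 / 2 + \<epsilon>) * m powr (\<epsilon> / 2) = m powr (1 + 5 / 2 * \<epsilon>)"
          by (simp add: algebra_simps flip: powr_add)
        also have "192 * C * m powr (1 + 5 / 2 * \<epsilon>) \<le> m powr (\<epsilon> / 2) * m powr (1 + 5 / 2 * \<epsilon>)"
          using m(2) C5 by (intro mult_right_mono) auto
        also have "\<dots> = m * K" using m(1) by (simp add: K_def powr_add[symmetric] powr_mult_base add.commute)
        finally show ?thesis .
      qed
      then have "8 * B * real (card X) / K \<le> m" using K2 by (simp add: field_simps)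
      moreover have "qf X A (\<lambda>_. 1) = 2 * m"
        unfolding X_def A_def using graph_matrix_total[OF G] E by (simp add: m_def)
      ultimately have wm: "m \<le> weight S M" using SW by linarith
      define N where "N = real (card S)"
      \<comment> \<open>So \<open>N\<close> lies between m^(1/2) and 6 m^(1/2 + \<epsilon>), which
        makes a weight of at least \<open>m\<close> almost quadratic in \<open>N\<close>.\<close>
      have "m \<le> N\<^sup>2" using wm weight_le[OF SG] by (simp add: N_def)
      then have "sqrt m \<le> N" by (intro real_le_lsqrt) (auto simp: N_def)
      then have N_ge: "m powr (1 / 2) \<le> N" using m(1) by (simp add: powr_half_sqrt)
      have finX: "finite X" using adjacencyD(1)[OF A] .
      have N_le: "N \<le> 6 * m powr (1 / 2 + \<epsilon>)"
        using card_mono[OF finX S] cardX by (simp add: N_def H_def)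
      have N1: "1 \<le> N" using N_ge ge_one_powr_ge_zero[OF m(1), of "1 / 2"] by simp
      have KN: "K \<le> N powr \<epsilon>\<^sub>1"
      proof -
        have "K = (m powr (1 / 2)) powr (6 * \<epsilon>)" by (simp add: K_def powr_powr)
        also have "\<dots> \<le> N powr (6 * \<epsilon>)" using N_ge \<epsilon> by (intro powr_mono2) auto
        also have "\<dots> \<le> N powr \<epsilon>\<^sub>1" using N1 \<epsilon> by (intro powr_mono) auto
        finally show ?thesis .
      qed
      have "N powr (2 - \<epsilon>\<^sub>1) \<le> weight S M"
      proof -
        have "N powr (2 - \<epsilon>\<^sub>1) = N\<^sup>2 / N powr \<epsilon>\<^sub>1" using N1 by (simp add: powr_diff powr_numeral)
        also have "\<dots> \<le> (6 * m powr (1 / 2 + \<epsilon>))\<^sup>2 / (m powr (1 / 2)) powr \<epsilon>\<^sub>1"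
          using N_le N_ge N1 m(1) \<epsilon>1 by (intro frac_le power_mono powr_mono2) auto
        also have "\<dots> = 36 * m powr (1 + 2 * \<epsilon>) / m powr (\<epsilon>\<^sub>1 / 2)"
          using m(1) by (simp add: power_mult_distrib powr_power powr_powr distrib_right mult.commute)
        also have "\<dots> = 36 * m powr (1 + 2 * \<epsilon> - \<epsilon>\<^sub>1 / 2)" by (simp add: powr_diff)
        also have "\<dots> \<le> m powr (\<epsilon>\<^sub>1 / 4) * m powr (1 - \<epsilon>\<^sub>1 / 4)"
          using m \<epsilon> by (intro mult_mono powr_mono) auto
        also have "\<dots> = m" using m(1) by (simp flip: powr_add)
        finally show ?thesis using wm by linarith
      qed
      moreover have "N0 \<le> N" using m(4) N_ge by linarith
      ultimately obtain I where I: "I \<subseteq> S" "\<forall>i\<in>I. \<forall>j\<in>I. i \<noteq> j \<longrightarrow> M i j = 1" "N powr (1 - \<alpha>) \<le> real (card I)"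
        using clq[OF SG N_def _ KN] by blast
      have "clique I E"
        unfolding clique_def
      proof (intro ballI impI)
        fix i j assume ij: "i \<in> I" "j \<in> I" "i \<noteq> j"
        then have "A i j = 1" using I(1,2) SM by (metis subsetD)
        then show "{i, j} \<in> E" by (simp add: A_def graph_matrix_def split: if_splits)
      qed
      moreover have "I \<subseteq> V" using I(1) S simple_graph_finite(3)[OF G] by (auto simp: X_def)
      moreover have "m powr (1 / 2 - \<delta>) \<le> real (card I)"
      proof -
        have "m powr (1 / 2 - \<delta>) \<le> m powr (1 / 2 * (1 - \<alpha>))" using m(1) \<alpha> by (intro powr_mono) auto
        also have "\<dots> = (m powr (1 / 2)) powr (1 - \<alpha>)" by (simp add: powr_powr)
        also have "\<dots> \<le> N powr (1 - \<alpha>)" using N_ge \<alpha> by (intro powr_mono2) auto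
        finally show ?thesis using I(3) by linarith
      qed
      ultimately show False using no_clique by (auto simp: m_def)
    qed
  qed
qed

end
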